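(* Let $\dim\Omega=n+1$ and let $$Lu=\sum_{i,j}h_{ij}\frac{\partial^2u}{\partial x_i\partial x_j}+\sum_i b_i(x)\frac{\partial u}{\partial x_i}+c(x)u,$$ where $(h_{ij})$ is a symmetric matrix of signature $(n,1)$. Let $O\subset\Omega$ be bounded by two spacelike surfaces $\Sigma_i$ and $\Sigma_e$ and swept out by a family of spacelike surfaces $\Sigma_e(s)$. Let $u$ solve the initial value problem $$Lu=f\ \text{ on } O,\qquad u=g\ \text{ and }\ du=\omega\ \text{ on }\Sigma_i .$$ Let $p$ be the interpolation polynomial for this problem, so that $$L(u-p)=\Delta f\ \text{ on } O,\qquad u-p=\Delta g\ \text{ and }\ d(u-p)=\Delta\omega\ \text{ on }\Sigma_i .$$ Then, with a constant $C$, $$\int_{O(s)}|u-p|^2\,dV\le\int_{\Sigma_i^b(s)}|\Delta g|^2\,dS+C(s-s_0)\int_{\Sigma_i}\left(|\Delta g|^2+|\Delta\omega|^2\right)dS+C\int_{O(s)}|\Delta f|^2\,dV$$ for $s\in[s_0,s_1]$.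
   Context: $\Omega$ is a domain of dimension $n+1$ with coordinates $x_i$; $b_i$ and $c$ are coefficient functions on $\Omega$. Signature $(n,1)$ means $n$ positive eigenvalues and one negative eigenvalue; a hypersurface is spacelike if its conormal $\nu\neq0$ satisfies $\sum_{i,j}h_{ij}\nu_i\nu_j<0$. The initial data are a function $g$ and a 1-form $\omega$. The surface $\Sigma_i$ is the one carrying the initial data. The sweeping surfaces $\Sigma_e(s)$, $s\in[s_0,s_1]$, are the level sets $\{t=s\}$ in $\overline O$ of a function $t$, and $O(s)=\overline O\cap\{t\le s\}$ is the part of $\overline O$ swept out up to parameter $s$. $\Sigma_i^b(s)$ is the part of $\Sigma_i$ lying in $O(s)$. $dV$ and $dS$ are the volume and surface measures, and $|\cdot|$ of a 1-form is its pointwise norm. The interpolation polynomial $p$ is a multivariate polynomial constructed recursively so that it satisfies the equation $Lp=f$ at the points of a given finite set of interpolation points in $O$ and matches the initial data ($p=g$, $dp=\omega$) at the points of a given finite set of interpolation points on $\Sigma_i$. The symbols $\Delta f=f-Lp$, $\Delta g=g-p$ and $\Delta\omega=\omega-dp$ denote the residuals; here $\Delta$ is a difference, not the Laplacian. *)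

theory Defs
  imports "HOL-Analysis.Analysis"
begin

section \<open>Partial derivatives and the operator\<close>

definition pd :: "'m::finite \<Rightarrow> (real^'m \<Rightarrow> real) \<Rightarrow> real^'m \<Rightarrow> real" where
  "pd i u x = frechet_derivative u (at x) (axis i 1)"

text \<open>The 1-form du is represented by its vector of components, so its pointwise norm is the
  Euclidean norm of that vector.\<close>

definition grad :: "(real^'m::finite \<Rightarrow> real) \<Rightarrow> real^'m \<Rightarrow> real^'m" where
  "grad u x = (\<chi> i. pd i u x)"

text \<open>These two predicates are meant for open sets.\<close>

definition C1_on :: "(real^'m::finite) set \<Rightarrow> (real^'m \<Rightarrow> real) \<Rightarrow> bool" where
  "C1_on U u \<longleftrightarrow> (\<forall>x\<in>U. u differentiable (at x)) \<and> (\<forall>i. continuous_on U (pd i u))"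

definition C2_on :: "(real^'m::finite) set \<Rightarrow> (real^'m \<Rightarrow> real) \<Rightarrow> bool" where
  "C2_on U u \<longleftrightarrow> C1_on U u \<and> (\<forall>i. C1_on U (pd i u))"

definition L_op :: "(real^'m::finite \<Rightarrow> real^'m^'m) \<Rightarrow> (real^'m \<Rightarrow> real^'m) \<Rightarrow> (real^'m \<Rightarrow> real) \<Rightarrow>
    (real^'m \<Rightarrow> real) \<Rightarrow> real^'m \<Rightarrow> real" where
  "L_op h b c u x = (\<Sum>i\<in>UNIV. \<Sum>j\<in>UNIV. h x $ i $ j * pd i (pd j u) x)
     + (\<Sum>i\<in>UNIV. b x $ i * pd i u x) + c x * u x"

section \<open>Signature and spacelike surfaces\<close>

definition eigenspace :: "real^'m^'m::finite \<Rightarrow> real \<Rightarrow> (real^'m) set" where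
  "eigenspace A l = {v. A *v v = l *\<^sub>R v}"

text \<open>Eigenvalues are counted with multiplicity.  The definition is applied to symmetric matrices
  only, for which the multiplicity of an eigenvalue is the dimension of its eigenspace.\<close>

definition has_signature :: "real^'m^'m::finite \<Rightarrow> nat \<Rightarrow> nat \<Rightarrow> bool" where
  "has_signature A p q \<longleftrightarrow>
     (\<Sum>l\<in>{l. 0 < l \<and> eigenspace A l \<noteq> {0}}. dim (eigenspace A l)) = p \<and>
     (\<Sum>l\<in>{l. l < 0 \<and> eigenspace A l \<noteq> {0}}. dim (eigenspace A l)) = q"

definition timelike_conormal :: "real^'m^'m::finite \<Rightarrow> real^'m \<Rightarrow> bool" where
  "timelike_conormal A v \<longleftrightarrow> v \<noteq> 0 \<and> (\<Sum>i\<in>UNIV. \<Sum>j\<in>UNIV. A $ i $ j * v $ i * v $ j) < 0"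

text \<open>An embedded hypersurface without boundary, given locally as the zero set of a
  continuously differentiable function whose differential is a conormal.\<close>

definition spacelike_hypersurface :: "(real^'m::finite \<Rightarrow> real^'m^'m) \<Rightarrow> (real^'m) set \<Rightarrow> bool" where
  "spacelike_hypersurface h M \<longleftrightarrow>
     (\<forall>x\<in>M. \<exists>U \<sigma>. open U \<and> x \<in> U \<and> C1_on U \<sigma> \<and> M \<inter> U = {y\<in>U. \<sigma> y = 0} \<and>
        (\<forall>y\<in>M \<inter> U. timelike_conormal (h y) (grad \<sigma> y)))"

text \<open>The bounding surfaces are compact pieces of hypersurfaces: the closure of a relatively open
  part.  Nothing is required of the shape of the edge.\<close>

definition spacelike_surface ::
    "(real^'m::finite \<Rightarrow> real^'m^'m) \<Rightarrow> (real^'m) set \<Rightarrow> (real^'m) set \<Rightarrow> bool" where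
  "spacelike_surface h \<Omega> S \<longleftrightarrow> compact S \<and>
     (\<exists>M. M \<subseteq> \<Omega> \<and> spacelike_hypersurface h M \<and> S \<subseteq> M \<and>
        S = closure (top_of_set M interior_of S))"

definition sweep :: "(real^'m::finite) set \<Rightarrow> (real^'m \<Rightarrow> real) \<Rightarrow> real \<Rightarrow> (real^'m) set" where
  "sweep D t s = {x \<in> closure D. t x = s}"

definition swept :: "(real^'m::finite) set \<Rightarrow> (real^'m \<Rightarrow> real) \<Rightarrow> real \<Rightarrow> (real^'m) set" where
  "swept D t s = {x \<in> closure D. t x \<le> s}"

text \<open>A function t whose level sets in the closure of D are spacelike surfaces that sweep out D as
  the level runs from s0 to s1.  The differential of t is a conormal of its level sets.\<close>

definition spacelike_sweeping :: "(real^'m::finite \<Rightarrow> real^'m^'m) \<Rightarrow> (real^'m) set \<Rightarrow>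
    (real^'m \<Rightarrow> real) \<Rightarrow> real \<Rightarrow> real \<Rightarrow> bool" where
  "spacelike_sweeping h D t s0 s1 \<longleftrightarrow>
     (\<exists>W. open W \<and> closure D \<subseteq> W \<and> C1_on W t) \<and>
     closure D = (\<Union>s\<in>{s0..s1}. sweep D t s) \<and>
     (\<forall>s\<in>{s0..s1}. \<forall>x\<in>sweep D t s. timelike_conormal (h x) (grad t x))"

section \<open>Initial value problem and interpolation\<close>

text \<open>Classical solutions: twice continuously differentiable in the open set D, and continuously
  differentiable up to the boundary.  At points of S the value of du is that of the continuous
  extension V of du from D.\<close>

definition solves_ivp :: "(real^'m::finite \<Rightarrow> real^'m^'m) \<Rightarrow> (real^'m \<Rightarrow> real^'m) \<Rightarrow> (real^'m \<Rightarrow> real) \<Rightarrow>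
    (real^'m) set \<Rightarrow> (real^'m) set \<Rightarrow>
    (real^'m \<Rightarrow> real) \<Rightarrow> (real^'m \<Rightarrow> real) \<Rightarrow> (real^'m \<Rightarrow> real^'m) \<Rightarrow> (real^'m \<Rightarrow> real) \<Rightarrow> bool" where
  "solves_ivp h b c D S f g \<omega> u \<longleftrightarrow>
     C2_on D u \<and> continuous_on (closure D) u \<and>
     (\<forall>x\<in>D. L_op h b c u x = f x) \<and>
     (\<forall>x\<in>S. u x = g x) \<and>
     (\<exists>V. continuous_on (closure D) V \<and> (\<forall>x\<in>D. V x = grad u x) \<and> (\<forall>x\<in>S. V x = \<omega> x))"

definition interpolation_polynomial :: "(real^'m::finite \<Rightarrow> real^'m^'m) \<Rightarrow> (real^'m \<Rightarrow> real^'m) \<Rightarrow>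
    (real^'m \<Rightarrow> real) \<Rightarrow> (real^'m) set \<Rightarrow> (real^'m) set \<Rightarrow>
    (real^'m \<Rightarrow> real) \<Rightarrow> (real^'m \<Rightarrow> real) \<Rightarrow> (real^'m \<Rightarrow> real^'m) \<Rightarrow> (real^'m \<Rightarrow> real) \<Rightarrow> bool" where
  "interpolation_polynomial h b c P Q f g \<omega> p \<longleftrightarrow>
     real_polynomial_function p \<and>
     (\<forall>x\<in>P. L_op h b c p x = f x) \<and>
     (\<forall>x\<in>Q. p x = g x \<and> grad p x = \<omega> x)"

section \<open>Surface measure\<close>

text \<open>The surface measure of hypersurfaces in (n+1)-dimensional space is n-dimensional Hausdorff
  measure on the Borel sets, normalised to agree with Lebesgue measure on n-dimensional planes.
  The outer measure is a metric outer measure, hence countably additive on Borel sets, so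
  \<open>measure_of\<close> does not collapse to the zero measure.  Boundedness of the covering sets is required
  explicitly because \<open>diameter\<close> has no meaningful value on unbounded sets.\<close>

definition hausdorff_weight :: "nat \<Rightarrow> 'a::euclidean_space set \<Rightarrow> ennreal" where
  "hausdorff_weight n A =
     (if A = {} then 0 else ennreal (unit_ball_vol (real n) * (diameter A / 2) ^ n))"

definition hausdorff_pre :: "nat \<Rightarrow> real \<Rightarrow> 'a::euclidean_space set \<Rightarrow> ennreal" where
  "hausdorff_pre n \<delta> A =
     (INF U \<in> {U :: nat \<Rightarrow> 'a set. A \<subseteq> (\<Union>k. U k) \<and> (\<forall>k. bounded (U k) \<and> diameter (U k) \<le> \<delta>)}.
        \<Sum>k. hausdorff_weight n (U k))"

definition hausdorff_outer :: "nat \<Rightarrow> 'a::euclidean_space set \<Rightarrow> ennreal" where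
  "hausdorff_outer n A = (SUP \<delta>\<in>{0<..}. hausdorff_pre n \<delta> A)"

definition hausdorff_measure :: "nat \<Rightarrow> 'a::euclidean_space measure" where
  "hausdorff_measure n = measure_of UNIV (sets borel) (hausdorff_outer n)"

end

theory Submission
  imports Defs
begin

text \<open>Write w = u - p and G = |w|^2 + |dw|^2.  Contracting the energy tensor of the principal part with a
  polynomial covector field \<open>\<tau>\<close> close to the timelike covector dt, and adding \<open>|w|\<^sup>2 \<tau>\<close>, gives a current J
  with \<open>J \<cdot> dt \<ge> c\<^sub>0 G\<close> and \<open>div J \<le> C\<^sub>1 (G + |Lw|\<^sup>2)\<close>.  Integrating the divergence of
  \<open>e\<^bsup>-kt\<^esup> (s - t)\<^sub>+ J\<close> with \<open>k = C\<^sub>1 / c\<^sub>0\<close> bounds the integral of G over O(s) directly by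
  \<open>s - s\<^sub>0\<close> times the data on the initial surface and the integral of \<open>|Lw|\<^sup>2\<close>: the weight vanishes on
  the upper boundary, so that no slicing by the surfaces \<open>\<Sigma>\<^sub>e(s)\<close> and no Gronwall argument is needed.

  The boundary integral over the initial surface is not computed.  The current is multiplied by a product of cutoff
  functions of balls of radius r that cover the surface; the gradient of each of them costs an integral of
  order \<open>r\<^sup>n |J|\<close>, and the infimum of the total cost over all fine covers is bounded by the Hausdorff integral of
  |J|.  This requires only that the surface has finite n-dimensional Hausdorff measure.\<close>

section \<open>Hausdorff measure\<close>

text \<open>The boundary is the obstacle. The edge of the initial surface is arbitrary and w is
  twice differentiable only inside D, so no divergence theorem for a domain with boundary applies.
  Multiplied by the cutoff and by the weight, the current has compact support in D, and the only
  integration by parts left is that a derivative of a compactly supported function has integral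
  zero. For this the positive part of s - t is smoothed so that it vanishes already slightly below
  the level s. The price is that the direction of the flux through the initial surface is lost: |J|
  is merely bounded by a multiple of G, which is harmless because the data term carries a constant
  anyway. The factor s - s0 is the bound of the weight on D. With k * c0 = C1 the derivative of the
  exponential cancels the part of the divergence that is bounded by G. The cost r^n of one cutoff is
  a gradient of order 1/r on a ball of volume of order r^(n + 1).\<close>

lemma hausdorff_weight_empty [simp]: "hausdorff_weight n {} = 0"
  by (simp add: hausdorff_weight_def)

lemma hausdorff_pre_le:
  assumes "A \<subseteq> (\<Union>k. U k)" "\<And>k. bounded (U k)" "\<And>k. diameter (U k) \<le> \<delta>"
  shows "hausdorff_pre n \<delta> A \<le> (\<Sum>k. hausdorff_weight n (U k))"
  unfolding hausdorff_pre_def using assms by (intro INF_lower) auto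

lemma hausdorff_pre_cover:
  assumes "hausdorff_pre n \<delta> A < y"
  obtains U :: "nat \<Rightarrow> 'a::euclidean_space set"
  where "A \<subseteq> (\<Union>k. U k)" "\<And>k. bounded (U k)" "\<And>k. diameter (U k) \<le> \<delta>"
    "(\<Sum>k. hausdorff_weight n (U k)) < y"
  using assms unfolding hausdorff_pre_def INF_less_iff by auto

lemma hausdorff_pre_mono: "A \<subseteq> B \<Longrightarrow> hausdorff_pre n \<delta> A \<le> hausdorff_pre n \<delta> B"
  unfolding hausdorff_pre_def by (intro INF_superset_mono) auto

lemma hausdorff_pre_antimono: "\<delta> \<le> \<epsilon> \<Longrightarrow> hausdorff_pre n \<epsilon> A \<le> hausdorff_pre n \<delta> A"
  unfolding hausdorff_pre_def by (intro INF_superset_mono) (auto intro: order_trans)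

lemma hausdorff_pre_le_outer: "0 < \<delta> \<Longrightarrow> hausdorff_pre n \<delta> A \<le> hausdorff_outer n A"
  unfolding hausdorff_outer_def by (intro SUP_upper) auto

lemma hausdorff_pre_empty [simp]: "0 \<le> \<delta> \<Longrightarrow> hausdorff_pre n \<delta> {} = 0"
  using hausdorff_pre_le[of "{}" "\<lambda>_. {}" \<delta> n] by (simp add: bot_unique[symmetric])

lemma hausdorff_outer_empty [simp]: "hausdorff_outer n {} = 0"
  unfolding hausdorff_outer_def by (rule antisym[OF SUP_least]) auto

lemma hausdorff_outer_mono: "A \<subseteq> B \<Longrightarrow> hausdorff_outer n A \<le> hausdorff_outer n B"
  unfolding hausdorff_outer_def by (intro SUP_mono') (rule hausdorff_pre_mono)

text \<open>Nearly optimal covers of the pieces, with excess e/2^(i + 1) for the i-th one, are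
  merged into one sequence by the pairing \<open>prod_decode\<close>.\<close>

lemma hausdorff_pre_countably_subadditive:
  "hausdorff_pre n \<delta> (\<Union>i. A i) \<le> (\<Sum>i. hausdorff_pre n \<delta> (A i :: 'a::euclidean_space set))"
proof (rule ennreal_le_epsilon)
  fix e :: real
  assume fin: "(\<Sum>i. hausdorff_pre n \<delta> (A i)) < top" and e: "0 < e"
  have "\<exists>U :: nat \<Rightarrow> 'a set. A i \<subseteq> (\<Union>k. U k) \<and> (\<forall>k. bounded (U k)) \<and> (\<forall>k. diameter (U k) \<le> \<delta>) \<and>
      (\<Sum>k. hausdorff_weight n (U k)) < hausdorff_pre n \<delta> (A i) + ennreal (e * (1/2)^Suc i)" for i
  proof -
    have "hausdorff_pre n \<delta> (A i) < top"
      using fin ennreal_suminf_lessD by blast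
    then have "hausdorff_pre n \<delta> (A i) < hausdorff_pre n \<delta> (A i) + ennreal (e * (1/2)^Suc i)"
      using e by (simp add: less_top)
    then show ?thesis by (metis hausdorff_pre_cover)
  qed
  then obtain U :: "nat \<Rightarrow> nat \<Rightarrow> 'a set" where U: "\<And>i. A i \<subseteq> (\<Union>k. U i k)" "\<And>i k. bounded (U i k)"
      "\<And>i k. diameter (U i k) \<le> \<delta>"
      "\<And>i. (\<Sum>k. hausdorff_weight n (U i k)) < hausdorff_pre n \<delta> (A i) + ennreal (e * (1/2)^Suc i)"
    by metis
  define V where "V m = (case prod_decode m of (i, k) \<Rightarrow> U i k)" for m
  have "(\<Union>i. A i) \<subseteq> (\<Union>m. V m)"
  proof
    fix x assume "x \<in> (\<Union>i. A i)"
    then obtain i k where "x \<in> U i k" using U(1) by blast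
    then have "x \<in> V (prod_encode (i,k))" by (simp add: V_def)
    then show "x \<in> (\<Union>m. V m)" by blast
  qed
  moreover have "bounded (V m)" "diameter (V m) \<le> \<delta>" for m
    using U(2,3) by (auto simp: V_def split: prod.split)
  ultimately have "hausdorff_pre n \<delta> (\<Union>i. A i) \<le> (\<Sum>m. hausdorff_weight n (V m))"
    by (rule hausdorff_pre_le)
  also have "\<dots> = (\<Sum>m. (\<lambda>(i,k). hausdorff_weight n (U i k)) (prod_decode m))"
    by (intro suminf_cong) (auto simp: V_def split: prod.split)
  also have "\<dots> = (\<Sum>i. \<Sum>k. hausdorff_weight n (U i k))"
    by (rule suminf_ennreal_2dimen) simp
  also have "\<dots> \<le> (\<Sum>i. hausdorff_pre n \<delta> (A i) + ennreal (e * (1/2)^Suc i))"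
    using U(4) by (intro suminf_le) (auto intro: less_imp_le)
  also have "\<dots> = (\<Sum>i. hausdorff_pre n \<delta> (A i)) + (\<Sum>i. ennreal (e * (1/2)^Suc i))"
    by (rule suminf_add[symmetric]) auto
  also have "(\<Sum>i. ennreal (e * (1/2)^Suc i)) = ennreal e"
    using sums_mult[OF power_half_series, of e] e by (intro suminf_ennreal_eq) auto
  finally show "hausdorff_pre n \<delta> (\<Union>i. A i) \<le> (\<Sum>i. hausdorff_pre n \<delta> (A i)) + ennreal e" .
qed

lemma hausdorff_outer_countably_subadditive:
  "hausdorff_outer n (\<Union>i. A i) \<le> (\<Sum>i. hausdorff_outer n (A i :: 'a::euclidean_space set))"
proof -
  have "hausdorff_pre n \<delta> (\<Union>i. A i) \<le> (\<Sum>i. hausdorff_outer n (A i))" if "0 < \<delta>" for \<delta>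
  proof -
    note hausdorff_pre_countably_subadditive
    also have "(\<Sum>i. hausdorff_pre n \<delta> (A i)) \<le> (\<Sum>i. hausdorff_outer n (A i))"
      using that by (intro suminf_le hausdorff_pre_le_outer) auto
    finally show ?thesis .
  qed
  then show ?thesis unfolding hausdorff_outer_def[of n "\<Union>i. A i"] by (intro SUP_least) auto
qed

lemma hausdorff_outer_space: "outer_measure_space (Pow UNIV) (hausdorff_outer n :: 'a::euclidean_space set \<Rightarrow> ennreal)"
  unfolding outer_measure_space_def positive_def increasing_def countably_subadditive_def
  using hausdorff_outer_countably_subadditive by (auto intro: hausdorff_outer_mono)

lemma hausdorff_outer_subadditive:
  "hausdorff_outer n (A \<union> B) \<le> hausdorff_outer n A + hausdorff_outer n (B :: 'a::euclidean_space set)"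
proof -
  interpret sigma_algebra UNIV "Pow UNIV :: 'a set set" by (rule sigma_algebra_Pow)
  have "subadditive (Pow UNIV) (hausdorff_outer n :: 'a set \<Rightarrow> ennreal)"
    using hausdorff_outer_space
    by (intro countably_subadditive_subadditive) (auto simp: outer_measure_space_def)
  then show ?thesis
    using hausdorff_outer_mono[of "A \<union> B" "A \<union> (B - A)" n] hausdorff_outer_mono[of "B - A" B n]
      subadditiveD[of "Pow UNIV" "hausdorff_outer n" A "B - A"]
    by (auto intro: order_trans add_left_mono)
qed

text \<open>A covering set of diameter at most \<delta> < d cannot meet both A and B, so every cover
  of the union splits into a cover of A and a cover of B with no set used twice.\<close>

lemma hausdorff_pre_separated:
  fixes A B :: "'a::euclidean_space set"
  assumes sep: "\<And>x y. x \<in> A \<Longrightarrow> y \<in> B \<Longrightarrow> d \<le> dist x y" and "0 \<le> \<delta>" "\<delta> < d"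
  shows "hausdorff_pre n \<delta> A + hausdorff_pre n \<delta> B \<le> hausdorff_pre n \<delta> (A \<union> B)"
proof -
  have "hausdorff_pre n \<delta> A + hausdorff_pre n \<delta> B \<le> (\<Sum>k. hausdorff_weight n (U k))"
    if U: "A \<union> B \<subseteq> (\<Union>k. U k)" "\<And>k. bounded (U k)" "\<And>k. diameter (U k) \<le> \<delta>"
    for U :: "nat \<Rightarrow> 'a set"
  proof -
    define V where "V C k = (if U k \<inter> C = {} then {} else U k)" for C k
    have pre: "hausdorff_pre n \<delta> C \<le> (\<Sum>k. hausdorff_weight n (V C k))" if C: "C \<subseteq> A \<union> B" for C
    proof (rule hausdorff_pre_le)
      show "C \<subseteq> (\<Union>k. V C k)"
      proof
        fix x assume x: "x \<in> C"
        then obtain k where "x \<in> U k" using C U(1) by blast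
        with x have "x \<in> V C k" by (auto simp: V_def)
        then show "x \<in> (\<Union>k. V C k)" by blast
      qed
    qed (use U assms in \<open>auto simp: V_def\<close>)
    have w: "hausdorff_weight n (V A k) + hausdorff_weight n (V B k) \<le> hausdorff_weight n (U k)" for k
    proof -
      have "U k \<inter> A = {} \<or> U k \<inter> B = {}"
      proof (rule ccontr)
        assume "\<not> ?thesis"
        then obtain x y where xy: "x \<in> U k" "x \<in> A" "y \<in> U k" "y \<in> B" by blast
        have "dist x y \<le> \<delta>"
          using diameter_bounded_bound[OF U(2) xy(1,3)] U(3)[of k] by simp
        with sep[OF xy(2,4)] assms show False by simp
      qed
      then show ?thesis by (auto simp: V_def)
    qed
    have "hausdorff_pre n \<delta> A + hausdorff_pre n \<delta> B
        \<le> (\<Sum>k. hausdorff_weight n (V A k)) + (\<Sum>k. hausdorff_weight n (V B k))"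
      by (intro add_mono pre) auto
    also have "\<dots> = (\<Sum>k. hausdorff_weight n (V A k) + hausdorff_weight n (V B k))"
      by (rule suminf_add) auto
    also have "\<dots> \<le> (\<Sum>k. hausdorff_weight n (U k))"
      by (intro suminf_le w) auto
    finally show ?thesis .
  qed
  then show ?thesis
    unfolding hausdorff_pre_def[of n \<delta> "A \<union> B"] by (intro INF_greatest) auto
qed

text \<open>Along an increasing sequence the supremum commutes with sums;
  \<open>hausdorff_outer_separated\<close> rests on this.\<close>

lemma hausdorff_outer_eq_SUP_seq:
  "hausdorff_outer n A = (SUP k::nat. hausdorff_pre n (inverse (Suc k)) A)"
proof (rule antisym)
  show "hausdorff_outer n A \<le> (SUP k::nat. hausdorff_pre n (inverse (Suc k)) A)"
    unfolding hausdorff_outer_def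
  proof (rule SUP_least)
    fix \<delta> :: real assume "\<delta> \<in> {0<..}"
    then obtain k where "inverse (real (Suc k)) < \<delta>"
      using reals_Archimedean by auto
    then have "hausdorff_pre n \<delta> A \<le> hausdorff_pre n (inverse (Suc k)) A"
      by (intro hausdorff_pre_antimono) auto
    also have "\<dots> \<le> (SUP k::nat. hausdorff_pre n (inverse (Suc k)) A)" by (rule SUP_upper) simp
    finally show "hausdorff_pre n \<delta> A \<le> \<dots>" .
  qed
  show "(SUP k::nat. hausdorff_pre n (inverse (Suc k)) A) \<le> hausdorff_outer n A"
    by (intro SUP_least hausdorff_pre_le_outer) auto
qed

lemma hausdorff_outer_separated:
  fixes A B :: "'a::euclidean_space set"
  assumes sep: "\<And>x y. x \<in> A \<Longrightarrow> y \<in> B \<Longrightarrow> d \<le> dist x y" and "0 < d"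
  shows "hausdorff_outer n A + hausdorff_outer n B \<le> hausdorff_outer n (A \<union> B)"
proof -
  have inc: "incseq (\<lambda>k::nat. hausdorff_pre n (inverse (Suc k)) C)" for C :: "'a set"
    by (intro incseq_SucI hausdorff_pre_antimono) (simp add: field_simps)
  have "hausdorff_outer n A + hausdorff_outer n B
      = (SUP k::nat. hausdorff_pre n (inverse (Suc k)) A + hausdorff_pre n (inverse (Suc k)) B)"
    unfolding hausdorff_outer_eq_SUP_seq by (rule ennreal_SUP_add[symmetric]) (rule inc)+
  also have "\<dots> \<le> hausdorff_outer n (A \<union> B)"
  proof (rule SUP_least)
    fix k :: nat
    obtain m where m: "inverse (real (Suc m)) < d" using reals_Archimedean assms(2) by blast
    \<comment> \<open>The scale has to be at most 1/(k + 1) for monotonicity and below d for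
      separation; m supplies the second.\<close>
    let ?\<delta> = "inverse (real (Suc (max k m)))"
    have le: "?\<delta> \<le> inverse (real (Suc k))" "?\<delta> \<le> inverse (real (Suc m))"
      by (intro le_imp_inverse_le; simp)+
    have "hausdorff_pre n (inverse (Suc k)) A + hausdorff_pre n (inverse (Suc k)) B
        \<le> hausdorff_pre n ?\<delta> A + hausdorff_pre n ?\<delta> B"
      using le by (intro add_mono hausdorff_pre_antimono) auto
    also have "\<dots> \<le> hausdorff_pre n ?\<delta> (A \<union> B)"
      by (rule hausdorff_pre_separated[OF sep _ le_less_trans[OF le(2) m]]) auto
    also have "\<dots> \<le> hausdorff_outer n (A \<union> B)" by (rule hausdorff_pre_le_outer) simp
    finally show "hausdorff_pre n (inverse (Suc k)) A + hausdorff_pre n (inverse (Suc k)) B \<le> hausdorff_outer n (A \<union> B)" .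
  qed
  finally show ?thesis .
qed

text \<open>Caratheodory's criterion: the distance shells around a closed set with indices of equal parity
  are separated, which makes the sum of their outer measures converge.\<close>

lemma hausdorff_outer_shells:
  fixes A F :: "'a::euclidean_space set"
  assumes F: "F \<noteq> {}" and fin: "hausdorff_outer n A < top"
  defines "B \<equiv> \<lambda>k::nat. {x\<in>A. inverse (real (k+2)) \<le> infdist x F \<and> infdist x F < inverse (real (k+1))}"
  shows "(\<Sum>k. hausdorff_outer n (B k)) < top"
proof -
  have part: "(\<Sum>j<N. hausdorff_outer n (B (2 * j + r))) \<le> hausdorff_outer n (\<Union>j<N. B (2 * j + r))" for N r
  proof (induction N)
    case (Suc N)
    have sep: "hausdorff_outer n (\<Union>j<N. B (2 * j + r)) + hausdorff_outer n (B (2 * N + r))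
      \<le> hausdorff_outer n ((\<Union>j<N. B (2 * j + r)) \<union> B (2 * N + r))"
    \<comment> \<open>For N = 0 the gap may involve the inverse of 0, which is 0 and gives no
      positive distance; the union is empty then.\<close>
    proof (cases "N = 0")
      case False
      show ?thesis
      proof (rule hausdorff_outer_separated[where d = "inverse (real (2*N+r)) - inverse (real (2*N+r+1))"])
        fix x y assume "x \<in> (\<Union>j<N. B (2 * j + r))" and y: "y \<in> B (2 * N + r)"
        then obtain j where j: "j < N" "x \<in> B (2 * j + r)" by auto
        have y': "infdist y F < inverse (real (2*N+r+1))" using y by (simp add: B_def)
        have "inverse (real (2*N+r)) \<le> inverse (real (2*j+r+2))" using j by (intro le_imp_inverse_le) auto
        also have "\<dots> \<le> infdist x F" using j by (simp add: B_def)
        finally show "inverse (real (2*N+r)) - inverse (real (2*N+r+1)) \<le> dist x y"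
          using infdist_triangle[of x F y] y' by linarith
      next
        have "0 < real (2*N+r)" using False by simp
        then show "0 < inverse (real (2*N+r)) - inverse (real (2*N+r+1))"
          by (simp add: inverse_less_iff_less)
      qed
    qed simp
    have "(\<Sum>j<Suc N. hausdorff_outer n (B (2 * j + r)))
        \<le> hausdorff_outer n (\<Union>j<N. B (2 * j + r)) + hausdorff_outer n (B (2 * N + r))"
      using Suc by (simp add: add_right_mono)
    also note sep
    also have "(\<Union>j<N. B (2 * j + r)) \<union> B (2 * N + r) = (\<Union>j<Suc N. B (2 * j + r))"
      by (auto simp: lessThan_Suc)
    finally show ?case .
  qed simp
  have par: "(\<Sum>j<N. hausdorff_outer n (B (2 * j + r))) \<le> hausdorff_outer n A" for N r
    by (rule order_trans[OF part hausdorff_outer_mono]) (auto simp: B_def)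
  have "(\<Sum>k. hausdorff_outer n (B k)) \<le> hausdorff_outer n A + hausdorff_outer n A"
  proof (rule suminf_le_const)
    fix N
    have "(\<Sum>k<N. hausdorff_outer n (B k)) \<le> (\<Sum>k<2*N. hausdorff_outer n (B k))"
      by (intro sum_mono2) auto
    also have "\<dots> = (\<Sum>j<N. hausdorff_outer n (B (2*j+0))) + (\<Sum>j<N. hausdorff_outer n (B (2*j+1)))"
      by (induction N) (auto simp: algebra_simps)
    also have "\<dots> \<le> hausdorff_outer n A + hausdorff_outer n A" by (intro add_mono par)
    finally show "(\<Sum>k<N. hausdorff_outer n (B k)) \<le> hausdorff_outer n A + hausdorff_outer n A" .
  qed simp
  also have "\<dots> < top" using fin by simp
  finally show ?thesis .
qed

text \<open>The part \<open>E k\<close> of A at distance at least 1/(k + 1) from F is separated from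
  F, so the outer measures of the two add up to at most that of A. The rest of A - F lies in shells
  of index at least k, whose total measure is the tail of a convergent series.\<close>

lemma closed_hausdorff_measurable:
  fixes F A :: "'a::euclidean_space set"
  assumes "closed F"
  shows "hausdorff_outer n (F \<inter> A) + hausdorff_outer n (A - F) \<le> hausdorff_outer n A"
proof (cases "F = {} \<or> hausdorff_outer n A = top")
  case True then show ?thesis by auto
next
  case False
  then have F: "F \<noteq> {}" and fin: "hausdorff_outer n A < top" by (auto simp: less_top)
  define B where "B \<equiv> \<lambda>k::nat. {x\<in>A. inverse (real (k+2)) \<le> infdist x F \<and> infdist x F < inverse (real (k+1))}"
  define E where "E \<equiv> \<lambda>k::nat. {x\<in>A. inverse (real (k+1)) \<le> infdist x F}"
  have sfin: "(\<Sum>k. hausdorff_outer n (B k)) < top"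
    using hausdorff_outer_shells[OF F fin] by (simp add: B_def)
  have cov: "A - F \<subseteq> E k \<union> (\<Union>j. B (j + k))" for k
  proof
    fix x assume x: "x \<in> A - F"
    then have pos: "0 < infdist x F"
      using assms F in_closed_iff_infdist_zero infdist_nonneg[of x F] by (metis DiffE less_eq_real_def)
    show "x \<in> E k \<union> (\<Union>j. B (j + k))"
    proof (cases "x \<in> E k")
      case False
      \<comment> \<open>m is the first index with 1/(m + 1) at most the distance to F, so x lies in
        the shell \<open>B (m - 1)\<close>; m > k because x is not in \<open>E k\<close>.\<close>
      define m where "m = (LEAST m. inverse (real (m+1)) \<le> infdist x F)"
      obtain m0 where "inverse (real (Suc m0)) < infdist x F" using reals_Archimedean[OF pos] by blast
      then have "inverse (real (m0+1)) \<le> infdist x F" by simp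
      then have m: "inverse (real (m+1)) \<le> infdist x F"
        unfolding m_def by (rule LeastI[where P = "\<lambda>m. inverse (real (m+1)) \<le> infdist x F"])
      have "k < m"
      proof (rule ccontr)
        assume "\<not> k < m"
        then have "inverse (real (k+1)) \<le> inverse (real (m+1))" by (intro le_imp_inverse_le) auto
        moreover have "infdist x F < inverse (real (k+1))" using False x by (simp add: E_def)
        ultimately show False using m by linarith
      qed
      have "\<not> inverse (real ((m-1)+1)) \<le> infdist x F"
        by (rule not_less_Least[where P = "\<lambda>m. inverse (real (m+1)) \<le> infdist x F", folded m_def])
          (use \<open>k < m\<close> in simp)
      then have "x \<in> B ((m - 1 - k) + k)"
        using \<open>k < m\<close> m x by (simp add: B_def not_le)
      then show ?thesis by blast
    qed simp
  qed
  have tail: "(\<lambda>k. \<Sum>j. hausdorff_outer n (B (j + k))) \<longlonglongrightarrow> 0"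
  proof -
    let ?f = "\<lambda>k. enn2real (hausdorff_outer n (B k))"
    have fk: "hausdorff_outer n (B k) = ennreal (?f k)" for k
      using sfin ennreal_suminf_lessD by fastforce
    have sm: "summable ?f"
      using sfin by (intro summable_suminf_not_top) (auto simp: fk[symmetric])
    have "(\<Sum>j. hausdorff_outer n (B (j + k))) = ennreal (\<Sum>j. ?f (j + k))" for k
      by (subst fk) (intro suminf_ennreal2 summable_ignore_initial_segment sm, auto)
    moreover have "(\<lambda>k. \<Sum>j. ?f (j + k)) \<longlonglongrightarrow> 0"
      using suminf_exist_split2[OF sm] by simp
    ultimately show ?thesis using tendsto_ennrealI by fastforce
  qed
  have main: "hausdorff_outer n (F \<inter> A) + hausdorff_outer n (A - F)
    \<le> hausdorff_outer n A + (\<Sum>j. hausdorff_outer n (B (j + k)))" for k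
  proof -
    have "hausdorff_outer n (A - F) \<le> hausdorff_outer n (E k) + hausdorff_outer n (\<Union>j. B (j + k))"
      using hausdorff_outer_mono[OF cov] hausdorff_outer_subadditive order_trans by blast
    also have "\<dots> \<le> hausdorff_outer n (E k) + (\<Sum>j. hausdorff_outer n (B (j + k)))"
      by (intro add_left_mono hausdorff_outer_countably_subadditive)
    finally have "hausdorff_outer n (F \<inter> A) + hausdorff_outer n (A - F)
      \<le> hausdorff_outer n (F \<inter> A) + hausdorff_outer n (E k) + (\<Sum>j. hausdorff_outer n (B (j + k)))"
      by (simp add: add.assoc add_left_mono)
    moreover have "hausdorff_outer n (F \<inter> A) + hausdorff_outer n (E k) \<le> hausdorff_outer n ((F \<inter> A) \<union> E k)"
    proof (rule hausdorff_outer_separated[where d = "inverse (real (k+1))"])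
      fix x y assume "x \<in> F \<inter> A" "y \<in> E k"
      then show "inverse (real (k+1)) \<le> dist x y"
        using infdist_le[of x F y] by (simp add: E_def dist_commute)
    qed simp
    moreover have "hausdorff_outer n ((F \<inter> A) \<union> E k) \<le> hausdorff_outer n A"
      by (rule hausdorff_outer_mono) (auto simp: E_def)
    ultimately show ?thesis by (meson add_right_mono order_trans)
  qed
  have "(\<lambda>k. hausdorff_outer n A + (\<Sum>j. hausdorff_outer n (B (j + k)))) \<longlonglongrightarrow> hausdorff_outer n A + 0"
    by (intro tendsto_add tendsto_const tail)
  then show ?thesis
    using main by (intro LIMSEQ_le_const[where X = "\<lambda>k. hausdorff_outer n A + (\<Sum>j. hausdorff_outer n (B (j + k)))"]) auto
qed

text \<open>\<open>measure_of\<close> returns the given set function only if it is a measure. The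
  Caratheodory sets form a sigma-algebra on which \<open>hausdorff_outer\<close> is one, and they
  contain the closed sets, hence the Borel sets.\<close>

lemma emeasure_hausdorff_measure:
  fixes A :: "'a::euclidean_space set"
  assumes "A \<in> sets borel"
  shows "emeasure (hausdorff_measure n) A = hausdorff_outer n A"
proof -
  interpret P: sigma_algebra UNIV "Pow UNIV :: 'a set set" by (rule sigma_algebra_Pow)
  let ?L = "lambda_system UNIV (Pow UNIV) (hausdorff_outer n :: 'a set \<Rightarrow> ennreal)"
  have ms: "measure_space UNIV ?L (hausdorff_outer n)"
    by (rule P.caratheodory_lemma[OF hausdorff_outer_space])
  have sa: "sigma_algebra UNIV ?L" using ms by (simp add: measure_space_def)
  have "F \<in> ?L" if "closed F" for F
  proof -
    have "hausdorff_outer n (F \<inter> x) + hausdorff_outer n ((UNIV - F) \<inter> x) = hausdorff_outer n x" for x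
    proof (rule antisym)
      have "(UNIV - F) \<inter> x = x - F" by auto
      then show "hausdorff_outer n (F \<inter> x) + hausdorff_outer n ((UNIV - F) \<inter> x) \<le> hausdorff_outer n x"
        using closed_hausdorff_measurable[OF that, of n x] by simp
      have "x = (F \<inter> x) \<union> ((UNIV - F) \<inter> x)" by auto
      then show "hausdorff_outer n x \<le> hausdorff_outer n (F \<inter> x) + hausdorff_outer n ((UNIV - F) \<inter> x)"
        using hausdorff_outer_subadditive by metis
    qed
    then show ?thesis by (simp add: lambda_system_def)
  qed
  then have sub: "sets borel \<subseteq> ?L"
    using sigma_algebra.sigma_sets_subset[OF sa, of "Collect closed"] by (auto simp: borel_eq_closed)
  have "measure_space UNIV (sets borel) (hausdorff_outer n :: 'a set \<Rightarrow> ennreal)"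
    using measure_down[OF ms _ sub] sets.sigma_algebra_axioms[of borel] by simp
  then have "positive (sets borel) (hausdorff_outer n :: 'a set \<Rightarrow> ennreal)"
      "countably_additive (sets borel) (hausdorff_outer n :: 'a set \<Rightarrow> ennreal)"
      "sigma_algebra UNIV (sets (borel :: 'a measure))"
    by (simp_all only: measure_space_def)
  then show ?thesis
    unfolding hausdorff_measure_def using assms by (metis emeasure_measure_of_sigma)
qed

lemma sets_hausdorff_measure [simp, measurable_cong]:
  "sets (hausdorff_measure n :: 'a::euclidean_space measure) = sets borel"
  unfolding hausdorff_measure_def using sets.sigma_sets_eq[of "borel :: 'a measure"]
  by (subst sets_measure_of) (simp_all only: space_borel subset_UNIV Pow_UNIV)

lemma space_hausdorff_measure [simp]: "space (hausdorff_measure n) = UNIV"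
  unfolding hausdorff_measure_def by (simp only: space_measure_of_conv)

section \<open>Calculus of partial derivatives\<close>

lemma pd_eqI: "(u has_derivative u') (at x) \<Longrightarrow> pd i u x = u' (axis i 1)"
  unfolding pd_def using frechet_derivative_at by metis

lemma has_derivative_grad:
  assumes "u differentiable (at x)"
  shows "(u has_derivative (\<lambda>v. grad u x \<bullet> v)) (at x)"
proof -
  let ?u = "frechet_derivative u (at x)"
  have d: "(u has_derivative ?u) (at x)" using assms frechet_derivative_works by blast
  have lin: "linear ?u" using d by (rule has_derivative_linear)
  have "?u v = grad u x \<bullet> v" for v
  proof -
    have "?u v = ?u (\<Sum>i\<in>UNIV. v $ i *\<^sub>R axis i 1)"
      using basis_expansion[of v] by (simp add: scalar_mult_eq_scaleR)
    also have "\<dots> = (\<Sum>i\<in>UNIV. v $ i * ?u (axis i 1))"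
      using lin by (simp add: linear_sum linear_scale)
    finally show ?thesis by (simp add: inner_vec_def grad_def pd_def mult.commute)
  qed
  then have "?u = (\<lambda>v. grad u x \<bullet> v)" by (rule ext)
  with d show ?thesis by simp
qed

lemma grad_nth [simp]: "grad u x $ i = pd i u x"
  by (simp add: grad_def)

lemma pd_const [simp]: "pd i (\<lambda>_. c) x = 0"
  by (rule pd_eqI[where u' = "\<lambda>_. 0"]) simp

lemma pd_add:
  assumes "f differentiable (at x)" "g differentiable (at x)"
  shows "pd i (\<lambda>x. f x + g x) x = pd i f x + pd i g x"
  using pd_eqI[OF has_derivative_add[OF has_derivative_grad[OF assms(1)] has_derivative_grad[OF assms(2)]], of i]
  by (simp add: inner_axis)

lemma pd_diff:
  assumes "f differentiable (at x)" "g differentiable (at x)"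
  shows "pd i (\<lambda>x. f x - g x) x = pd i f x - pd i g x"
  using pd_eqI[OF has_derivative_diff[OF has_derivative_grad[OF assms(1)] has_derivative_grad[OF assms(2)]], of i]
  by (simp add: inner_axis)

lemma pd_mult:
  assumes "f differentiable (at x)" "g differentiable (at x)"
  shows "pd i (\<lambda>x. f x * g x) x = f x * pd i g x + pd i f x * g x"
  using pd_eqI[OF has_derivative_mult[OF has_derivative_grad[OF assms(1)] has_derivative_grad[OF assms(2)]], of i]
  by (simp add: inner_axis)

lemma pd_sum:
  assumes "\<And>k. k \<in> I \<Longrightarrow> f k differentiable (at x)"
  shows "pd i (\<lambda>x. \<Sum>k\<in>I. f k x) x = (\<Sum>k\<in>I. pd i (f k) x)"
  using pd_eqI[OF has_derivative_sum[of I f "\<lambda>k v. grad (f k) x \<bullet> v" "at x", OF has_derivative_grad[OF assms]], of i]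
  by (simp add: inner_axis)

lemma pd_compose:
  assumes "f differentiable (at x)" "(\<phi> has_real_derivative d) (at (f x))"
  shows "pd i (\<lambda>x. \<phi> (f x)) x = d * pd i f x"
  using pd_eqI[OF has_derivative_compose[OF has_derivative_grad[OF assms(1)] assms(2)[unfolded has_field_derivative_def]], of i]
  by (simp add: inner_axis)

text \<open>Differentiability is not assumed: \<open>frechet_derivative\<close> is a choice among
  the derivatives at x, and functions that agree near x have the same ones.\<close>

lemma pd_cong_open:
  assumes "open U" "x \<in> U" "\<And>y. y \<in> U \<Longrightarrow> f y = g y"
  shows "pd i f x = pd i g x"
proof -
  have "(f has_derivative F) (at x) \<longleftrightarrow> (g has_derivative F) (at x)" for F
    using assms has_derivative_transform_within_open[of f F x UNIV U g]
      has_derivative_transform_within_open[of g F x UNIV U f] by auto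
  then show ?thesis unfolding pd_def frechet_derivative_def by presburger
qed

lemma differentiable_cong_open:
  assumes "open U" "x \<in> U" "\<And>y. y \<in> U \<Longrightarrow> f y = g y" "f differentiable (at x)"
  shows "g differentiable (at x)"
proof -
  obtain F where "(f has_derivative F) (at x)" using assms(4) differentiable_def by blast
  from has_derivative_transform_within_open[OF this assms(1,2,3)]
  show ?thesis unfolding differentiable_def by blast
qed

section \<open>Stability of the classes C1 and C2, and the operator on differences\<close>

lemma C1_on_D:
  assumes "C1_on U f"
  shows "x \<in> U \<Longrightarrow> f differentiable (at x)" "continuous_on U (pd i f)" "continuous_on U f"
proof -
  show "x \<in> U \<Longrightarrow> f differentiable (at x)" "continuous_on U (pd i f)"
    using assms by (auto simp: C1_on_def)
  show "continuous_on U f"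
    using assms differentiable_imp_continuous_within
    by (intro continuous_at_imp_continuous_on) (auto simp: C1_on_def)
qed

lemma C1_on_cong:
  assumes "open U" "\<And>y. y \<in> U \<Longrightarrow> f y = g y" "C1_on U f"
  shows "C1_on U g"
  unfolding C1_on_def
proof (intro conjI ballI allI)
  show "g differentiable (at x)" if "x \<in> U" for x
    by (rule differentiable_cong_open[OF assms(1) that _ C1_on_D(1)[OF assms(3) that]]) (rule assms(2))
  show "continuous_on U (pd i g)" for i
    by (rule continuous_on_cong[THEN iffD1, OF refl _ C1_on_D(2)[OF assms(3)]])
      (rule pd_cong_open[OF assms(1) _ assms(2)])
qed

lemma C1_on_subset: "C1_on U f \<Longrightarrow> V \<subseteq> U \<Longrightarrow> C1_on V f"
  unfolding C1_on_def by (meson continuous_on_subset subsetD)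

lemma C1_on_const [simp]: "C1_on U (\<lambda>_. c)"
  unfolding C1_on_def by (simp add: pd_const[abs_def])

lemma C1_on_add:
  assumes f: "C1_on U f" and g: "C1_on U g" shows "C1_on U (\<lambda>x. f x + g x)"
  unfolding C1_on_def
proof (intro conjI ballI allI)
  show "continuous_on U (pd i (\<lambda>x. f x + g x))" for i
    by (rule continuous_on_cong[THEN iffD2, OF refl pd_add])
      (auto intro!: continuous_intros C1_on_D(1)[OF f] C1_on_D(1)[OF g] C1_on_D(2)[OF f] C1_on_D(2)[OF g])
qed (auto intro!: differentiable_add C1_on_D(1)[OF f] C1_on_D(1)[OF g])

lemma C1_on_diff:
  assumes f: "C1_on U f" and g: "C1_on U g" shows "C1_on U (\<lambda>x. f x - g x)"
  unfolding C1_on_def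
proof (intro conjI ballI allI)
  show "continuous_on U (pd i (\<lambda>x. f x - g x))" for i
    by (rule continuous_on_cong[THEN iffD2, OF refl pd_diff])
      (auto intro!: continuous_intros C1_on_D(1)[OF f] C1_on_D(1)[OF g] C1_on_D(2)[OF f] C1_on_D(2)[OF g])
qed (auto intro!: differentiable_diff C1_on_D(1)[OF f] C1_on_D(1)[OF g])

lemma C1_on_mult:
  assumes f: "C1_on U f" and g: "C1_on U g" shows "C1_on U (\<lambda>x. f x * g x)"
  unfolding C1_on_def
proof (intro conjI ballI allI)
  show "continuous_on U (pd i (\<lambda>x. f x * g x))" for i
    by (rule continuous_on_cong[THEN iffD2, OF refl pd_mult])
      (auto intro!: continuous_intros C1_on_D(1)[OF f] C1_on_D(1)[OF g] C1_on_D(2)[OF f] C1_on_D(2)[OF g]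
        C1_on_D(3)[OF f] C1_on_D(3)[OF g])
qed (auto intro!: differentiable_mult C1_on_D(1)[OF f] C1_on_D(1)[OF g])

lemma C1_on_sum:
  assumes "finite I" "\<And>k. k \<in> I \<Longrightarrow> C1_on U (f k)" shows "C1_on U (\<lambda>x. \<Sum>k\<in>I. f k x)"
  using assms by (induction I rule: finite_induct) (auto intro!: C1_on_add)

lemma C1_on_compose:
  assumes f: "C1_on U f" and d: "\<And>y. (\<phi> has_real_derivative \<phi>' y) (at y)" and c: "continuous_on UNIV \<phi>'"
  shows "C1_on U (\<lambda>x. \<phi> (f x))"
  unfolding C1_on_def
proof (intro conjI ballI allI)
  show "(\<lambda>x. \<phi> (f x)) differentiable (at x)" if "x \<in> U" for x
    using has_derivative_compose[OF has_derivative_grad[OF C1_on_D(1)[OF f that]] d[unfolded has_field_derivative_def]]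
    unfolding differentiable_def by blast
  show "continuous_on U (pd i (\<lambda>x. \<phi> (f x)))" for i
    by (rule continuous_on_cong[THEN iffD2, OF refl pd_compose[OF _ d]])
      (auto intro!: continuous_intros C1_on_D(1)[OF f] C1_on_D(2)[OF f]
        continuous_on_compose2[OF c C1_on_D(3)[OF f]])
qed

lemma C2_on_D:
  assumes "C2_on U f"
  shows "C1_on U f" "C1_on U (pd i f)"
  using assms by (auto simp: C2_on_def)

lemma C2_on_diff:
  assumes "open U" "C2_on U f" "C2_on U g" shows "C2_on U (\<lambda>x. f x - g x)"
  unfolding C2_on_def
proof (intro conjI allI)
  show "C1_on U (\<lambda>x. f x - g x)" by (intro C1_on_diff C2_on_D(1)[OF assms(2)] C2_on_D(1)[OF assms(3)])
  show "C1_on U (pd i (\<lambda>x. f x - g x))" for i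
  proof (rule C1_on_cong[OF assms(1)])
    show "C1_on U (\<lambda>x. pd i f x - pd i g x)"
      by (intro C1_on_diff C2_on_D(2)[OF assms(2)] C2_on_D(2)[OF assms(3)])
  qed (simp add: pd_diff C1_on_D(1)[OF C2_on_D(1)[OF assms(2)]] C1_on_D(1)[OF C2_on_D(1)[OF assms(3)]])
qed

lemma L_op_diff:
  assumes U: "open U" "C2_on U f" "C2_on U g" "x \<in> U"
  shows "L_op h b c (\<lambda>x. f x - g x) x = L_op h b c f x - L_op h b c g x"
proof -
  note f = C1_on_D(1)[OF C2_on_D(1)[OF U(2)]] C1_on_D(1)[OF C2_on_D(2)[OF U(2)]]
  note g = C1_on_D(1)[OF C2_on_D(1)[OF U(3)]] C1_on_D(1)[OF C2_on_D(2)[OF U(3)]]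
  have 1: "pd i (\<lambda>x. f x - g x) y = pd i f y - pd i g y" if "y \<in> U" for i y
    using that f g by (simp add: pd_diff)
  have "pd i (pd j (\<lambda>x. f x - g x)) x = pd i (\<lambda>x. pd j f x - pd j g x) x" for i j
    by (rule pd_cong_open[OF U(1,4) 1])
  then have 2: "pd i (pd j (\<lambda>x. f x - g x)) x = pd i (pd j f) x - pd i (pd j g) x" for i j
    using U(4) f g by (simp add: pd_diff)
  show ?thesis unfolding L_op_def 1[OF U(4)] 2
    by (simp add: algebra_simps sum_subtractf)
qed

section \<open>Polynomials\<close>

lemma real_polynomial_function_pd:
  assumes "real_polynomial_function p"
  shows "(\<forall>x. p differentiable (at x)) \<and> real_polynomial_function (pd i p)"
  using assms
proof (induction p rule: real_polynomial_function.induct)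
  case (linear f)
  then have "(f has_derivative f) (at x)" for x by (rule bounded_linear_imp_has_derivative)
  then have "pd i f = (\<lambda>_. f (axis i 1))" "\<forall>x. f differentiable (at x)"
    by (auto simp: pd_eqI differentiable_def)
  then show ?case by auto
next
  case (const c) then show ?case by (auto simp: pd_const[abs_def])
next
  case (add f g)
  then have "pd i (\<lambda>x. f x + g x) = (\<lambda>x. pd i f x + pd i g x)" by (auto simp: pd_add)
  with add show ?case by (auto intro!: differentiable_add)
next
  case (mult f g)
  then have "pd i (\<lambda>x. f x * g x) = (\<lambda>x. f x * pd i g x + pd i f x * g x)" by (auto simp: pd_mult)
  with mult show ?case by (auto intro!: differentiable_mult)
qed

lemma real_polynomial_function_C1_on: "real_polynomial_function p \<Longrightarrow> C1_on U p"
  unfolding C1_on_def using real_polynomial_function_pd continuous_polymonial_function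
  by (metis continuous_at_imp_continuous_on real_polynomial_function_eq)

lemma real_polynomial_function_C2_on: "real_polynomial_function p \<Longrightarrow> C2_on U p"
  unfolding C2_on_def using real_polynomial_function_C1_on real_polynomial_function_pd by blast

section \<open>Symmetry of second derivatives\<close>

lemma has_real_derivative_line:
  assumes "u differentiable (at (x + a *\<^sub>R axis i 1))"
  shows "((\<lambda>a. u (x + a *\<^sub>R axis i 1)) has_real_derivative pd i u (x + a *\<^sub>R axis i 1)) (at a)"
proof -
  have "((\<lambda>a. x + a *\<^sub>R axis i 1) has_derivative (\<lambda>a. a *\<^sub>R axis i 1)) (at a)"
    by (auto intro!: derivative_eq_intros)
  from has_derivative_compose[OF this has_derivative_grad[OF assms]]
  show ?thesis by (simp add: has_field_derivative_def inner_axis mult_commute_abs)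
qed

text \<open>The mean value theorem is applied in direction i to the increment of u in direction j,
  then in direction j to \<open>pd i u\<close>.\<close>

lemma second_difference:
  fixes x :: "real^'m"
  assumes "open U" "C2_on U u" "0 < s"
    and sub: "\<And>a b. 0 \<le> a \<Longrightarrow> a \<le> s \<Longrightarrow> 0 \<le> b \<Longrightarrow> b \<le> s \<Longrightarrow> x + a *\<^sub>R axis i 1 + b *\<^sub>R axis j 1 \<in> U"
  shows "\<exists>a b. 0 < a \<and> a < s \<and> 0 < b \<and> b < s \<and>
    u (x + s *\<^sub>R axis i 1 + s *\<^sub>R axis j 1) - u (x + s *\<^sub>R axis i 1) - u (x + s *\<^sub>R axis j 1) + u x
    = s * s * pd j (pd i u) (x + a *\<^sub>R axis i 1 + b *\<^sub>R axis j 1)"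
proof -
  note d1 = C1_on_D(1)[OF C2_on_D(1)[OF assms(2)]] and d2 = C1_on_D(1)[OF C2_on_D(2)[OF assms(2)]]
  let ?\<phi> = "\<lambda>a. u ((x + s *\<^sub>R axis j 1) + a *\<^sub>R axis i 1) - u (x + a *\<^sub>R axis i 1)"
  have "\<exists>a>0. a < s \<and> ?\<phi> s - ?\<phi> 0
    = (s - 0) * (pd i u ((x + s *\<^sub>R axis j 1) + a *\<^sub>R axis i 1) - pd i u (x + a *\<^sub>R axis i 1))"
  proof (rule MVT2)
    fix a assume a: "0 \<le> a" "a \<le> s"
    have "x + a *\<^sub>R axis i 1 \<in> U" "(x + s *\<^sub>R axis j 1) + a *\<^sub>R axis i 1 \<in> U"
      using sub[of a 0] sub[of a s] a assms(3) by (auto simp: algebra_simps)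
    then show "(?\<phi> has_real_derivative pd i u ((x + s *\<^sub>R axis j 1) + a *\<^sub>R axis i 1) - pd i u (x + a *\<^sub>R axis i 1)) (at a)"
      by (intro DERIV_diff has_real_derivative_line d1)
  qed (use assms in auto)
  then obtain a where a: "0 < a" "a < s" "?\<phi> s - ?\<phi> 0
    = s * (pd i u ((x + s *\<^sub>R axis j 1) + a *\<^sub>R axis i 1) - pd i u (x + a *\<^sub>R axis i 1))" by auto
  let ?\<psi> = "\<lambda>b. pd i u ((x + a *\<^sub>R axis i 1) + b *\<^sub>R axis j 1)"
  have "\<exists>b>0. b < s \<and> ?\<psi> s - ?\<psi> 0
    = (s - 0) * pd j (pd i u) ((x + a *\<^sub>R axis i 1) + b *\<^sub>R axis j 1)"
  proof (rule MVT2)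
    fix b assume "0 \<le> b" "b \<le> s"
    then have "(x + a *\<^sub>R axis i 1) + b *\<^sub>R axis j 1 \<in> U" using a by (intro sub) auto
    then show "(?\<psi> has_real_derivative pd j (pd i u) ((x + a *\<^sub>R axis i 1) + b *\<^sub>R axis j 1)) (at b)"
      by (intro has_real_derivative_line d2)
  qed (use assms in auto)
  then obtain b where "0 < b" "b < s" "?\<psi> s - ?\<psi> 0
    = s * pd j (pd i u) ((x + a *\<^sub>R axis i 1) + b *\<^sub>R axis j 1)" by auto
  with a show ?thesis
    by (intro exI[of _ a] exI[of _ b]) (simp add: algebra_simps)
qed

text \<open>The second difference is symmetric in i and j, so the two mixed derivatives agree at two
  points arbitrarily close to x; by continuity they cannot differ at x.\<close>

lemma pd_commute:
  fixes x :: "real^'m"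
  assumes "open U" "C2_on U u" "x \<in> U"
  shows "pd i (pd j u) x = pd j (pd i u) x"
proof (rule ccontr)
  assume ne: "pd i (pd j u) x \<noteq> pd j (pd i u) x"
  define e where "e = \<bar>pd i (pd j u) x - pd j (pd i u) x\<bar> / 2"
  have "0 < e" using ne by (simp add: e_def)
  note c = C1_on_D(2)[OF C2_on_D(2)[OF assms(2)]]
  have "isCont (pd i (pd j u)) x" "isCont (pd j (pd i u)) x"
    using c assms continuous_on_eq_continuous_at by blast+
  then obtain r1 r2 where r: "0 < r1" "0 < r2"
    "\<And>y. dist y x < r1 \<Longrightarrow> dist (pd i (pd j u) y) (pd i (pd j u) x) < e"
    "\<And>y. dist y x < r2 \<Longrightarrow> dist (pd j (pd i u) y) (pd j (pd i u) x) < e"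
    unfolding continuous_at_eps_delta using \<open>0 < e\<close> by metis
  obtain r0 where r0: "0 < r0" "ball x r0 \<subseteq> U" using assms openE by blast
  \<comment> \<open>All points reached are within 2 s of x; the factor 3 makes the comparison with
    the three radii strict.\<close>
  define s where "s = min r0 (min r1 r2) / 3"
  have s: "0 < s" "3 * s \<le> r0" "3 * s \<le> r1" "3 * s \<le> r2" using r r0 by (auto simp: s_def)
  have d: "dist (x + a *\<^sub>R axis k 1 + b *\<^sub>R axis l 1) x < 3 * s"
    if "0 \<le> a" "a \<le> s" "0 \<le> b" "b \<le> s" for a b k l
  proof -
    have "norm (a *\<^sub>R axis k 1 + b *\<^sub>R axis l 1 :: real^'m) \<le> a + b"
      using norm_triangle_ineq[of "a *\<^sub>R axis k 1 :: real^'m" "b *\<^sub>R axis l 1"] that by simp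
    then show ?thesis using that s by (simp add: dist_norm add.assoc)
  qed
  have inU: "x + a *\<^sub>R axis k 1 + b *\<^sub>R axis l 1 \<in> U"
    if "0 \<le> a" "a \<le> s" "0 \<le> b" "b \<le> s" for a b k l
    using d[OF that, of k l] s(2) r0 by (auto simp: dist_commute)
  obtain a b where ab: "0 < a" "a < s" "0 < b" "b < s"
    "u (x + s *\<^sub>R axis i 1 + s *\<^sub>R axis j 1) - u (x + s *\<^sub>R axis i 1) - u (x + s *\<^sub>R axis j 1) + u x
    = s * s * pd j (pd i u) (x + a *\<^sub>R axis i 1 + b *\<^sub>R axis j 1)"
    using second_difference[OF assms(1,2) s(1) inU, of i j] by auto
  obtain a' b' where ab': "0 < a'" "a' < s" "0 < b'" "b' < s"
    "u (x + s *\<^sub>R axis j 1 + s *\<^sub>R axis i 1) - u (x + s *\<^sub>R axis j 1) - u (x + s *\<^sub>R axis i 1) + u x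
    = s * s * pd i (pd j u) (x + a' *\<^sub>R axis j 1 + b' *\<^sub>R axis i 1)"
    using second_difference[OF assms(1,2) s(1) inU, of j i] by auto
  have "s * s * pd j (pd i u) (x + a *\<^sub>R axis i 1 + b *\<^sub>R axis j 1)
      = s * s * pd i (pd j u) (x + a' *\<^sub>R axis j 1 + b' *\<^sub>R axis i 1)"
    using ab(5) ab'(5) by (simp add: algebra_simps)
  then have eq: "pd j (pd i u) (x + a *\<^sub>R axis i 1 + b *\<^sub>R axis j 1) = pd i (pd j u) (x + a' *\<^sub>R axis j 1 + b' *\<^sub>R axis i 1)"
    using s(1) by simp
  have "dist (pd j (pd i u) (x + a *\<^sub>R axis i 1 + b *\<^sub>R axis j 1)) (pd j (pd i u) x) < e"
    by (rule r(4)) (use d[of a b i j] ab s in linarith)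
  moreover have "dist (pd i (pd j u) (x + a' *\<^sub>R axis j 1 + b' *\<^sub>R axis i 1)) (pd i (pd j u) x) < e"
    by (rule r(3)) (use d[of a' b' j i] ab' s in linarith)
  ultimately show False unfolding eq dist_real_def e_def by (smt (verit) field_sum_of_halves)
qed

section \<open>Compactly supported functions\<close>

text \<open>Translation invariance and dominated convergence of the difference quotients.\<close>

lemma integral_pd_compact_support:
  fixes F :: "real^'m \<Rightarrow> real"
  assumes D: "open D" and K: "compact K" "K \<subseteq> D" and F: "C1_on D F" "\<And>x. x \<in> D - K \<Longrightarrow> F x = 0"
  shows "integrable lborel (\<lambda>x. indicator D x * pd i F x)" "(\<integral>x. indicator D x * pd i F x \<partial>lborel) = 0"
proof -
  \<comment> \<open>The extension by zero is differentiable on the whole space, because the open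
    sets D and \<open>- K\<close> cover it.\<close>
  define G where "G x = indicator D x * F x" for x
  define G' where "G' x = indicator D x * pd i F x" for x
  define e :: "real^'m" where "e = axis i 1"
  have G0: "G x = 0" if "x \<notin> K" for x using F(2) that by (cases "x \<in> D") (auto simp: G_def)
  have oK: "open (- K)" using K by (simp add: compact_imp_closed open_Compl)
  have G'0: "G' x = 0" if "x \<notin> K" for x
  proof (cases "x \<in> D")
    case True
    have "pd i F x = pd i (\<lambda>_. 0) x"
      by (rule pd_cong_open[of "D \<inter> - K"]) (use D oK True that F(2) in auto)
    then show ?thesis by (simp add: G'_def)
  qed (simp add: G'_def)
  have der: "((\<lambda>a. G (x + a *\<^sub>R e)) has_real_derivative G' (x + a *\<^sub>R e)) (at a)" for x a
  proof (cases "x + a *\<^sub>R e \<in> D")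
    case True
    have op: "open ((\<lambda>a. x + a *\<^sub>R e) -` D)"
      by (intro continuous_open_vimage D continuous_intros)
    have "((\<lambda>a. F (x + a *\<^sub>R e)) has_real_derivative G' (x + a *\<^sub>R e)) (at a)"
      using has_real_derivative_line[of F x a i] C1_on_D(1)[OF F(1) True] True by (simp add: G'_def e_def)
    then show ?thesis
      by (rule has_field_derivative_transform_within_open[OF _ op]) (use True in \<open>auto simp: G_def\<close>)
  next
    case False
    then have nK: "x + a *\<^sub>R e \<notin> K" using K by blast
    have op: "open ((\<lambda>a. x + a *\<^sub>R e) -` (- K))"
      by (intro continuous_open_vimage oK continuous_intros)
    have "((\<lambda>a. 0) has_real_derivative G' (x + a *\<^sub>R e)) (at a)" using G'0[OF nK] by simp
    then show ?thesis
      by (rule has_field_derivative_transform_within_open[OF _ op]) (use nK G0 in auto)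
  qed
  have meas: "G \<in> borel_measurable borel" "G' \<in> borel_measurable borel"
    unfolding G_def[abs_def] G'_def[abs_def]
    using borel_measurable_continuous_on_indicator[of D F] borel_measurable_continuous_on_indicator[of D "pd i F"]
      C1_on_D(2,3)[OF F(1)] D by auto
  have "\<exists>B>0. \<forall>x\<in>K. \<bar>f x\<bar> \<le> B" if "continuous_on D f" for f :: "real^'m \<Rightarrow> real"
    using compact_imp_bounded[OF compact_continuous_image[OF continuous_on_subset[OF that K(2)] K(1)]]
    by (force simp: bounded_pos)
  from this[OF C1_on_D(3)[OF F(1)]] this[OF C1_on_D(2)[OF F(1)], of i]
  obtain B0 B where B: "0 < B0" "\<And>x. x \<in> K \<Longrightarrow> \<bar>F x\<bar> \<le> B0" "0 < B" "\<And>x. x \<in> K \<Longrightarrow> \<bar>pd i F x\<bar> \<le> B"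
    by blast
  have GB: "\<bar>G x\<bar> \<le> B0 * indicator K x" for x
    using B G0[of x] by (cases "x \<in> K") (auto simp: G_def indicator_def)
  have GB': "\<bar>G' x\<bar> \<le> B" for x
    using B G'0[of x] by (cases "x \<in> K") (auto simp: G'_def indicator_def)
  obtain R where R: "0 < R" "\<And>x. x \<in> K \<Longrightarrow> norm x \<le> R"
    using compact_imp_bounded[OF K(1)] by (auto simp: bounded_pos)
  have intK: "integrable lborel (indicator K :: real^'m \<Rightarrow> real)"
    using K emeasure_compact_finite[OF K(1)] by (intro integrable_real_indicator) (auto simp: compact_imp_closed)
  have iG: "integrable lborel G"
    by (rule Bochner_Integration.integrable_bound[of _ "\<lambda>x. B0 * indicator K x"])
      (use intK meas GB in \<open>auto intro!: AE_I2 order_trans[OF GB]\<close>)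
  have iC: "integrable lborel (\<lambda>x. B * indicator (cball 0 (R+1)) x :: real)"
    by (intro integrable_mult_right integrable_real_indicator) (auto intro: emeasure_compact_finite[unfolded infinity_ennreal_def])
  \<comment> \<open>Steps of length at most 1 keep the supports of all difference quotients in the
    ball of radius R + 1, which provides an integrable majorant.\<close>
  define eps where "eps k = inverse (real (Suc k))" for k
  have eps: "0 < eps k" "eps k \<le> 1" for k by (auto simp: eps_def field_simps)
  have eps0: "eps \<longlonglongrightarrow> 0" unfolding eps_def by (rule LIMSEQ_inverse_real_of_nat)
  let ?q = "\<lambda>k x. (G (x + eps k *\<^sub>R e) - G x) / eps k"
  have trans: "integrable lborel (\<lambda>x. G (x + c))" "(\<integral>x. G (x + c) \<partial>lborel) = (\<integral>x. G x \<partial>lborel)" for c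
  proof -
    have "integrable (distr lborel borel ((+) c)) G" using iG by (simp add: lborel_distr_plus)
    then show "integrable lborel (\<lambda>x. G (x + c))"
      by (subst (asm) integrable_distr_eq) (use meas in \<open>auto simp: add.commute\<close>)
    have "(\<integral>x. G x \<partial>lborel) = (\<integral>x. G x \<partial>distr lborel borel ((+) c))" by (simp add: lborel_distr_plus)
    also have "\<dots> = (\<integral>x. G (x + c) \<partial>lborel)"
      by (subst integral_distr) (use meas in \<open>auto simp: add.commute\<close>)
    finally show "(\<integral>x. G (x + c) \<partial>lborel) = (\<integral>x. G x \<partial>lborel)" by simp
  qed
  have q0: "(\<integral>x. ?q k x \<partial>lborel) = 0" for k
    using trans[of "eps k *\<^sub>R e"] iG by simp
  have lim: "(\<lambda>k. ?q k x) \<longlonglongrightarrow> G' x" for x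
  proof -
    have "((\<lambda>h. (G (x + h *\<^sub>R e) - G x) / h) \<longlongrightarrow> G' x) (at 0)"
      using der[of x 0] by (simp add: DERIV_def)
    then show ?thesis
      by (rule filterlim_compose) (use eps eps0 in \<open>auto simp: filterlim_at less_imp_neq[symmetric]\<close>)
  qed
  have bd: "\<bar>?q k x\<bar> \<le> B * indicator (cball 0 (R+1)) x" for k x
  proof (cases "norm x \<le> R + 1")
    case True
    have "\<exists>a>0. a < eps k \<and> G (x + eps k *\<^sub>R e) - G (x + 0 *\<^sub>R e) = (eps k - 0) * G' (x + a *\<^sub>R e)"
      by (rule MVT2) (use eps der in auto)
    then obtain a where "G (x + eps k *\<^sub>R e) - G x = eps k * G' (x + a *\<^sub>R e)" by auto
    then have "?q k x = G' (x + a *\<^sub>R e)" using eps[of k] by simp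
    then show ?thesis using GB' True by simp
  next
    case False
    have "norm x \<le> norm (x + eps k *\<^sub>R e) + norm (eps k *\<^sub>R e)"
      using norm_triangle_ineq4[of "x + eps k *\<^sub>R e" "eps k *\<^sub>R e"] by simp
    also have "norm (eps k *\<^sub>R e) \<le> 1" using eps[of k] by (simp add: e_def)
    finally have "x \<notin> K" "x + eps k *\<^sub>R e \<notin> K" using R False by force+
    then show ?thesis using G0 False by simp
  qed
  have m': "(\<lambda>x. ?q k x) \<in> borel_measurable lborel" for k
    using meas by measurable
  show "integrable lborel (\<lambda>x. indicator D x * pd i F x)"
    unfolding G'_def[symmetric]
  proof (rule Bochner_Integration.integrable_bound[OF iC])
    have "\<bar>G' x\<bar> \<le> B * indicator (cball 0 (R+1)) x" for x
      using GB'[of x] G'0[of x] R(2)[of x] by (cases "x \<in> K") (auto simp: indicator_def)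
    then show "AE x in lborel. norm (G' x) \<le> norm (B * indicator (cball 0 (R+1)) x :: real)"
      by (intro AE_I2) (metis abs_ge_self order_trans real_norm_def)
  qed (use meas in simp)
  have "(\<lambda>k. \<integral>x. ?q k x \<partial>lborel) \<longlonglongrightarrow> (\<integral>x. G' x \<partial>lborel)"
    by (rule integral_dominated_convergence[OF _ m' iC]) (use meas lim bd in auto)
  then show "(\<integral>x. indicator D x * pd i F x \<partial>lborel) = 0"
    unfolding q0 by (simp add: G'_def LIMSEQ_const_iff)
qed

text \<open>Squaring removes the corner of the positive part. All cutoffs and the smoothed weight
  are built from this one C1 function.\<close>

lemma has_real_derivative_pospart_power2:
  "((\<lambda>y. (max 0 y)\<^sup>2) has_real_derivative 2 * max 0 y) (at (y::real))"
proof -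
  consider "0 < y" | "y < 0" | "y = 0" by linarith
  then show ?thesis
  proof cases
    case 1
    have "((\<lambda>y. y\<^sup>2) has_real_derivative 2 * max 0 y) (at y)"
      using 1 by (auto intro!: derivative_eq_intros)
    then show ?thesis
      by (rule has_field_derivative_transform_within_open[of _ _ _ "{0<..}"]) (use 1 in auto)
  next
    case 2
    have "((\<lambda>y. 0) has_real_derivative 2 * max 0 y) (at y)" using 2 by simp
    then show ?thesis
      by (rule has_field_derivative_transform_within_open[of _ _ _ "{..<0}"]) (use 2 in auto)
  next
    case 3
    have "((\<lambda>h::real. max 0 h) \<longlongrightarrow> max 0 0) (at 0)" by (intro tendsto_intros)
    moreover have "max 0 h = (max 0 h)\<^sup>2 / h" for h :: real by (auto simp: max_def power2_eq_square)
    ultimately show ?thesis using 3 by (simp add: DERIV_def)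
  qed
qed

section \<open>Hausdorff measure of pieces of level sets\<close>

text \<open>The finite cover is padded with empty sets. Their weight is 0 by definition, also for n
  = 0, where the formula for nonempty sets would give a positive value.\<close>

lemma hausdorff_pre_finite_cover:
  fixes U :: "'i \<Rightarrow> 'a::euclidean_space set"
  assumes fin: "finite X" and sub: "A \<subseteq> (\<Union>x\<in>X. U x)" and b: "\<And>x. x \<in> X \<Longrightarrow> bounded (U x)"
    and d: "\<And>x. x \<in> X \<Longrightarrow> diameter (U x) \<le> \<delta>" and "0 \<le> \<delta>"
  shows "hausdorff_pre n \<delta> A \<le> (\<Sum>x\<in>X. hausdorff_weight n (U x))"
proof -
  obtain f where f: "bij_betw f {0..<card X} X" using ex_bij_betw_nat_finite[OF fin] by blast
  define V where "V k = (if k < card X then U (f k) else {})" for k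
  have fX: "f k \<in> X" if "k < card X" for k using f that by (auto simp: bij_betw_def)
  have "hausdorff_pre n \<delta> A \<le> (\<Sum>k. hausdorff_weight n (V k))"
  proof (rule hausdorff_pre_le)
    show "A \<subseteq> (\<Union>k. V k)"
    proof
      fix y assume "y \<in> A"
      then obtain x where x: "x \<in> X" "y \<in> U x" using sub by blast
      moreover obtain k where "k < card X" "f k = x" using f x(1) by (force simp: bij_betw_def)
      ultimately have "y \<in> V k" by (simp add: V_def)
      then show "y \<in> (\<Union>k. V k)" by blast
    qed
  qed (use assms fX in \<open>auto simp: V_def\<close>)
  also have "\<dots> = (\<Sum>k\<in>{0..<card X}. hausdorff_weight n (V k))"
    by (rule suminf_finite) (auto simp: V_def)
  also have "\<dots> = (\<Sum>k\<in>{0..<card X}. hausdorff_weight n (U (f k)))"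
    by (intro sum.cong) (auto simp: V_def)
  also have "\<dots> = (\<Sum>x\<in>X. hausdorff_weight n (U x))"
    by (rule sum.reindex_bij_betw[OF f])
  finally show ?thesis .
qed

lemma hausdorff_pre_subadditive:
  fixes A :: "'i \<Rightarrow> 'a::euclidean_space set"
  assumes I: "finite I" and "0 \<le> \<delta>"
  shows "hausdorff_pre n \<delta> (\<Union>i\<in>I. A i) \<le> (\<Sum>i\<in>I. hausdorff_pre n \<delta> (A i))"
proof -
  obtain f where f: "bij_betw f {0..<card I} I" using ex_bij_betw_nat_finite[OF I] by blast
  define V where "V k = (if k < card I then A (f k) else {})" for k
  have "(\<Union>i\<in>I. A i) \<subseteq> (\<Union>k. V k)"
    using f by (force simp: V_def bij_betw_def)
  then have "hausdorff_pre n \<delta> (\<Union>i\<in>I. A i) \<le> hausdorff_pre n \<delta> (\<Union>k. V k)"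
    by (rule hausdorff_pre_mono)
  also have "\<dots> \<le> (\<Sum>k. hausdorff_pre n \<delta> (V k))" by (rule hausdorff_pre_countably_subadditive)
  also have "\<dots> = (\<Sum>k\<in>{0..<card I}. hausdorff_pre n \<delta> (V k))"
    by (rule suminf_finite) (auto simp: V_def assms)
  also have "\<dots> = (\<Sum>k\<in>{0..<card I}. hausdorff_pre n \<delta> (A (f k)))"
    by (intro sum.cong) (auto simp: V_def)
  also have "\<dots> = (\<Sum>i\<in>I. hausdorff_pre n \<delta> (A i))"
    by (rule sum.reindex_bij_betw[OF f])
  finally show ?thesis .
qed

text \<open>On a nearly flat set T with unit normal e, the translates of a \<delta>-separated set along e
  by multiples of \<delta>/2 are disjoint balls, so that comparing volumes bounds its cardinality.\<close>

lemma packing_bound: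
  fixes T :: "(real^'m::finite) set" and r \<delta> :: real
  assumes card: "CARD('m) = n + 1" and e: "norm e = 1"
    and flat: "\<And>y z. y \<in> T \<Longrightarrow> z \<in> T \<Longrightarrow> \<bar>e \<bullet> (y - z)\<bar> \<le> norm (y - z) / 2"
    and T: "T \<subseteq> cball x0 r" and "0 \<le> r"
    and X: "finite X" "X \<subseteq> T" and sep: "\<And>y z. y \<in> X \<Longrightarrow> z \<in> X \<Longrightarrow> y \<noteq> z \<Longrightarrow> \<delta> \<le> dist y z"
    and \<delta>: "0 < \<delta>" "\<delta> \<le> 1"
  shows "card X * \<delta> ^ n \<le> (4 * (r + 2)) ^ (n + 1)"
proof -
  \<comment> \<open>On each point J balls are stacked up to a height of about 1/2 that does not
    shrink with \<delta>. This turns a volume count in dimension n + 1 into a count of order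
    \<delta>^(-n).\<close>
  define J where "J = nat \<lceil>1 / \<delta>\<rceil>"
  have J: "1 / \<delta> \<le> J" "J < 1 / \<delta> + 1" using \<delta> by (auto simp: J_def) linarith+
  define P where "P = (\<lambda>(x, j::nat). ball (x + (j * (\<delta> / 2)) *\<^sub>R e) (\<delta> / 4))"
  let ?I = "X \<times> {..<J}"
  have far: "\<delta> / 2 \<le> dist (x + (j * (\<delta> / 2)) *\<^sub>R e) (y + (k * (\<delta> / 2)) *\<^sub>R e)"
    if "x \<in> X" "y \<in> X" "(x, j) \<noteq> (y, k)" for x y and j k :: nat
  proof (cases "x = y")
    case True
    then have "1 \<le> \<bar>real j - real k\<bar>" using that by auto
    then have "\<delta> / 2 \<le> \<bar>real j - real k\<bar> * (\<delta> / 2)" using \<delta> by simp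
    also have "\<dots> = dist (x + (j * (\<delta> / 2)) *\<^sub>R e) (y + (k * (\<delta> / 2)) *\<^sub>R e)"
    proof -
      have "(x + (j * (\<delta> / 2)) *\<^sub>R e) - (y + (k * (\<delta> / 2)) *\<^sub>R e) = ((real j - real k) * (\<delta> / 2)) *\<^sub>R e"
        using True by (simp add: scaleR_left_diff_distrib left_diff_distrib del: times_divide_eq_right)
      then show ?thesis using e \<delta> by (simp add: dist_norm abs_mult)
    qed
    finally show ?thesis .
  next
    case False
    define v where "v = x - y"
    define s where "s = real j * (\<delta> / 2) - real k * (\<delta> / 2)"
    have v: "\<delta> \<le> norm v" using sep[OF that(1,2) False] by (simp add: v_def dist_norm)
    have "\<bar>e \<bullet> v\<bar> \<le> norm v / 2" unfolding v_def using flat that X by blast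
    then have ev: "(e \<bullet> v)\<^sup>2 \<le> (norm v / 2)\<^sup>2" by (metis abs_ge_zero power2_abs power_mono)
    have "(norm (v + s *\<^sub>R e))\<^sup>2 = (norm v)\<^sup>2 + 2 * s * (e \<bullet> v) + s\<^sup>2"
      unfolding power2_norm_eq_inner using e[unfolded norm_eq_1]
      by (simp add: inner_add_left inner_add_right inner_commute power2_eq_square)
    \<comment> \<open>Moving along e cannot bring v closer to 0 than its distance to the line of e:
      |v + s e|^2 is at least |v|^2 - (e . v)^2, which flatness bounds below by 3/4 |v|^2, more than
      the |v|^2 / 4 that is required.\<close>
    moreover have "0 \<le> (s + e \<bullet> v)\<^sup>2" by simp
    ultimately have "(norm v)\<^sup>2 - (e \<bullet> v)\<^sup>2 \<le> (norm (v + s *\<^sub>R e))\<^sup>2"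
      by (simp add: power2_sum)
    moreover have "(norm v / 2)\<^sup>2 = (norm v)\<^sup>2 / 4" by (simp add: power_divide)
    ultimately have "(norm v / 2)\<^sup>2 \<le> (norm (v + s *\<^sub>R e))\<^sup>2"
      using ev zero_le_power2[of "norm v"] by linarith
    then have "norm v / 2 \<le> norm (v + s *\<^sub>R e)" by (rule power2_le_imp_le) simp
    moreover have "(x + (j * (\<delta> / 2)) *\<^sub>R e) - (y + (k * (\<delta> / 2)) *\<^sub>R e) = v + s *\<^sub>R e"
      by (simp add: v_def s_def algebra_simps)
    ultimately show ?thesis using v by (simp add: dist_norm)
  qed
  have disj: "disjoint_family_on P ?I"
    unfolding disjoint_family_on_def
  proof (intro ballI impI)
    fix p q assume pq: "p \<in> ?I" "q \<in> ?I" "p \<noteq> q"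
    obtain x j y k where [simp]: "p = (x, j)" "q = (y, k)" by fastforce
    have "\<delta> / 2 \<le> dist (x + (j * (\<delta> / 2)) *\<^sub>R e) (y + (k * (\<delta> / 2)) *\<^sub>R e)"
      by (rule far) (use pq in auto)
    then show "P p \<inter> P q = {}" unfolding P_def by (auto intro!: disjoint_ballI)
  qed
  have sub: "(\<Union>p\<in>?I. P p) \<subseteq> ball x0 (r + 2)"
  proof
    fix z assume "z \<in> (\<Union>p\<in>?I. P p)"
    then obtain x j where xj: "x \<in> X" "j < J" "dist (x + (j * (\<delta> / 2)) *\<^sub>R e) z < \<delta> / 4"
      by (auto simp: P_def)
    have "real j * (\<delta> / 2) \<le> (1 / \<delta>) * (\<delta> / 2)" using xj J \<delta> by (intro mult_right_mono) auto
    then have "real j * (\<delta> / 2) \<le> 1 / 2" using \<delta> by simp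
    moreover have "dist x (x + (j * (\<delta> / 2)) *\<^sub>R e) = j * (\<delta> / 2)" using e \<delta> by (simp add: dist_norm)
    moreover have "dist x0 x \<le> r" using xj X T by (auto simp: mem_cball)
    ultimately show "z \<in> ball x0 (r + 2)"
      using dist_triangle[of x0 z x] dist_triangle[of x z "x + (j * (\<delta> / 2)) *\<^sub>R e"] xj(3) \<delta> by simp
  qed
  have vol: "measure lborel (P p) = unit_ball_vol (n + 1) * (\<delta> / 4) ^ (n + 1)" for p
    unfolding P_def using card \<delta> by (auto simp: content_ball split: prod.split)
  have fin: "emeasure lborel (P p) \<noteq> \<infinity>" and mP: "P p \<in> sets lborel" for p
    unfolding P_def using \<delta> by (auto simp: emeasure_ball split: prod.split)
  have "(\<Sum>p\<in>?I. measure lborel (P p)) = measure lborel (\<Union>p\<in>?I. P p)"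
    by (rule measure_finite_Union[symmetric])
      (use X disj fin mP in auto)
  also have "\<dots> \<le> measure lborel (ball x0 (r + 2))"
    by (rule measure_mono_fmeasurable[OF sub]) (use X mP in \<open>auto simp: fmeasurable_def emeasure_lborel_ball_finite[unfolded infinity_ennreal_def]\<close>)
  also have "\<dots> = unit_ball_vol (n + 1) * (r + 2) ^ (n + 1)"
    using card \<open>0 \<le> r\<close> by (simp add: content_ball)
  finally have "unit_ball_vol (n + 1) * (card X * J * (\<delta> / 4) ^ (n + 1)) \<le> unit_ball_vol (n + 1) * (r + 2) ^ (n + 1)"
    by (simp add: vol card_cartesian_product algebra_simps)
  then have 1: "card X * J * (\<delta> / 4) ^ (n + 1) \<le> (r + 2) ^ (n + 1)"
    by (rule mult_left_le_imp_le) (simp add: unit_ball_vol_pos)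
  \<comment> \<open>One of the n + 1 factors \<delta> is paid for by the number of
    translates.\<close>
  have "1 \<le> J * \<delta>" using J(1) \<delta> by (simp add: field_simps)
  then have "card X * \<delta> ^ n * 1 \<le> card X * \<delta> ^ n * (J * \<delta>)"
    using \<delta> by (intro mult_left_mono) auto
  also have "\<dots> = 4 ^ (n + 1) * (card X * J * (\<delta> / 4) ^ (n + 1))"
    by (simp add: power_divide)
  also have "\<dots> \<le> 4 ^ (n + 1) * (r + 2) ^ (n + 1)"
    using 1 by (intro mult_left_mono) auto
  finally show ?thesis by (simp only: power_mult_distrib mult_1_right)
qed

text \<open>\<open>packing_bound\<close> limits the cardinality of separated sets, so there is a
  d-separated subset X of T of largest cardinality. The balls of radius d around X cover T, since an
  uncovered point could be added, and their total weight is bounded independently of the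
  scale.\<close>

lemma hausdorff_pre_flat:
  fixes T :: "(real^'m::finite) set"
  assumes card: "CARD('m) = n + 1" and e: "norm e = 1"
    and flat: "\<And>y z. y \<in> T \<Longrightarrow> z \<in> T \<Longrightarrow> \<bar>e \<bullet> (y - z)\<bar> \<le> norm (y - z) / 2"
    and T: "T \<subseteq> cball x0 r" and "0 \<le> r" and \<delta>: "0 < \<delta>"
  shows "hausdorff_pre n \<delta> T \<le> ennreal (unit_ball_vol n * (4 * (r + 2)) ^ (n + 1))"
proof -
  \<comment> \<open>Balls of radius d have diameter 2 d \<le> \<delta>; the cap 1 meets the
    condition of \<open>packing_bound\<close>.\<close>
  define d where "d = min (\<delta> / 2) 1"
  have d: "0 < d" "d \<le> 1" "2 * d \<le> \<delta>" using \<delta> by (auto simp: d_def)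
  define M where "M = (4 * (r + 2)) ^ (n + 1) / d ^ n"
  define good where "good X \<longleftrightarrow> finite X \<and> X \<subseteq> T \<and> (\<forall>y\<in>X. \<forall>z\<in>X. y \<noteq> z \<longrightarrow> d \<le> dist y z)" for X
  have bd: "card X * d ^ n \<le> (4 * (r + 2)) ^ (n + 1)" if "good X" for X
    by (rule packing_bound[OF card e flat T \<open>0 \<le> r\<close>]) (use that d in \<open>auto simp: good_def\<close>)
  have "card X < Suc (nat \<lceil>M\<rceil>)" if "good X" for X
  proof -
    have "real (card X) \<le> M" using bd[OF that] d by (simp add: M_def field_simps)
    then show ?thesis by linarith
  qed
  moreover have "good {}" by (simp add: good_def)
  ultimately obtain X where X: "good X" "\<And>Y. good Y \<Longrightarrow> card Y \<le> card X"
    using ex_has_greatest_nat[of good "{}" card "Suc (nat \<lceil>M\<rceil>)"] by (meson less_imp_le_nat)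
  have fX: "finite X" using X by (simp add: good_def)
  have cov: "T \<subseteq> (\<Union>x\<in>X. cball x d)"
  proof
    fix y assume y: "y \<in> T"
    show "y \<in> (\<Union>x\<in>X. cball x d)"
    proof (rule ccontr)
      assume n: "y \<notin> (\<Union>x\<in>X. cball x d)"
      then have "good (insert y X)" "y \<notin> X"
        using X(1) y d by (auto simp: good_def dist_commute not_le less_imp_le)
      with X(2)[of "insert y X"] fX show False by simp
    qed
  qed
  have "hausdorff_pre n \<delta> T \<le> (\<Sum>x\<in>X. hausdorff_weight n (cball x d))"
    by (rule hausdorff_pre_finite_cover[OF fX cov]) (use d \<delta> in auto)
  also have "\<dots> = ennreal (unit_ball_vol n * (card X * d ^ n))"
    using d by (simp add: hausdorff_weight_def ennreal_mult' ennreal_of_nat_eq_real_of_nat mult.left_commute)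
  also have "\<dots> \<le> ennreal (unit_ball_vol n * (4 * (r + 2)) ^ (n + 1))"
    using bd[OF X(1)] by (intro ennreal_leI mult_left_mono) (auto simp: unit_ball_vol_nonneg)
  finally show ?thesis .
qed

text \<open>A weakening of the notion of hypersurface: containment in a level set replaces equality,
  and the gradient is nonzero at x itself. It is shared by compact pieces with arbitrary edge and by
  the sets \<open>sweep D t s\<close>.\<close>

definition locally_in_level_set :: "(real^'m::finite) set \<Rightarrow> bool" where
  "locally_in_level_set S \<longleftrightarrow>
     (\<forall>x\<in>S. \<exists>U \<sigma>. open U \<and> x \<in> U \<and> C1_on U \<sigma> \<and> (\<forall>y\<in>S \<inter> U. \<sigma> y = 0) \<and> grad \<sigma> x \<noteq> 0)"

text \<open>By the mean value theorem the gradient at some point of the segment between two zeros is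
  orthogonal to y - z; near x it differs from the gradient at x by at most half the length of the
  latter.\<close>

lemma level_set_flat:
  fixes U :: "(real^'m::finite) set"
  assumes U: "open U" "x \<in> U" "C1_on U \<sigma>" and g: "grad \<sigma> x \<noteq> 0"
  shows "\<exists>r>0. \<forall>y\<in>cball x r. \<forall>z\<in>cball x r. \<sigma> y = 0 \<longrightarrow> \<sigma> z = 0 \<longrightarrow>
    \<bar>(grad \<sigma> x /\<^sub>R norm (grad \<sigma> x)) \<bullet> (y - z)\<bar> \<le> norm (y - z) / 2"
proof -
  define a where "a = norm (grad \<sigma> x)"
  have a: "0 < a" using g by (simp add: a_def)
  have "continuous_on U (grad \<sigma>)"
    unfolding grad_def[abs_def] by (intro continuous_intros C1_on_D(2)[OF U(3)])
  then have "isCont (grad \<sigma>) x" using U continuous_on_eq_continuous_at by blast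
  then obtain r1 where r1: "0 < r1" "\<And>y. dist y x < r1 \<Longrightarrow> dist (grad \<sigma> y) (grad \<sigma> x) < a / 2"
    unfolding continuous_at_eps_delta using a by (meson half_gt_zero)
  obtain r2 where r2: "0 < r2" "ball x r2 \<subseteq> U" using U openE by blast
  define r where "r = min r1 r2 / 2"
  have r: "0 < r" "r < r1" "r < r2" using r1 r2 by (auto simp: r_def)
  show ?thesis
  proof (intro exI[of _ r] conjI ballI impI r(1))
    fix y z assume yz: "y \<in> cball x r" "z \<in> cball x r" "\<sigma> y = 0" "\<sigma> z = 0"
    have der: "((\<lambda>s. \<sigma> (z + s *\<^sub>R (y - z))) has_real_derivative grad \<sigma> (z + s *\<^sub>R (y - z)) \<bullet> (y - z)) (at s)"
      if "z + s *\<^sub>R (y - z) \<in> U" for s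
    proof -
      have "((\<lambda>s. z + s *\<^sub>R (y - z)) has_derivative (\<lambda>s. s *\<^sub>R (y - z))) (at s)"
        by (auto intro!: derivative_eq_intros)
      from has_derivative_compose[OF this has_derivative_grad[OF C1_on_D(1)[OF U(3) that]]]
      show ?thesis by (simp add: has_field_derivative_def mult_commute_abs)
    qed
    have seg: "z + s *\<^sub>R (y - z) \<in> cball x r" if "0 \<le> s" "s \<le> 1" for s
    proof -
      have "(1 - s) *\<^sub>R z + s *\<^sub>R y \<in> cball x r"
        using convexD_alt[OF convex_cball yz(2,1) that] .
      then show ?thesis by (simp add: algebra_simps)
    qed
    have "\<exists>s>0. s < 1 \<and> \<sigma> (z + 1 *\<^sub>R (y - z)) - \<sigma> (z + 0 *\<^sub>R (y - z)) = (1 - 0) * (grad \<sigma> (z + s *\<^sub>R (y - z)) \<bullet> (y - z))"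
    proof (rule MVT2)
      fix s :: real assume "0 \<le> s" "s \<le> 1"
      then have "z + s *\<^sub>R (y - z) \<in> U" using seg r r2 by (force simp: dist_commute)
      then show "((\<lambda>s. \<sigma> (z + s *\<^sub>R (y - z))) has_real_derivative grad \<sigma> (z + s *\<^sub>R (y - z)) \<bullet> (y - z)) (at s)"
        by (rule der)
    qed simp
    then obtain s where s: "0 < s" "s < 1" "grad \<sigma> (z + s *\<^sub>R (y - z)) \<bullet> (y - z) = 0"
      using yz by auto
    let ?\<xi> = "z + s *\<^sub>R (y - z)"
    have "dist ?\<xi> x < r1" using seg[of s] s r by (simp add: dist_commute)
    then have n: "norm (grad \<sigma> x - grad \<sigma> ?\<xi>) \<le> a / 2"
      using less_imp_le[OF r1(2)[of ?\<xi>]] by (simp only: dist_norm norm_minus_commute)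
    have "\<bar>grad \<sigma> x \<bullet> (y - z)\<bar> = \<bar>(grad \<sigma> x - grad \<sigma> ?\<xi>) \<bullet> (y - z)\<bar>"
      using s by (simp add: inner_diff_left)
    also have "\<dots> \<le> norm (grad \<sigma> x - grad \<sigma> ?\<xi>) * norm (y - z)" by (rule Cauchy_Schwarz_ineq2)
    also have "\<dots> \<le> a / 2 * norm (y - z)" using n by (intro mult_right_mono) auto
    finally show "\<bar>(grad \<sigma> x /\<^sub>R norm (grad \<sigma> x)) \<bullet> (y - z)\<bar> \<le> norm (y - z) / 2"
      using a unfolding a_def[symmetric] by (simp add: abs_mult field_simps)
  qed
qed

text \<open>Compactness yields finitely many flat pieces. As the bound is uniform in the scale it
  bounds the Hausdorff measure itself, without any parametrisation of the surface.\<close>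

lemma level_set_hausdorff_bound:
  fixes S :: "(real^'m::finite) set"
  assumes card: "CARD('m) = n + 1" and S: "compact S" "locally_in_level_set S"
  obtains B where "0 \<le> B" "\<And>\<delta>. 0 < \<delta> \<Longrightarrow> hausdorff_pre n \<delta> S \<le> ennreal B"
proof -
  have "\<exists>r>0. \<exists>B\<ge>0. \<forall>\<delta>>0. hausdorff_pre n \<delta> (S \<inter> cball x r) \<le> ennreal B" if "x \<in> S" for x
  proof -
    have "\<exists>U \<sigma>. open U \<and> x \<in> U \<and> C1_on U \<sigma> \<and> (\<forall>y\<in>S \<inter> U. \<sigma> y = 0) \<and> grad \<sigma> x \<noteq> 0"
      using S(2) that by (simp only: locally_in_level_set_def)
    then obtain U \<sigma> where U: "open U" "x \<in> U" "C1_on U \<sigma>" "\<forall>y\<in>S \<inter> U. \<sigma> y = 0" "grad \<sigma> x \<noteq> 0"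
      by (elim exE conjE)
    obtain r where r: "0 < r" "\<forall>y\<in>cball x r. \<forall>z\<in>cball x r. \<sigma> y = 0 \<longrightarrow> \<sigma> z = 0 \<longrightarrow>
      \<bar>(grad \<sigma> x /\<^sub>R norm (grad \<sigma> x)) \<bullet> (y - z)\<bar> \<le> norm (y - z) / 2"
      using level_set_flat[OF U(1,2,3,5)] by (elim exE conjE)
    obtain r' where r': "0 < r'" "cball x r' \<subseteq> U" using U open_contains_cball by blast
    define q where "q = min r r'"
    have q: "0 < q" "q \<le> r" "cball x q \<subseteq> U" using r r' by (auto simp: q_def)
    have "hausdorff_pre n \<delta> (S \<inter> cball x q) \<le> ennreal (unit_ball_vol n * (4 * (q + 2)) ^ (n + 1))" if "0 < \<delta>" for \<delta>
    proof (rule hausdorff_pre_flat[OF card, where e = "grad \<sigma> x /\<^sub>R norm (grad \<sigma> x)" and ?x0.0 = x])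
      show "norm (grad \<sigma> x /\<^sub>R norm (grad \<sigma> x)) = 1" using U(5) by simp
      fix y z assume "y \<in> S \<inter> cball x q" "z \<in> S \<inter> cball x q"
      then show "\<bar>(grad \<sigma> x /\<^sub>R norm (grad \<sigma> x)) \<bullet> (y - z)\<bar> \<le> norm (y - z) / 2"
        using q U(4) by (intro r(2)[rule_format]) (auto simp: subset_iff)
    qed (use q that in auto)
    moreover have "0 \<le> unit_ball_vol n * (4 * (q + 2)) ^ (n + 1)"
      using q by (simp add: unit_ball_vol_nonneg)
    ultimately show ?thesis using q(1) by blast
  qed
  then obtain r B where rB: "\<And>x. x \<in> S \<Longrightarrow> 0 < r x" "\<And>x. x \<in> S \<Longrightarrow> (0::real) \<le> B x"
    "\<And>x \<delta>. x \<in> S \<Longrightarrow> 0 < \<delta> \<Longrightarrow> hausdorff_pre n \<delta> (S \<inter> cball x (r x)) \<le> ennreal (B x)"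
    by metis
  obtain X where X: "X \<subseteq> S" "finite X" "S \<subseteq> (\<Union>x\<in>X. ball x (r x))"
    using compactE_image[OF S(1), of S "\<lambda>x. ball x (r x)"] rB(1) by force
  show ?thesis
  proof (rule that[of "\<Sum>x\<in>X. B x"])
    show "0 \<le> (\<Sum>x\<in>X. B x)" by (rule sum_nonneg, rule rB(2), rule subsetD[OF X(1)])
    fix \<delta> :: real assume \<delta>: "0 < \<delta>"
    have "S \<subseteq> (\<Union>x\<in>X. S \<inter> cball x (r x))" using X(3) ball_subset_cball by blast
    then have "hausdorff_pre n \<delta> S \<le> hausdorff_pre n \<delta> (\<Union>x\<in>X. S \<inter> cball x (r x))"
      by (rule hausdorff_pre_mono)
    also have "\<dots> \<le> (\<Sum>x\<in>X. hausdorff_pre n \<delta> (S \<inter> cball x (r x)))"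
      using X(2) \<delta> by (intro hausdorff_pre_subadditive) auto
    also have "\<dots> \<le> (\<Sum>x\<in>X. ennreal (B x))" by (rule sum_mono, rule rB(3)[OF subsetD[OF X(1)] \<delta>])
    also have "\<dots> = ennreal (\<Sum>x\<in>X. B x)" by (rule sum_ennreal, rule rB(2), rule subsetD[OF X(1)])
    finally show "hausdorff_pre n \<delta> S \<le> ennreal (\<Sum>x\<in>X. B x)" .
  qed
qed

text \<open>A cover of mesh \<delta> has total volume at most a constant times \<delta> times its
  n-dimensional weight, because one of the n + 1 factors of the diameter is at most
  \<delta>.\<close>

lemma level_set_null:
  fixes S :: "(real^'m::finite) set"
  assumes card: "CARD('m) = n + 1" and S: "compact S" "locally_in_level_set S"
  shows "emeasure lborel S = 0"
proof -
  obtain B where B: "0 \<le> B" "\<And>\<delta>. 0 < \<delta> \<Longrightarrow> hausdorff_pre n \<delta> S \<le> ennreal B"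
    using level_set_hausdorff_bound[OF assms] by blast
  \<comment> \<open>Quotient of the volume \<open>unit_ball_vol (n + 1) * d ^ (n + 1)\<close> and
    the weight \<open>unit_ball_vol n * (d / 2) ^ n\<close>, once a factor d of the volume has been
    replaced by \<delta>.\<close>
  define C where "C = unit_ball_vol (n + 1) * 2 ^ n / unit_ball_vol n"
  have C: "0 \<le> C" by (simp add: C_def unit_ball_vol_nonneg)
  have main: "emeasure lborel S \<le> ennreal (C * \<delta> * (B + 1))" if \<delta>: "0 < \<delta>" for \<delta>
  proof -
    have "hausdorff_pre n \<delta> S < ennreal (B + 1)"
      using B(1) by (intro order_le_less_trans[OF B(2)[OF \<delta>]] ennreal_lessI) auto
    from hausdorff_pre_cover[OF this] obtain U :: "nat \<Rightarrow> (real^'m) set" where U: "S \<subseteq> (\<Union>k. U k)" "\<And>k. bounded (U k)" "\<And>k. diameter (U k) \<le> \<delta>"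
      "(\<Sum>k. hausdorff_weight n (U k)) < ennreal (B + 1)"
      by metis
    \<comment> \<open>The covering sets need not be measurable, so each one is enlarged to a closed
      ball around one of its points, with its diameter as radius.\<close>
    define V where "V k = (if U k = {} then {} else cball (SOME x. x \<in> U k) (diameter (U k)))" for k
    have UV: "U k \<subseteq> V k" for k
    proof (cases "U k = {}")
      case False
      then have "(SOME x. x \<in> U k) \<in> U k" by (simp add: some_in_eq)
      then show ?thesis using False diameter_bounded_bound[OF U(2)] by (auto simp: V_def)
    qed simp
    have vol: "emeasure lborel (V k) \<le> ennreal (C * \<delta>) * hausdorff_weight n (U k)" for k
    proof (cases "U k = {}")
      case False
      let ?d = "diameter (U k)"
      have d: "0 \<le> ?d" by (simp add: U(2) diameter_ge_0)
      have "emeasure lborel (V k) = ennreal (unit_ball_vol (n + 1) * ?d ^ (n + 1))"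
        using False d card by (simp add: V_def emeasure_cball)
      also have "\<dots> \<le> ennreal (unit_ball_vol (n + 1) * (\<delta> * ?d ^ n))"
        using d U(3)[of k] by (intro ennreal_leI mult_left_mono) (auto simp: unit_ball_vol_nonneg intro: mult_right_mono)
      also have "unit_ball_vol (n + 1) * (\<delta> * ?d ^ n) = (C * \<delta>) * (unit_ball_vol (real n) * (?d / 2) ^ n)"
        using less_imp_neq[OF unit_ball_vol_pos[OF of_nat_0_le_iff, of n]] by (simp add: C_def power_divide)
      also have "ennreal \<dots> = ennreal (C * \<delta>) * hausdorff_weight n (U k)"
        using False C \<delta> d by (simp add: hausdorff_weight_def ennreal_mult unit_ball_vol_nonneg)
      finally show ?thesis .
    qed (simp add: V_def)
    have mV: "V k \<in> sets lborel" for k by (simp add: V_def)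
    have "S \<subseteq> (\<Union>k. V k)" using U(1) UV by (meson SUP_mono UNIV_I subset_trans)
    then have "emeasure lborel S \<le> emeasure lborel (\<Union>k. V k)"
      using mV by (intro emeasure_mono) auto
    also have "\<dots> \<le> (\<Sum>k. emeasure lborel (V k))"
      by (rule emeasure_subadditive_countably) (use mV in auto)
    also have "\<dots> \<le> (\<Sum>k. ennreal (C * \<delta>) * hausdorff_weight n (U k))"
      by (intro suminf_le vol) auto
    also have "\<dots> = ennreal (C * \<delta>) * (\<Sum>k. hausdorff_weight n (U k))" by simp
    also have "\<dots> \<le> ennreal (C * \<delta>) * ennreal (B + 1)"
      using U(4) by (intro mult_left_mono) auto
    also have "\<dots> = ennreal (C * \<delta> * (B + 1))" using C \<delta> B(1) by (simp add: ennreal_mult)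
    finally show ?thesis .
  qed
  have "emeasure lborel S \<le> 0"
  proof (rule ennreal_le_epsilon)
    fix e :: real assume "0 < e"
    define \<delta> where "\<delta> = e / (C * (B + 1) + 1)"
    have pos: "0 < C * (B + 1) + 1" using C B by (intro add_nonneg_pos) auto
    then have \<delta>: "0 < \<delta>" using \<open>0 < e\<close> by (simp add: \<delta>_def)
    have "C * \<delta> * (B + 1) = e * (C * (B + 1) / (C * (B + 1) + 1))" by (simp add: \<delta>_def)
    also have "\<dots> \<le> e * 1" using \<open>0 < e\<close> pos by (intro mult_left_mono) (auto simp: divide_le_eq)
    finally show "emeasure lborel S \<le> 0 + ennreal e"
      using main[OF \<delta>] by (auto intro: order_trans ennreal_leI)
  qed
  then show ?thesis by simp
qed

section \<open>Quadratic forms of signature (n,1)\<close>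

definition bform :: "real^'m^'m \<Rightarrow> real^'m \<Rightarrow> real^'m::finite \<Rightarrow> real" where
  "bform A v w = (\<Sum>i\<in>UNIV. \<Sum>j\<in>UNIV. A $ i $ j * v $ i * w $ j)"

lemma bform_inner: "bform A v w = v \<bullet> (A *v w)"
  by (simp add: bform_def inner_vec_def matrix_vector_mult_def sum_distrib_left algebra_simps)

lemma bform_linear:
  "bform A (u + v) w = bform A u w + bform A v w"
  "bform A v (u + w) = bform A v u + bform A v w"
  "bform A (r *\<^sub>R v) w = r * bform A v w"
  "bform A v (r *\<^sub>R w) = r * bform A v w"
  "bform A (u - v) w = bform A u w - bform A v w"
  "bform A v (u - w) = bform A v u - bform A v w"
  by (simp_all add: bform_inner inner_add_left inner_add_right inner_diff_left inner_diff_right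
      matrix_vector_right_distrib matrix_vector_mult_diff_distrib matrix_vector_mult_scaleR)

lemma bform_commute: "transpose A = A \<Longrightarrow> bform A v w = bform A w v"
  unfolding bform_inner using dot_lmul_matrix[of v A w]
  by (metis inner_commute vector_transpose_matrix)

text \<open>The orthonormal bases of the eigenspaces form together a basis of the whole space, because
  their number is the full dimension; exactly one of these vectors belongs to a negative eigenvalue.\<close>

lemma signature_positive:
  fixes A :: "real^'m^'m::finite"
  assumes sym: "transpose A = A" and sig: "has_signature A n 1" and card: "CARD('m) = n + 1"
  obtains b0 where "\<And>v. v \<noteq> 0 \<Longrightarrow> v \<bullet> b0 = 0 \<Longrightarrow> 0 < bform A v v"
proof -
  define Ep where "Ep = {l. 0 < l \<and> eigenspace A l \<noteq> {0}}"
  define En where "En = {l. l < 0 \<and> eigenspace A l \<noteq> {0}}"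
  have sub: "subspace (eigenspace A l)" for l
    unfolding subspace_def eigenspace_def
    by (simp add: matrix_vector_right_distrib matrix_vector_mult_scaleR scaleR_add_right)
  have "\<exists>B. B \<subseteq> eigenspace A l \<and> pairwise orthogonal B \<and> (\<forall>x\<in>B. norm x = 1) \<and> independent B \<and>
      card B = dim (eigenspace A l) \<and> span B = eigenspace A l" for l
    using orthonormal_basis_subspace[OF sub[of l]] by metis
  then obtain B where B: "\<And>l. B l \<subseteq> eigenspace A l" "\<And>l. pairwise orthogonal (B l)"
    "\<And>l x. x \<in> B l \<Longrightarrow> norm x = 1" "\<And>l. independent (B l)" "\<And>l. card (B l) = dim (eigenspace A l)"
    "\<And>l. span (B l) = eigenspace A l"
    by metis
  have orth: "v \<bullet> w = 0" if "v \<in> eigenspace A l" "w \<in> eigenspace A k" "l \<noteq> k" for v w l k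
  proof -
    have "v \<bullet> (A *v w) = w \<bullet> (A *v v)" using bform_commute[OF sym] by (metis bform_inner)
    then have "k * (v \<bullet> w) = l * (v \<bullet> w)" using that by (simp add: eigenspace_def inner_commute)
    with that show ?thesis by simp
  qed
  have n1: "x \<bullet> x = 1" if "x \<in> B l" for x l using B(3)[OF that] by (simp add: norm_eq_1)
  have disj: "B l \<inter> B k = {}" if "l \<noteq> k" for l k
  proof (rule ccontr)
    assume "B l \<inter> B k \<noteq> {}"
    then obtain x where x: "x \<in> B l" "x \<in> B k" by blast
    then have "x \<bullet> x = 0" using orth[of x l x k] B(1) that by blast
    with n1[OF x(1)] show False by simp
  qed
  define BB where "BB = (\<Union>l\<in>Ep \<union> En. B l)"
  have pw: "pairwise orthogonal BB"
    unfolding pairwise_def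
  proof (intro ballI impI)
    fix x y assume "x \<in> BB" "y \<in> BB" and ne: "x \<noteq> y"
    then obtain l k where lk: "x \<in> B l" "y \<in> B k" by (auto simp: BB_def)
    show "orthogonal x y"
    proof (cases "l = k")
      case True then show ?thesis using lk B(2)[of l] ne by (auto simp: pairwise_def)
    next
      case False then show ?thesis using lk orth B(1) unfolding orthogonal_def by blast
    qed
  qed
  have nz: "0 \<notin> BB" using n1 by (force simp: BB_def)
  have ind: "independent BB" by (rule pairwise_orthogonal_independent[OF pw nz])
  then have finB: "finite BB" using independent_bound by blast
  have ne: "B l \<noteq> {}" if "l \<in> Ep \<union> En" for l
    using that B(6)[of l] by (auto simp: Ep_def En_def)
  \<comment> \<open>A sum over an infinite index set is 0, so the sums in
    \<open>has_signature\<close> count multiplicities only if the eigenvalues are finitely many. One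
    basis vector from each eigenspace embeds them into the finite set \<open>BB\<close>.\<close>
  have finE: "finite (Ep \<union> En)"
  proof (rule inj_on_finite[OF _ _ finB])
    let ?f = "\<lambda>l. SOME x. x \<in> B l"
    have f: "?f l \<in> B l" if "l \<in> Ep \<union> En" for l using ne[OF that] by (simp add: some_in_eq)
    show "inj_on ?f (Ep \<union> En)" using f disj by (intro inj_onI) (metis disjoint_iff)
    show "?f ` (Ep \<union> En) \<subseteq> BB" using f unfolding BB_def by blast
  qed
  have fB: "finite (B l)" for l using B(4) independent_bound by blast
  have cU: "card (\<Union>l\<in>E. B l) = (\<Sum>l\<in>E. dim (eigenspace A l))" if "E \<subseteq> Ep \<union> En" for E
    using that finE disj fB by (subst card_UN_disjoint) (auto simp: B(5) finite_subset)
  have "card (\<Union>l\<in>En. B l) = 1"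
    using cU[of En] sig by (auto simp: has_signature_def En_def)
  then obtain b0 where b0: "(\<Union>l\<in>En. B l) = {b0}" by (auto simp: card_1_singleton_iff)
  have "card BB = (\<Sum>l\<in>Ep. dim (eigenspace A l)) + (\<Sum>l\<in>En. dim (eigenspace A l))"
    unfolding BB_def using finE by (subst cU, simp, subst sum.union_disjoint) (auto simp: Ep_def En_def)
  also have "\<dots> = n + 1" using sig by (auto simp: has_signature_def En_def Ep_def)
  finally have cBB: "card BB = DIM(real^'m)" using card by simp
  have spn: "span BB = UNIV"
    using card_ge_dim_independent[OF subset_UNIV ind] cBB by (auto simp: dim_UNIV)
  show ?thesis
  proof (rule that[of b0])
    fix v :: "real^'m" assume v: "v \<noteq> 0" "v \<bullet> b0 = 0"
    have ex: "(\<Sum>i\<in>BB. (v \<bullet> i) *\<^sub>R i) = v"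
      by (rule orthonormal_basis_expand[OF pw _ _ finB]) (use B(3) spn in \<open>auto simp: BB_def\<close>)
    \<comment> \<open>Each summand is an eigenvalue times (v . i)^2; the one for b0 vanishes by
      orthogonality, and all other vectors of \<open>BB\<close> have positive eigenvalues.\<close>
    have summand: "0 \<le> (v \<bullet> i) * (v \<bullet> (A *v i)) \<and> (v \<bullet> i \<noteq> 0 \<longrightarrow> 0 < (v \<bullet> i) * (v \<bullet> (A *v i)))"
      if "i \<in> BB" for i
    proof (cases "i = b0")
      case False
      with that b0 obtain l where l: "l \<in> Ep" "i \<in> B l" by (auto simp: BB_def)
      then have "A *v i = l *\<^sub>R i" using B(1) by (auto simp: eigenspace_def)
      then have "(v \<bullet> i) * (v \<bullet> (A *v i)) = l * (v \<bullet> i)\<^sup>2" by (simp add: power2_eq_square)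
      then show ?thesis using l by (auto simp: Ep_def)
    qed (use v in simp)
    have "bform A v v = v \<bullet> (A *v (\<Sum>i\<in>BB. (v \<bullet> i) *\<^sub>R i))" by (simp add: bform_inner ex)
    also have "A *v (\<Sum>i\<in>BB. (v \<bullet> i) *\<^sub>R i) = (\<Sum>i\<in>BB. (v \<bullet> i) *\<^sub>R (A *v i))"
      by (simp add: linear_sum[OF matrix_vector_mul_linear] matrix_vector_mult_scaleR)
    also have "v \<bullet> \<dots> = (\<Sum>i\<in>BB. (v \<bullet> i) * (v \<bullet> (A *v i)))" by (simp add: inner_sum_right)
    finally have eq: "bform A v v = (\<Sum>i\<in>BB. (v \<bullet> i) * (v \<bullet> (A *v i)))" .
    have "\<exists>i\<in>BB. v \<bullet> i \<noteq> 0"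
    proof (rule ccontr)
      assume "\<not> ?thesis"
      then have "(\<Sum>i\<in>BB. (v \<bullet> i) *\<^sub>R i) = 0" by (intro sum.neutral) simp
      with ex v show False by simp
    qed
    then show "0 < bform A v v"
      unfolding eq using summand finB by (meson sum_pos2)
  qed
qed

text \<open>The dominant energy condition for the multiplier A \<tau>.\<close>

lemma energy_density_pos:
  fixes A :: "real^'m^'m::finite"
  assumes sym: "transpose A = A" and sig: "has_signature A n 1" and card: "CARD('m) = n + 1"
    and \<tau>: "timelike_conormal A \<tau>" and \<eta>: "\<eta> \<noteq> 0"
  shows "0 < (bform A \<tau> \<eta>)\<^sup>2 - bform A \<tau> \<tau> * bform A \<eta> \<eta> / 2"
proof -
  obtain b0 where b0: "\<And>v. v \<noteq> 0 \<Longrightarrow> v \<bullet> b0 = 0 \<Longrightarrow> 0 < bform A v v"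
    using signature_positive[OF sym sig card] by blast
  have neg: "bform A \<tau> \<tau> < 0" using \<tau> by (simp add: timelike_conormal_def bform_def)
  \<comment> \<open>\<eta> is split into a multiple of \<tau> and a part \<zeta> that is orthogonal
    to \<tau> with respect to A.\<close>
  define a where "a = bform A \<tau> \<eta> / bform A \<tau> \<tau>"
  define \<zeta> where "\<zeta> = \<eta> - a *\<^sub>R \<tau>"
  have z: "bform A \<tau> \<zeta> = 0" "bform A \<zeta> \<tau> = 0"
    using neg bform_commute[OF sym, of \<tau> \<zeta>] by (auto simp: \<zeta>_def bform_linear a_def)
  have zpos: "0 < bform A \<zeta> \<zeta>" if "\<zeta> \<noteq> 0"
  proof (rule ccontr)
    assume np: "\<not> 0 < bform A \<zeta> \<zeta>"
    \<comment> \<open>The combination of \<tau> and \<zeta> that is orthogonal to b0 in the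
      Euclidean sense. If A were nonpositive on \<zeta>, it would be so on v; this forces v = 0,
      then \<zeta> is orthogonal to b0, and A is positive on it after all.\<close>
    define v where "v = (\<zeta> \<bullet> b0) *\<^sub>R \<tau> - (\<tau> \<bullet> b0) *\<^sub>R \<zeta>"
    have bv: "bform A v v = (\<zeta> \<bullet> b0)\<^sup>2 * bform A \<tau> \<tau> + (\<tau> \<bullet> b0)\<^sup>2 * bform A \<zeta> \<zeta>"
      using z by (simp add: v_def bform_linear power2_eq_square algebra_simps)
    have "(\<zeta> \<bullet> b0)\<^sup>2 * bform A \<tau> \<tau> \<le> 0" "(\<tau> \<bullet> b0)\<^sup>2 * bform A \<zeta> \<zeta> \<le> 0"
      using neg np by (auto intro!: mult_nonneg_nonpos)
    with bv have "\<not> 0 < bform A v v" by linarith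
    moreover have "v \<bullet> b0 = 0" by (simp add: v_def inner_diff_left)
    ultimately have v0: "v = 0" using b0 by blast
    have "bform A \<tau> v = (\<zeta> \<bullet> b0) * bform A \<tau> \<tau>" using z by (simp add: v_def bform_linear)
    then have 1: "\<zeta> \<bullet> b0 = 0" using v0 neg by (simp add: bform_inner)
    then have "\<not> \<zeta> \<noteq> 0" using b0[of \<zeta>] np by blast
    with that show False by simp
  qed
  have e: "\<eta> = a *\<^sub>R \<tau> + \<zeta>" by (simp add: \<zeta>_def)
  let ?q = "bform A \<tau> \<tau>"
  \<comment> \<open>In the split form both terms are nonnegative since
    \<open>bform A \<tau> \<tau>\<close> is negative, and one is positive because a and \<zeta> do
    not both vanish.\<close>
  have "(bform A \<tau> \<eta>)\<^sup>2 - ?q * bform A \<eta> \<eta> / 2 = (a * ?q)\<^sup>2 / 2 + (- ?q) * bform A \<zeta> \<zeta> / 2"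
    using z unfolding e by (simp add: bform_linear power2_eq_square algebra_simps)
  moreover have "0 < (a * ?q)\<^sup>2 / 2 + (- ?q) * bform A \<zeta> \<zeta> / 2"
  proof (cases "\<zeta> = 0")
    case True
    then have "a \<noteq> 0" using \<eta> e by auto
    with neg True show ?thesis by (simp add: bform_inner)
  next
    case False
    from mult_pos_pos[OF _ zpos[OF this], of "- ?q"] neg show ?thesis
      by (intro add_nonneg_pos) auto
  qed
  ultimately show ?thesis by simp
qed

section \<open>Cutoff functions around a set of finite Hausdorff measure\<close>

lemma C1_on_norm_power2:
  fixes a :: "real^'m::finite"
  shows "C1_on U (\<lambda>x. (norm (x - a))\<^sup>2)" "grad (\<lambda>x. (norm (x - a))\<^sup>2) x = 2 *\<^sub>R (x - a)"
proof -
  have d: "((\<lambda>x. (norm (x - a))\<^sup>2) has_derivative (\<lambda>v. 2 * ((x - a) \<bullet> v))) (at x)" for x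
    unfolding power2_norm_eq_inner
    by (auto intro!: derivative_eq_intros simp: inner_commute)
  have p: "pd i (\<lambda>x. (norm (x - a))\<^sup>2) x = 2 * (x - a) $ i" for i x
    using pd_eqI[OF d] by (simp add: inner_axis)
  then show "grad (\<lambda>x. (norm (x - a))\<^sup>2) x = 2 *\<^sub>R (x - a)"
    by (simp add: vec_eq_iff)
  show "C1_on U (\<lambda>x. (norm (x - a))\<^sup>2)"
    unfolding C1_on_def p[abs_def] using d by (auto simp: differentiable_def intro!: continuous_intros)
qed

text \<open>In terms of \<rho> = |x - a|^2 / r^2 - 1 this is a C1 step from 0 for \<rho> \<le> 0 to
  1 for \<rho> \<ge> 1, made of two nested squared positive parts.\<close>

definition bump :: "real^'m::finite \<Rightarrow> real \<Rightarrow> real^'m \<Rightarrow> real" where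
  "bump a r x = 1 - (max 0 (1 - (max 0 ((norm (x - a))\<^sup>2 / r\<^sup>2 - 1))\<^sup>2))\<^sup>2"

lemma bump_range: "0 \<le> bump a r x" "bump a r x \<le> 1"
proof -
  have "(max 0 (1 - (max 0 ((norm (x - a))\<^sup>2 / r\<^sup>2 - 1))\<^sup>2))\<^sup>2 \<le> 1"
    by (intro power_le_one) auto
  then show "0 \<le> bump a r x" "bump a r x \<le> 1" by (auto simp: bump_def)
qed

lemma bump_near: "0 < r \<Longrightarrow> dist x a \<le> r \<Longrightarrow> bump a r x = 0"
  by (simp add: bump_def dist_norm max_def power_mono)

lemma bump_far:
  assumes "0 < r" "2 * r \<le> dist x a"
  shows "bump a r x = 1"
proof -
  have "(2 * r)\<^sup>2 \<le> (norm (x - a))\<^sup>2" using assms by (intro power_mono) (auto simp: dist_norm)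
  then have "4 \<le> (norm (x - a))\<^sup>2 / r\<^sup>2" using assms by (simp add: field_simps)
  then have "1 \<le> (max 0 ((norm (x - a))\<^sup>2 / r\<^sup>2 - 1))\<^sup>2" by (intro one_le_power) auto
  then show ?thesis by (simp add: bump_def max_def)
qed

text \<open>By the chain rule the gradient has norm at most 2 * 2 * (2 / r^2) * |x - a|, and it
  vanishes unless |x - a| \<le> 2 r; hence the constant 16.\<close>

lemma C1_on_bump: "C1_on U (bump a r)"
  and norm_grad_bump: "0 < r \<Longrightarrow> norm (grad (bump a r) x) \<le> 16 / r * indicator (cball a (2 * r)) x"
proof -
  define \<rho> where "\<rho> x = (norm (x - a))\<^sup>2 * inverse (r\<^sup>2) - 1" for x
  define P where "P y = (max 0 y)\<^sup>2" for y :: real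
  have dP: "(P has_real_derivative 2 * max 0 y) (at y)" for y
    unfolding P_def[abs_def] by (rule has_real_derivative_pospart_power2)
  have cP: "continuous_on UNIV (\<lambda>y::real. 2 * max 0 y)" by (intro continuous_intros)
  have C\<rho>: "C1_on U \<rho>" for U
    unfolding \<rho>_def[abs_def] by (intro C1_on_diff C1_on_mult C1_on_norm_power2 C1_on_const)
  have CQ: "C1_on U (\<lambda>x. 1 - P (\<rho> x))" for U
    by (intro C1_on_diff C1_on_const C1_on_compose[OF C\<rho> dP cP])
  have b: "bump a r = (\<lambda>x. 1 - P (1 - P (\<rho> x)))"
    by (simp add: bump_def[abs_def] P_def \<rho>_def divide_inverse)
  show "C1_on U (bump a r)"
    unfolding b by (intro C1_on_diff C1_on_const C1_on_compose[OF CQ dP cP])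
  assume r: "0 < r"
  note d\<rho> = C1_on_D(1)[OF C\<rho>[of UNIV], OF UNIV_I] and dQ = C1_on_D(1)[OF CQ[of UNIV], OF UNIV_I]
    and dPQ = C1_on_D(1)[OF C1_on_compose[OF CQ[of UNIV] dP cP], OF UNIV_I]
    and dP\<rho> = C1_on_D(1)[OF C1_on_compose[OF C\<rho>[of UNIV] dP cP], OF UNIV_I]
    and dN = C1_on_D(1)[OF C1_on_norm_power2(1)[of UNIV], OF UNIV_I]
  have p\<rho>: "pd i \<rho> x = 2 * (x - a) $ i * inverse (r\<^sup>2)" for i
    using arg_cong[OF C1_on_norm_power2(2)[of a x], of "\<lambda>v. v $ i"]
    unfolding \<rho>_def[abs_def] by (simp add: pd_diff pd_mult dN differentiable_mult)
  have "pd i (bump a r) x = (2 * max 0 (1 - P (\<rho> x))) * (2 * max 0 (\<rho> x)) * (2 * inverse (r\<^sup>2)) * (x - a) $ i" for i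
    unfolding b by (simp add: pd_diff dPQ dP\<rho> pd_compose[OF dQ dP] pd_compose[OF d\<rho> dP] p\<rho>)
  then have g: "grad (bump a r) x = ((2 * max 0 (1 - P (\<rho> x))) * (2 * max 0 (\<rho> x)) * (2 * inverse (r\<^sup>2))) *\<^sub>R (x - a)"
    by (simp add: vec_eq_iff)
  show "norm (grad (bump a r) x) \<le> 16 / r * indicator (cball a (2 * r)) x"
  proof (cases "\<rho> x < 1")
    case False
    then have "1 \<le> P (\<rho> x)" unfolding P_def by (intro one_le_power) auto
    then show ?thesis using r by (simp add: g)
  next
    case True
    have "(norm (x - a))\<^sup>2 = (\<rho> x + 1) * r\<^sup>2" using r by (simp add: \<rho>_def)
    also have "\<dots> \<le> 4 * r\<^sup>2" using True by (intro mult_right_mono) auto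
    also have "\<dots> = (2 * r)\<^sup>2" by simp
    finally have n: "norm (x - a) \<le> 2 * r" by (rule power2_le_imp_le) (use r in simp)
    have "norm (grad (bump a r) x) = (2 * max 0 (1 - P (\<rho> x))) * (2 * max 0 (\<rho> x)) * (2 * inverse (r\<^sup>2)) * norm (x - a)"
      unfolding g by (simp add: abs_mult)
    also have "\<dots> \<le> (2 * 1) * (2 * 1) * (2 * inverse (r\<^sup>2)) * (2 * r)"
      using True n r by (intro mult_mono) (auto simp: P_def)
    also have "\<dots> = 16 / r" using r by (simp add: power2_eq_square field_simps)
    finally show ?thesis using n by (simp add: dist_norm norm_minus_commute)
  qed
qed

text \<open>In the product rule every factor that is not differentiated is at most 1, so no constant
  depending on the number of factors appears.\<close>

lemma C1_on_prod_unit_interval: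
  fixes f :: "'i \<Rightarrow> real^'m::finite \<Rightarrow> real"
  assumes "finite I" "\<And>k. k \<in> I \<Longrightarrow> C1_on UNIV (f k)" "\<And>k x. k \<in> I \<Longrightarrow> 0 \<le> f k x \<and> f k x \<le> 1"
  shows "C1_on UNIV (\<lambda>x. \<Prod>k\<in>I. f k x) \<and>
    (\<forall>x. norm (grad (\<lambda>x. \<Prod>k\<in>I. f k x) x) \<le> (\<Sum>k\<in>I. norm (grad (f k) x)))"
  using assms
proof (induction I rule: finite_induct)
  case empty
  have "grad (\<lambda>x. 1) x = 0" for x :: "real^'m" by (simp add: vec_eq_iff)
  then show ?case by simp
next
  case (insert j I)
  let ?g = "\<lambda>x. \<Prod>k\<in>I. f k x"
  have IH: "C1_on UNIV ?g" "\<And>x. norm (grad ?g x) \<le> (\<Sum>k\<in>I. norm (grad (f k) x))"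
    using insert by auto
  have fj: "C1_on UNIV (f j)" "\<And>x. 0 \<le> f j x" "\<And>x. f j x \<le> 1" using insert.prems by auto
  have g01: "0 \<le> ?g x" "?g x \<le> 1" for x
    using insert.prems by (auto intro!: prod_nonneg prod_le_1)
  have e: "(\<lambda>x. \<Prod>k\<in>insert j I. f k x) = (\<lambda>x. f j x * ?g x)" using insert.hyps by simp
  have "grad (\<lambda>x. f j x * ?g x) x = f j x *\<^sub>R grad ?g x + ?g x *\<^sub>R grad (f j) x" for x
    using C1_on_D(1)[OF fj(1) UNIV_I] C1_on_D(1)[OF IH(1) UNIV_I]
    by (simp add: vec_eq_iff pd_mult)
  moreover have "norm (f j x *\<^sub>R grad ?g x + ?g x *\<^sub>R grad (f j) x) \<le> (\<Sum>k\<in>insert j I. norm (grad (f k) x))" for x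
  proof -
    have "norm (f j x *\<^sub>R grad ?g x) \<le> norm (grad ?g x)" "norm (?g x *\<^sub>R grad (f j) x) \<le> norm (grad (f j) x)"
      using fj g01[of x] by (auto intro!: mult_left_le_one_le)
    moreover have "(\<Sum>k\<in>insert j I. norm (grad (f k) x)) = norm (grad (f j) x) + (\<Sum>k\<in>I. norm (grad (f k) x))"
      using insert.hyps by simp
    ultimately show ?thesis
      using IH(2)[of x] norm_triangle_ineq[of "f j x *\<^sub>R grad ?g x" "?g x *\<^sub>R grad (f j) x"] by linarith
  qed
  ultimately have "norm (grad (\<lambda>x. f j x * ?g x) x) \<le> (\<Sum>k\<in>insert j I. norm (grad (f k) x))" for x
    by presburger
  then show ?case unfolding e using C1_on_mult[OF fj(1) IH(1)] by blast
qed

text \<open>A covering set that meets A lies in a ball around one of its points in A whose radius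
  slightly exceeds its diameter; c converts weights into n-th powers of diameters. Finite subsums
  suffice, since compactness later selects a finite subcover.\<close>

lemma hausdorff_ball_cover:
  fixes A :: "'a::euclidean_space set"
  assumes b: "hausdorff_pre n \<delta> A \<le> ennreal b" "0 \<le> b" and "0 < \<delta>" "0 < e"
  defines "c \<equiv> 2 ^ n / unit_ball_vol (real n)"
  shows "\<exists>(x :: nat \<Rightarrow> 'a) r K. (\<forall>k\<in>K. x k \<in> A) \<and> (\<forall>k. 0 < r k) \<and> (\<forall>k. r k \<le> 2 * \<delta>) \<and>
    A \<subseteq> (\<Union>k\<in>K. ball (x k) (r k)) \<and> (\<forall>F. finite F \<longrightarrow> F \<subseteq> K \<longrightarrow> (\<Sum>k\<in>F. r k ^ n) \<le> c * b + e)"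
proof -
  have v: "0 < unit_ball_vol (real n)" by simp
  have c: "0 < c" unfolding c_def by (intro divide_pos_pos v) simp
  \<comment> \<open>Half of the error e is spent on the choice of the cover, the other half on
    enlarging the radii.\<close>
  define e1 where "e1 = e / (2 * c)"
  have e1: "0 < e1" "c * e1 = e / 2" using c \<open>0 < e\<close> by (auto simp: e1_def)
  have "hausdorff_pre n \<delta> A < ennreal (b + e1)"
    using b e1 by (intro order_le_less_trans[OF b(1)] ennreal_lessI) auto
  from hausdorff_pre_cover[OF this] obtain U :: "nat \<Rightarrow> 'a set" where
    U: "A \<subseteq> (\<Union>k. U k)" "\<And>k. bounded (U k)" "\<And>k. diameter (U k) \<le> \<delta>"
      "(\<Sum>k. hausdorff_weight n (U k)) < ennreal (b + e1)" by metis
  define d where "d k = diameter (U k)" for k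
  have d: "0 \<le> d k" "d k \<le> \<delta>" for k using U by (auto simp: d_def diameter_ge_0)
  define K where "K = {k. U k \<inter> A \<noteq> {}}"
  define x where "x k = (SOME y. y \<in> U k \<inter> A)" for k
  have x: "x k \<in> U k \<inter> A" if "k \<in> K" for k
    using that unfolding x_def K_def some_in_eq by simp
  \<comment> \<open>A radius strictly above the diameter allows open balls and is positive even for
    one-point sets; the excess of the n-th powers is summable over k.\<close>
  have "\<exists>r. d k < r \<and> r \<le> 2 * \<delta> \<and> r ^ n < d k ^ n + e / 2 * (1/2) ^ Suc k" for k
  proof -
    have "((\<lambda>r. r ^ n) \<longlongrightarrow> d k ^ n) (at_right (d k))" by (intro tendsto_intros)
    then have "eventually (\<lambda>r. r ^ n < d k ^ n + e / 2 * (1/2) ^ Suc k) (at_right (d k))"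
      using assms by (intro order_tendstoD(2)) auto
    moreover have "eventually (\<lambda>r. r < 2 * \<delta>) (at_right (d k))"
      using d[of k] \<open>0 < \<delta>\<close> by (intro eventually_at_right_real[of "d k" "2 * \<delta>", THEN eventually_mono]) auto
    moreover have "eventually (\<lambda>r. d k < r) (at_right (d k))" by (simp add: eventually_at_right_less)
    ultimately have "eventually (\<lambda>r. d k < r \<and> r \<le> 2 * \<delta> \<and> r ^ n < d k ^ n + e / 2 * (1/2) ^ Suc k) (at_right (d k))"
      by eventually_elim auto
    then show ?thesis using eventually_happens' trivial_limit_at_right_real by blast
  qed
  then obtain r where r: "\<And>k. d k < r k" "\<And>k. r k \<le> 2 * \<delta>" "\<And>k. r k ^ n < d k ^ n + e / 2 * (1/2) ^ Suc k"
    by metis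
  show ?thesis
  proof (intro exI[of _ x] exI[of _ r] exI[of _ K] conjI allI impI ballI)
    show "0 < r k" for k using r(1)[of k] d(1)[of k] by simp
    show "r k \<le> 2 * \<delta>" for k by (rule r(2))
    show "x k \<in> A" if "k \<in> K" for k using x[OF that] by simp
    show "A \<subseteq> (\<Union>k\<in>K. ball (x k) (r k))"
    proof
      fix y assume y: "y \<in> A"
      then obtain k where k: "y \<in> U k" using U(1) by blast
      with y have kK: "k \<in> K" by (auto simp: K_def)
      have "dist (x k) y \<le> d k"
        unfolding d_def using x[OF kK] k by (intro diameter_bounded_bound U(2)) auto
      then have "y \<in> ball (x k) (r k)" using r(1)[of k] by simp
      with kK show "y \<in> (\<Union>k\<in>K. ball (x k) (r k))" by blast
    qed
    fix F assume F: "finite F" "F \<subseteq> K"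
    have "ennreal (\<Sum>k\<in>F. unit_ball_vol (real n) * (d k / 2) ^ n) = (\<Sum>k\<in>F. hausdorff_weight n (U k))"
    proof (subst sum_ennreal[symmetric])
      show "(\<Sum>k\<in>F. ennreal (unit_ball_vol (real n) * (d k / 2) ^ n)) = (\<Sum>k\<in>F. hausdorff_weight n (U k))"
        using F by (intro sum.cong) (auto simp: hausdorff_weight_def d_def K_def)
    qed (use v d in auto)
    also have "\<dots> \<le> (\<Sum>k. hausdorff_weight n (U k))" using F by (intro sum_le_suminf) auto
    also have "\<dots> \<le> ennreal (b + e1)" using U(4) by simp
    finally have "(\<Sum>k\<in>F. unit_ball_vol (real n) * (d k / 2) ^ n) \<le> b + e1"
      using b e1 by (subst (asm) ennreal_le_iff) auto
    then have "c * (\<Sum>k\<in>F. unit_ball_vol (real n) * (d k / 2) ^ n) \<le> c * (b + e1)"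
      using c by (intro mult_left_mono) auto
    also have "c * (\<Sum>k\<in>F. unit_ball_vol (real n) * (d k / 2) ^ n) = (\<Sum>k\<in>F. d k ^ n)"
      unfolding sum_distrib_left using less_imp_neq[OF v] by (intro sum.cong) (auto simp: c_def power_divide)
    finally have 1: "(\<Sum>k\<in>F. d k ^ n) \<le> c * b + e / 2" using e1 by (simp add: distrib_left)
    have "(\<Sum>k\<in>F. r k ^ n) \<le> (\<Sum>k\<in>F. d k ^ n + e / 2 * (1/2) ^ Suc k)"
      using r(3) by (intro sum_mono less_imp_le)
    also have "\<dots> = (\<Sum>k\<in>F. d k ^ n) + e / 2 * (\<Sum>k\<in>F. (1/2) ^ Suc k)"
      by (simp add: sum.distrib sum_distrib_left)
    also have "(\<Sum>k\<in>F. (1/2::real) ^ Suc k) \<le> (\<Sum>k. (1/2) ^ Suc k)"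
      using F power_half_series by (intro sum_le_suminf) (auto simp: sums_iff)
    also have "(\<Sum>k. (1/2::real) ^ Suc k) = 1" using power_half_series by (simp add: sums_iff)
    finally show "(\<Sum>k\<in>F. r k ^ n) \<le> c * b + e" using 1 \<open>0 < e\<close> by simp
  qed
qed

text \<open>The weighted cover is assembled from covers of the level pieces of the weight.\<close>

lemma hausdorff_weighted_ball_cover:
  fixes S :: "'a::euclidean_space set"
  assumes S: "compact S" and B: "\<And>\<delta>. 0 < \<delta> \<Longrightarrow> hausdorff_pre n \<delta> S \<le> ennreal B" "0 \<le> B"
    and G: "continuous_on S G" "\<And>x. x \<in> S \<Longrightarrow> 0 \<le> G x" and pos: "0 < \<delta>" "0 < \<beta>"
  defines "c \<equiv> 2 ^ n / unit_ball_vol (real n)"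
  shows "\<exists>F :: ('a \<times> real) set. finite F \<and> (\<forall>p\<in>F. fst p \<in> S \<and> 0 < snd p \<and> snd p \<le> \<delta>) \<and>
    S \<subseteq> (\<Union>p\<in>F. ball (fst p) (snd p)) \<and>
    ennreal (\<Sum>p\<in>F. snd p ^ n * (G (fst p) + \<beta>))
      \<le> ennreal c * ((\<integral>\<^sup>+x\<in>S. ennreal (G x) \<partial>hausdorff_measure n) + ennreal (2 * \<beta> * B)) + ennreal \<beta>"
proof -
  have c: "0 < c" by (simp add: c_def)
  have "\<exists>M>0. \<forall>x\<in>S. \<bar>G x\<bar> \<le> M"
    using compact_imp_bounded[OF compact_continuous_image[OF G(1) S]] by (force simp: bounded_pos)
  then obtain M where M: "0 < M" "\<And>x. x \<in> S \<Longrightarrow> G x \<le> M" by (meson abs_le_D1)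
  define N where "N = nat \<lceil>M / \<beta>\<rceil> + 1"
  have N: "M < N * \<beta>"
  proof -
    have "M / \<beta> < N" unfolding N_def by linarith
    then show ?thesis using pos by (simp add: field_simps)
  qed
  \<comment> \<open>Layers on which G varies by less than \<beta>; the first N of them exhaust
    S.\<close>
  define A where "A j = {x\<in>S. real j * \<beta> \<le> G x \<and> G x < (real j + 1) * \<beta>}" for j
  have clo: "closed {x\<in>S. a \<le> G x}" for a
    using continuous_closed_preimage[OF G(1) compact_imp_closed[OF S] closed_atLeast[of a]]
    by (simp add: vimage_def Int_def)
  have "A j = {x\<in>S. real j * \<beta> \<le> G x} - {x\<in>S. (real j + 1) * \<beta> \<le> G x}" for j
    by (auto simp: A_def)
  then have Ab: "A j \<in> sets borel" for j
    by (simp only: sets.Diff borel_closed clo)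
  have Sb: "S \<in> sets borel" using S by (simp add: compact_imp_closed)
  have HS: "hausdorff_outer n S \<le> ennreal B"
    unfolding hausdorff_outer_def using B by (intro SUP_least) auto
  define b where "b j = enn2real (hausdorff_outer n (A j))" for j
  have HA: "hausdorff_outer n (A j) \<le> ennreal B" for j
    by (rule order_trans[OF hausdorff_outer_mono HS]) (auto simp: A_def)
  have b: "ennreal (b j) = hausdorff_outer n (A j)" "0 \<le> b j" for j
    using HA[of j] by (auto simp: b_def less_top[symmetric] intro!: ennreal_enn2real order_le_less_trans[OF HA])
  \<comment> \<open>The errors of the N covers enter with the weights
    \<open>(real j + 2) * \<beta>\<close> and must add up to at most \<beta>; the summand 1 keeps
    the denominator positive.\<close>
  define e where "e = \<beta> / ((\<Sum>j<N. (real j + 2) * \<beta>) + 1)"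
  have s0: "0 \<le> (\<Sum>j<N. (real j + 2) * \<beta>)" using pos by (intro sum_nonneg) auto
  then have e: "0 < e" "(\<Sum>j<N. (real j + 2) * \<beta>) * e \<le> \<beta>"
    using pos by (auto simp: e_def field_simps)
  define Q where "Q j x r K \<longleftrightarrow> (\<forall>k\<in>K. x k \<in> A j) \<and> (\<forall>k. 0 < r k) \<and> (\<forall>k. r k \<le> 2 * (\<delta> / 2)) \<and>
    A j \<subseteq> (\<Union>k\<in>K. ball (x k) (r k)) \<and> (\<forall>F. finite F \<longrightarrow> F \<subseteq> K \<longrightarrow> (\<Sum>k\<in>F. r k ^ n) \<le> c * b j + e)"
    for j and x :: "nat \<Rightarrow> 'a" and r K
  have "\<exists>x r K. Q j x r K" for j
  proof -
    have "hausdorff_pre n (\<delta> / 2) (A j) \<le> ennreal (b j)"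
      using pos unfolding b(1) by (intro hausdorff_pre_le_outer) simp
    from hausdorff_ball_cover[OF this b(2) half_gt_zero[OF pos(1)] e(1)] show ?thesis unfolding Q_def c_def .
  qed
  then obtain x r K where Q: "\<And>j. Q j (x j) (r j) (K j)" by metis
  have R: "\<And>j. \<forall>k\<in>K j. x j k \<in> A j" "\<And>j. \<forall>k. 0 < r j k" "\<And>j. \<forall>k. r j k \<le> 2 * (\<delta> / 2)"
    "\<And>j. A j \<subseteq> (\<Union>k\<in>K j. ball (x j k) (r j k))"
    "\<And>j. \<forall>F. finite F \<longrightarrow> F \<subseteq> K j \<longrightarrow> (\<Sum>k\<in>F. r j k ^ n) \<le> c * b j + e"
    using Q unfolding Q_def by blast+
  define I where "I = Sigma {..<N} K"
  have cov: "S \<subseteq> (\<Union>p\<in>I. ball (x (fst p) (snd p)) (r (fst p) (snd p)))"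
  proof
    fix y assume y: "y \<in> S"
    define j where "j = nat \<lfloor>G y / \<beta>\<rfloor>"
    have q: "0 \<le> G y / \<beta>" using G(2)[OF y] pos by simp
    then have "real j \<le> G y / \<beta>" "G y / \<beta> < real j + 1" unfolding j_def by linarith+
    then have "real j * \<beta> \<le> G y" "G y < (real j + 1) * \<beta>" using pos by (simp_all add: field_simps)
    then have yj: "y \<in> A j" using y by (simp add: A_def)
    have "real j * \<beta> < N * \<beta>" using \<open>real j * \<beta> \<le> G y\<close> M(2)[OF y] N by linarith
    then have "j < N" using pos by simp
    obtain k where "k \<in> K j" "y \<in> ball (x j k) (r j k)" using R(4)[of j] yj by blast
    with \<open>j < N\<close> have "(j, k) \<in> I" by (simp add: I_def)
    with \<open>y \<in> ball (x j k) (r j k)\<close> show "y \<in> (\<Union>p\<in>I. ball (x (fst p) (snd p)) (r (fst p) (snd p)))"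
      by (intro UN_I[of "(j,k)"]) auto
  qed
  obtain I0 where I0: "I0 \<subseteq> I" "finite I0" "S \<subseteq> (\<Union>p\<in>I0. ball (x (fst p) (snd p)) (r (fst p) (snd p)))"
    by (rule compactE_image[OF S _ cov]) auto
  define h where "h p = (x (fst p) (snd p), r (fst p) (snd p))" for p
  have term_nonneg: "0 \<le> snd (h p) ^ n * (G (fst (h p)) + \<beta>)" if "p \<in> I0" for p
  proof -
    have "x (fst p) (snd p) \<in> S" using that I0(1) R(1) by (auto simp: I_def A_def)
    then show ?thesis using G(2) pos R(2) by (auto simp: h_def less_imp_le)
  qed
  \<comment> \<open>\<open>h\<close> may identify indices, but passing to the image can only
    decrease a sum of nonnegative terms.\<close>
  have "(\<Sum>p\<in>h ` I0. snd p ^ n * (G (fst p) + \<beta>)) \<le> (\<Sum>p\<in>I0. snd (h p) ^ n * (G (fst (h p)) + \<beta>))"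
    using I0(2) term_nonneg by (rule sum_image_le[unfolded comp_def])
  also have "\<dots> \<le> (\<Sum>p\<in>I0. r (fst p) (snd p) ^ n * ((real (fst p) + 2) * \<beta>))"
  proof (rule sum_mono)
    fix p assume p: "p \<in> I0"
    have "x (fst p) (snd p) \<in> A (fst p)" using p I0(1) R(1) by (auto simp: I_def)
    then have "G (x (fst p) (snd p)) + \<beta> \<le> (real (fst p) + 2) * \<beta>" by (simp add: A_def algebra_simps)
    then show "snd (h p) ^ n * (G (fst (h p)) + \<beta>) \<le> r (fst p) (snd p) ^ n * ((real (fst p) + 2) * \<beta>)"
      using R(2) by (auto simp: h_def less_imp_le intro!: mult_left_mono)
  qed
  also have "\<dots> = (\<Sum>j<N. \<Sum>k | (j, k) \<in> I0. r j k ^ n * ((real j + 2) * \<beta>))"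
  proof -
    have "I0 = Sigma {..<N} (\<lambda>j. {k. (j, k) \<in> I0})" using I0(1) by (auto simp: I_def)
    moreover have "finite {k. (j, k) \<in> I0}" for j
      using finite_imageI[OF I0(2), of snd] by (rule finite_subset[rotated]) force
    ultimately show ?thesis by (subst sum.Sigma) (auto simp: case_prod_beta)
  qed
  also have "\<dots> \<le> (\<Sum>j<N. (real j + 2) * \<beta> * (c * b j + e))"
  proof (rule sum_mono)
    fix j
    have fin: "finite {k. (j, k) \<in> I0}"
      using finite_imageI[OF I0(2), of snd] by (rule finite_subset[rotated]) force
    have "{k. (j, k) \<in> I0} \<subseteq> K j" using I0(1) by (auto simp: I_def)
    with fin have "(\<Sum>k | (j, k) \<in> I0. r j k ^ n) \<le> c * b j + e" using R(5) by blast
    then have "(real j + 2) * \<beta> * (\<Sum>k | (j, k) \<in> I0. r j k ^ n) \<le> (real j + 2) * \<beta> * (c * b j + e)"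
      using pos by (intro mult_left_mono) auto
    then show "(\<Sum>k | (j, k) \<in> I0. r j k ^ n * ((real j + 2) * \<beta>)) \<le> (real j + 2) * \<beta> * (c * b j + e)"
      by (simp add: sum_distrib_left mult.commute)
  qed
  also have "\<dots> = c * (\<Sum>j<N. (real j + 2) * \<beta> * b j) + (\<Sum>j<N. (real j + 2) * \<beta>) * e"
    by (simp add: sum.distrib sum_distrib_left sum_distrib_right algebra_simps)
  also have "\<dots> \<le> c * (\<Sum>j<N. (real j + 2) * \<beta> * b j) + \<beta>" using e by simp
  finally have main: "(\<Sum>p\<in>h ` I0. snd p ^ n * (G (fst p) + \<beta>)) \<le> c * (\<Sum>j<N. (real j + 2) * \<beta> * b j) + \<beta>" .
  have "ennreal (\<Sum>j<N. (real j + 2) * \<beta> * b j) = (\<Sum>j<N. ennreal ((real j + 2) * \<beta>) * emeasure (hausdorff_measure n) (A j))"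
    using pos b by (subst sum_ennreal[symmetric]) (auto simp: ennreal_mult emeasure_hausdorff_measure Ab)
  also have "\<dots> = (\<Sum>j<N. \<integral>\<^sup>+x. ennreal ((real j + 2) * \<beta>) * indicator (A j) x \<partial>hausdorff_measure n)"
    using Ab by (intro sum.cong refl nn_integral_cmult_indicator[symmetric]) simp
  also have "\<dots> = (\<integral>\<^sup>+x. (\<Sum>j<N. ennreal ((real j + 2) * \<beta>) * indicator (A j) x) \<partial>hausdorff_measure n)"
    using Ab by (intro nn_integral_sum[symmetric]) (auto intro!: borel_measurable_times borel_measurable_indicator)
  also have "\<dots> \<le> (\<integral>\<^sup>+x. ennreal (G x) * indicator S x + ennreal (2 * \<beta>) * indicator S x \<partial>hausdorff_measure n)"
  proof (rule nn_integral_mono)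
    fix y :: 'a
    \<comment> \<open>The layers are disjoint, so at most one summand survives at y, and there
      \<open>(real j + 2) * \<beta>\<close> is at most \<open>G y + 2 * \<beta>\<close>.\<close>
    have uniq: "j = nat \<lfloor>G y / \<beta>\<rfloor>" if "y \<in> A j" for j
    proof -
      have "real j \<le> G y / \<beta>" "G y / \<beta> < real j + 1" using that pos by (auto simp: A_def field_simps)
      then show ?thesis by linarith
    qed
    show "(\<Sum>j<N. ennreal ((real j + 2) * \<beta>) * indicator (A j) y)
      \<le> ennreal (G y) * indicator S y + ennreal (2 * \<beta>) * indicator S y"
    proof (cases "\<exists>j. y \<in> A j")
      case True
      then obtain j where j: "y \<in> A j" by blast
      have "(\<Sum>i<N. ennreal ((real i + 2) * \<beta>) * indicator (A i) y)
          = (\<Sum>i<N. if i = j then ennreal ((real j + 2) * \<beta>) else 0)"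
        using uniq j by (intro sum.cong) (auto simp: indicator_def)
      also have "\<dots> \<le> ennreal ((real j + 2) * \<beta>)" by simp
      also have "\<dots> \<le> ennreal (G y + 2 * \<beta>)" using j by (intro ennreal_leI) (auto simp: A_def algebra_simps)
      also have "\<dots> = ennreal (G y) + ennreal (2 * \<beta>)" using j G(2) pos by (intro ennreal_plus) (auto simp: A_def)
      finally show ?thesis using j by (simp add: A_def)
    qed simp
  qed
  also have "\<dots> = (\<integral>\<^sup>+x. ennreal (G x) * indicator S x \<partial>hausdorff_measure n) + (\<integral>\<^sup>+x. ennreal (2 * \<beta>) * indicator S x \<partial>hausdorff_measure n)"
  proof (rule nn_integral_add)
    have "(\<lambda>x. indicator S x * G x) \<in> borel_measurable borel"
      using borel_measurable_continuous_on_indicator[OF Sb G(1)] by simp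
    then have "(\<lambda>x. ennreal (indicator S x * G x)) \<in> borel_measurable borel" by simp
    moreover have "(\<lambda>x. ennreal (indicator S x * G x)) = (\<lambda>x. ennreal (G x) * indicator S x)"
      by (auto simp: indicator_def)
    ultimately show "(\<lambda>x. ennreal (G x) * indicator S x) \<in> borel_measurable (hausdorff_measure n)"
      by (simp cong: measurable_cong_sets)
    show "(\<lambda>x. ennreal (2 * \<beta>) * indicator S x) \<in> borel_measurable (hausdorff_measure n)"
      using Sb by (auto intro!: borel_measurable_times borel_measurable_indicator)
  qed
  also have "(\<integral>\<^sup>+x. ennreal (2 * \<beta>) * indicator S x \<partial>hausdorff_measure n) = ennreal (2 * \<beta>) * hausdorff_outer n S"
    using Sb by (subst nn_integral_cmult_indicator) (auto simp: emeasure_hausdorff_measure)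
  also have "\<dots> \<le> ennreal (2 * \<beta>) * ennreal B" by (intro mult_left_mono HS) simp
  also have "\<dots> = ennreal (2 * \<beta> * B)" using pos B(2) by (intro ennreal_mult[symmetric]) auto
  finally have int: "ennreal (\<Sum>j<N. (real j + 2) * \<beta> * b j)
    \<le> (\<integral>\<^sup>+x\<in>S. ennreal (G x) \<partial>hausdorff_measure n) + ennreal (2 * \<beta> * B)" by simp
  show ?thesis
  proof (intro exI[of _ "h ` I0"] conjI ballI)
    show "finite (h ` I0)" using I0 by simp
    fix p assume "p \<in> h ` I0"
    then obtain q where q: "q \<in> I0" "p = h q" by blast
    then have "x (fst q) (snd q) \<in> A (fst q)" using I0(1) R(1) by (auto simp: I_def)
    then show "fst p \<in> S" "0 < snd p" "snd p \<le> \<delta>" using q R(2,3) by (auto simp: h_def A_def)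
  next
    show "S \<subseteq> (\<Union>p\<in>h ` I0. ball (fst p) (snd p))" using I0(3) by (simp add: h_def)
    have sn: "0 \<le> (\<Sum>j<N. (real j + 2) * \<beta> * b j)"
      using pos b(2) by (intro sum_nonneg mult_nonneg_nonneg) auto
    have "ennreal (\<Sum>p\<in>h ` I0. snd p ^ n * (G (fst p) + \<beta>)) \<le> ennreal (c * (\<Sum>j<N. (real j + 2) * \<beta> * b j) + \<beta>)"
      using main by (rule ennreal_leI)
    also have "\<dots> = ennreal c * ennreal (\<Sum>j<N. (real j + 2) * \<beta> * b j) + ennreal \<beta>"
      using c pos sn by (simp add: ennreal_plus ennreal_mult)
    also have "\<dots> \<le> ennreal c * ((\<integral>\<^sup>+x\<in>S. ennreal (G x) \<partial>hausdorff_measure n) + ennreal (2 * \<beta> * B)) + ennreal \<beta>"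
      by (intro add_right_mono mult_left_mono int) simp
    finally show "ennreal (\<Sum>p\<in>h ` I0. snd p ^ n * (G (fst p) + \<beta>))
      \<le> ennreal c * ((\<integral>\<^sup>+x\<in>S. ennreal (G x) \<partial>hausdorff_measure n) + ennreal (2 * \<beta> * B)) + ennreal \<beta>" .
  qed
qed

text \<open>The cutoff is a product of bumps over a finite cover of S by small balls. Each bump
  costs about r^n times the value of G at the centre, and the weighted cover compares the sum of
  these costs with the integral over S. The constant depends on n alone, not on G, S or \<epsilon>,
  so \<epsilon> can tend to 0.\<close>

lemma cutoff_around_null_set:
  fixes S K :: "(real^'m::finite) set" and G :: "real^'m \<Rightarrow> real"
  assumes card: "CARD('m) = n + 1" and S: "compact S" "S \<subseteq> K" and K: "compact K"
    and B: "\<And>\<delta>. 0 < \<delta> \<Longrightarrow> hausdorff_pre n \<delta> S \<le> ennreal B" "0 \<le> B"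
    and G: "continuous_on K G" "\<And>x. x \<in> K \<Longrightarrow> 0 \<le> G x" and "0 < \<epsilon>"
  defines "c \<equiv> 2 ^ n / unit_ball_vol (real n)"
  defines "C \<equiv> 16 * 2 ^ (n + 1) * unit_ball_vol (real (n + 1)) * (c + 1)"
  shows "\<exists>\<eta>. C1_on UNIV \<eta> \<and> (\<forall>x. 0 \<le> \<eta> x \<and> \<eta> x \<le> 1) \<and> (\<exists>T. open T \<and> S \<subseteq> T \<and> (\<forall>x\<in>T. \<eta> x = 0)) \<and>
    (\<forall>x. (\<forall>y\<in>S. \<epsilon> \<le> dist x y) \<longrightarrow> \<eta> x = 1) \<and>
    (\<integral>\<^sup>+x\<in>K. ennreal (norm (grad \<eta> x) * G x) \<partial>lborel)
      \<le> ennreal C * ((\<integral>\<^sup>+x\<in>S. ennreal (G x) \<partial>hausdorff_measure n) + ennreal \<epsilon>)"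
proof -
  have c: "0 < c" by (simp add: c_def)
  define D where "D = 16 * 2 ^ (n + 1) * unit_ball_vol (real (n + 1))"
  have D: "0 < D" by (simp add: D_def)
  \<comment> \<open>With this value the errors \<open>2 * \<beta> * B\<close> and \<beta> of the
    weighted cover add up to \<epsilon>.\<close>
  define \<beta> where "\<beta> = \<epsilon> / (2 * B + 1)"
  have \<beta>: "0 < \<beta>" "2 * \<beta> * B + \<beta> = \<epsilon>" 
  proof -
    have "0 < 2 * B + 1" using B(2) by simp
    then have "0 < \<beta>" "\<beta> * (2 * B + 1) = \<epsilon>" using \<open>0 < \<epsilon>\<close> by (simp_all add: \<beta>_def)
    then show "0 < \<beta>" "2 * \<beta> * B + \<beta> = \<epsilon>" by (simp_all add: algebra_simps)
  qed
  have "uniformly_continuous_on K G" by (rule compact_uniformly_continuous[OF G(1) K])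
  then obtain \<delta>0 where \<delta>0: "0 < \<delta>0" "\<And>x y. x \<in> K \<Longrightarrow> y \<in> K \<Longrightarrow> dist y x < \<delta>0 \<Longrightarrow> dist (G y) (G x) < \<beta>"
    unfolding uniformly_continuous_on_def using \<beta>(1) by metis
  \<comment> \<open>The gradients of the bumps live on the doubled balls: on these G exceeds its
    value at the centre by at most \<beta> because 2 \<delta> < \<open>\<delta>0\<close>, and 2
    \<delta> \<le> \<epsilon> makes every bump equal to 1 at distance \<epsilon> from S.\<close>
  define \<delta> where "\<delta> = min \<delta>0 \<epsilon> / 3"
  have \<delta>: "0 < \<delta>" "2 * \<delta> < \<delta>0" "2 * \<delta> \<le> \<epsilon>" using \<delta>0(1) \<open>0 < \<epsilon>\<close> by (auto simp: \<delta>_def)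
  have "\<exists>F :: ((real^'m) \<times> real) set. finite F \<and> (\<forall>p\<in>F. fst p \<in> S \<and> 0 < snd p \<and> snd p \<le> \<delta>) \<and>
    S \<subseteq> (\<Union>p\<in>F. ball (fst p) (snd p)) \<and>
    ennreal (\<Sum>p\<in>F. snd p ^ n * (G (fst p) + \<beta>))
      \<le> ennreal c * ((\<integral>\<^sup>+x\<in>S. ennreal (G x) \<partial>hausdorff_measure n) + ennreal (2 * \<beta> * B)) + ennreal \<beta>"
    unfolding c_def
    by (rule hausdorff_weighted_ball_cover[OF S(1) B(1,2) continuous_on_subset[OF G(1) S(2)] G(2)[OF subsetD[OF S(2)]] \<delta>(1) \<beta>(1)])
  then obtain F :: "((real^'m) \<times> real) set" where F1: "finite F" and F2: "\<forall>p\<in>F. fst p \<in> S \<and> 0 < snd p \<and> snd p \<le> \<delta>"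
    and F3: "S \<subseteq> (\<Union>p\<in>F. ball (fst p) (snd p))"
    and F4: "ennreal (\<Sum>p\<in>F. snd p ^ n * (G (fst p) + \<beta>))
      \<le> ennreal c * ((\<integral>\<^sup>+x\<in>S. ennreal (G x) \<partial>hausdorff_measure n) + ennreal (2 * \<beta> * B)) + ennreal \<beta>"
    by (elim exE conjE)
  note F = F1 F2[rule_format] F3 F4
  define \<eta> where "\<eta> x = (\<Prod>p\<in>F. bump (fst p) (snd p) x)" for x
  have pr: "C1_on UNIV \<eta> \<and> (\<forall>x. norm (grad \<eta> x) \<le> (\<Sum>p\<in>F. norm (grad (bump (fst p) (snd p)) x)))"
    unfolding \<eta>_def[abs_def]
    by (rule C1_on_prod_unit_interval[OF F(1)]) (auto simp: C1_on_bump bump_range)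
  let ?T = "\<Union>p\<in>F. ball (fst p) (snd p)"
  have T0: "\<eta> x = 0" if x: "x \<in> ?T" for x
  proof -
    obtain p where p: "p \<in> F" "dist (fst p) x < snd p" using x by auto
    then have "bump (fst p) (snd p) x = 0" using F(2) by (intro bump_near) (auto simp: dist_commute)
    then show ?thesis unfolding \<eta>_def using p(1) F(1) by (intro prod_zero) auto
  qed
  have one: "\<eta> x = 1" if x: "\<forall>y\<in>S. \<epsilon> \<le> dist x y" for x
    unfolding \<eta>_def
  proof (rule prod.neutral, rule ballI)
    fix p assume p: "p \<in> F"
    have "\<epsilon> \<le> dist x (fst p)" using x F(2)[OF p] by blast
    then show "bump (fst p) (snd p) x = 1" using F(2)[OF p] \<delta> by (intro bump_far) auto
  qed
  have pt: "norm (grad \<eta> x) * G x \<le> (\<Sum>p\<in>F. 16 / snd p * (G (fst p) + \<beta>) * indicator (cball (fst p) (2 * snd p)) x)"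
    if x: "x \<in> K" for x
  proof -
    have "norm (grad \<eta> x) * G x \<le> (\<Sum>p\<in>F. norm (grad (bump (fst p) (snd p)) x)) * G x"
      using pr G(2)[OF x] by (intro mult_right_mono) auto
    also have "\<dots> = (\<Sum>p\<in>F. norm (grad (bump (fst p) (snd p)) x) * G x)" by (rule sum_distrib_right)
    also have "\<dots> \<le> (\<Sum>p\<in>F. 16 / snd p * (G (fst p) + \<beta>) * indicator (cball (fst p) (2 * snd p)) x)"
    proof (rule sum_mono)
      fix p assume p: "p \<in> F"
      have pp: "fst p \<in> S" "0 < snd p" "snd p \<le> \<delta>" using F(2)[OF p] by auto
      have "norm (grad (bump (fst p) (snd p)) x) * G x \<le> (16 / snd p * indicator (cball (fst p) (2 * snd p)) x) * G x"
        using G(2)[OF x] by (intro mult_right_mono norm_grad_bump pp) auto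
      also have "\<dots> \<le> 16 / snd p * (G (fst p) + \<beta>) * indicator (cball (fst p) (2 * snd p)) x"
      proof (cases "x \<in> cball (fst p) (2 * snd p)")
        case True
        then have "dist x (fst p) < \<delta>0" using pp \<delta> by (simp add: dist_commute)
        then have "dist (G x) (G (fst p)) < \<beta>" using pp S(2) x by (intro \<delta>0(2)) auto
        then have "G x \<le> G (fst p) + \<beta>" by (simp add: dist_real_def)
        then show ?thesis using True pp by (simp add: divide_right_mono)
      qed simp
      finally show "norm (grad (bump (fst p) (snd p)) x) * G x
        \<le> 16 / snd p * (G (fst p) + \<beta>) * indicator (cball (fst p) (2 * snd p)) x" .
    qed
    finally show ?thesis .
  qed
  have co: "0 \<le> 16 / snd p * (G (fst p) + \<beta>)" if "p \<in> F" for p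
    using F(2)[OF that] G(2) S(2) \<beta>(1) by (auto intro!: mult_nonneg_nonneg add_nonneg_nonneg)
  have "(\<integral>\<^sup>+x\<in>K. ennreal (norm (grad \<eta> x) * G x) \<partial>lborel)
      \<le> (\<integral>\<^sup>+x. (\<Sum>p\<in>F. ennreal (16 / snd p * (G (fst p) + \<beta>)) * indicator (cball (fst p) (2 * snd p)) x) \<partial>lborel)"
  proof (rule nn_integral_mono)
    fix x :: "real^'m"
    show "ennreal (norm (grad \<eta> x) * G x) * indicator K x
      \<le> (\<Sum>p\<in>F. ennreal (16 / snd p * (G (fst p) + \<beta>)) * indicator (cball (fst p) (2 * snd p)) x)"
    proof (cases "x \<in> K")
      case True
      have "ennreal (norm (grad \<eta> x) * G x) \<le> ennreal (\<Sum>p\<in>F. 16 / snd p * (G (fst p) + \<beta>) * indicator (cball (fst p) (2 * snd p)) x)"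
        by (rule ennreal_leI[OF pt[OF True]])
      also have "\<dots> = (\<Sum>p\<in>F. ennreal (16 / snd p * (G (fst p) + \<beta>) * indicator (cball (fst p) (2 * snd p)) x))"
        by (rule sum_ennreal[symmetric], rule mult_nonneg_nonneg[OF co]) auto
      also have "\<dots> = (\<Sum>p\<in>F. ennreal (16 / snd p * (G (fst p) + \<beta>)) * indicator (cball (fst p) (2 * snd p)) x)"
        by (intro sum.cong refl) (auto simp: indicator_def)
      finally show ?thesis using True by simp
    qed simp
  qed
  also have "\<dots> = (\<Sum>p\<in>F. \<integral>\<^sup>+x. ennreal (16 / snd p * (G (fst p) + \<beta>)) * indicator (cball (fst p) (2 * snd p)) x \<partial>lborel)"
    by (rule nn_integral_sum, intro borel_measurable_times_ennreal borel_measurable_const borel_measurable_indicator) simp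
  also have "\<dots> = (\<Sum>p\<in>F. ennreal (D * (snd p ^ n * (G (fst p) + \<beta>))))"
  proof (rule sum.cong[OF refl])
    fix p assume p: "p \<in> F"
    have pp: "0 < snd p" using F(2)[OF p] by auto
    have "(\<integral>\<^sup>+x. ennreal (16 / snd p * (G (fst p) + \<beta>)) * indicator (cball (fst p) (2 * snd p)) x \<partial>lborel)
      = ennreal (16 / snd p * (G (fst p) + \<beta>)) * ennreal (unit_ball_vol (real (n + 1)) * (2 * snd p) ^ (n + 1))"
      using pp card by (subst nn_integral_cmult_indicator) (auto simp: emeasure_cball)
    also have "\<dots> = ennreal (16 / snd p * (G (fst p) + \<beta>) * (unit_ball_vol (real (n + 1)) * (2 * snd p) ^ (n + 1)))"
      by (rule ennreal_mult[symmetric]) (use co[OF p] pp in auto)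
    also have "16 / snd p * (G (fst p) + \<beta>) * (unit_ball_vol (real (n + 1)) * (2 * snd p) ^ (n + 1))
        = D * (snd p ^ n * (G (fst p) + \<beta>))"
      using pp by (simp add: D_def power_mult_distrib)
    finally show "(\<integral>\<^sup>+x. ennreal (16 / snd p * (G (fst p) + \<beta>)) * indicator (cball (fst p) (2 * snd p)) x \<partial>lborel)
      = ennreal (D * (snd p ^ n * (G (fst p) + \<beta>)))" .
  qed
  also have "\<dots> = ennreal (\<Sum>p\<in>F. D * (snd p ^ n * (G (fst p) + \<beta>)))"
  proof (rule sum_ennreal)
    fix p assume p: "p \<in> F"
    have "0 \<le> G (fst p)" "0 < snd p" using F(2)[OF p] G(2) S(2) by auto
    then show "0 \<le> D * (snd p ^ n * (G (fst p) + \<beta>))" using D \<beta>(1) by simp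
  qed
  also have "\<dots> = ennreal D * ennreal (\<Sum>p\<in>F. snd p ^ n * (G (fst p) + \<beta>))"
    using D by (simp add: sum_distrib_left[symmetric] ennreal_mult')
  also have "\<dots> \<le> ennreal D * (ennreal c * ((\<integral>\<^sup>+x\<in>S. ennreal (G x) \<partial>hausdorff_measure n) + ennreal (2 * \<beta> * B)) + ennreal \<beta>)"
    by (intro mult_left_mono F(4)) simp
  \<comment> \<open>Replacing c by c + 1 lets the additive error \<beta> share the common factor
    even if c < 1.\<close>
  also have "\<dots> \<le> ennreal D * (ennreal (c + 1) * ((\<integral>\<^sup>+x\<in>S. ennreal (G x) \<partial>hausdorff_measure n) + ennreal \<epsilon>))"
  proof (rule mult_left_mono)
    let ?I = "\<integral>\<^sup>+x\<in>S. ennreal (G x) \<partial>hausdorff_measure n"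
    have e: "ennreal (2 * \<beta> * B) + ennreal \<beta> = ennreal \<epsilon>"
      using \<beta> B(2) by (subst ennreal_plus[symmetric]) auto
    have "ennreal c * (?I + ennreal (2 * \<beta> * B)) + ennreal \<beta>
      \<le> ennreal (c + 1) * (?I + ennreal (2 * \<beta> * B)) + ennreal (c + 1) * ennreal \<beta>"
    proof (rule add_mono)
      show "ennreal c * (?I + ennreal (2 * \<beta> * B)) \<le> ennreal (c + 1) * (?I + ennreal (2 * \<beta> * B))"
        by (intro mult_right_mono ennreal_leI) auto
      have "ennreal \<beta> \<le> ennreal ((c + 1) * \<beta>)" using c \<beta>(1) by (intro ennreal_leI) (simp add: distrib_right)
      also have "\<dots> = ennreal (c + 1) * ennreal \<beta>" using c \<beta>(1) by (intro ennreal_mult) auto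
      finally show "ennreal \<beta> \<le> ennreal (c + 1) * ennreal \<beta>" .
    qed
    also have "\<dots> = ennreal (c + 1) * (?I + (ennreal (2 * \<beta> * B) + ennreal \<beta>))"
      by (simp only: distrib_left add.assoc)
    finally show "ennreal c * (?I + ennreal (2 * \<beta> * B)) + ennreal \<beta> \<le> ennreal (c + 1) * (?I + ennreal \<epsilon>)"
      unfolding e .
  qed simp
  also have "\<dots> = ennreal C * ((\<integral>\<^sup>+x\<in>S. ennreal (G x) \<partial>hausdorff_measure n) + ennreal \<epsilon>)"
  proof -
    have "ennreal C = ennreal D * ennreal (c + 1)"
      unfolding C_def D_def[symmetric] using c D by (intro ennreal_mult) auto
    then show ?thesis by (simp only: mult.assoc)
  qed
  finally have int: "(\<integral>\<^sup>+x\<in>K. ennreal (norm (grad \<eta> x) * G x) \<partial>lborel)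
      \<le> ennreal C * ((\<integral>\<^sup>+x\<in>S. ennreal (G x) \<partial>hausdorff_measure n) + ennreal \<epsilon>)" .
  have rng: "\<forall>x. 0 \<le> \<eta> x \<and> \<eta> x \<le> 1"
    unfolding \<eta>_def by (auto intro!: prod_nonneg prod_le_1 simp: bump_range)
  have "open ?T" by blast
  with T0 F(3) have "\<exists>T. open T \<and> S \<subseteq> T \<and> (\<forall>x\<in>T. \<eta> x = 0)" by blast
  with pr rng one int show ?thesis by blast
qed

section \<open>Energy estimate for currents\<close>

text \<open>A C1 approximation of the positive part from below. It vanishes for r \<le> \<epsilon>,
  not merely for r \<le> 0, which keeps the support of the cut off current away from the level t =
  s.\<close>

definition ramp :: "real \<Rightarrow> real \<Rightarrow> real" where
  "ramp \<epsilon> r = sqrt ((max 0 (r - \<epsilon>))\<^sup>2 + \<epsilon>\<^sup>2) - \<epsilon>"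

definition ramp_deriv :: "real \<Rightarrow> real \<Rightarrow> real" where
  "ramp_deriv \<epsilon> r = max 0 (r - \<epsilon>) / sqrt ((max 0 (r - \<epsilon>))\<^sup>2 + \<epsilon>\<^sup>2)"

lemma ramp_has_derivative:
  assumes "0 < \<epsilon>"
  shows "(ramp \<epsilon> has_real_derivative ramp_deriv \<epsilon> r) (at r)"
proof -
  have pos: "0 < (max 0 (r - \<epsilon>))\<^sup>2 + \<epsilon>\<^sup>2" using assms by (intro add_nonneg_pos) auto
  have "((\<lambda>r. (max 0 (r - \<epsilon>))\<^sup>2) has_real_derivative 2 * max 0 (r - \<epsilon>) * 1) (at r)"
    by (rule DERIV_chain2[OF has_real_derivative_pospart_power2]) (auto intro!: derivative_eq_intros)
  then have "((\<lambda>r. (max 0 (r - \<epsilon>))\<^sup>2 + \<epsilon>\<^sup>2) has_real_derivative 2 * max 0 (r - \<epsilon>)) (at r)"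
    using DERIV_add[OF _ DERIV_const[of "\<epsilon>\<^sup>2"]] by fastforce
  from DERIV_chain2[OF DERIV_real_sqrt[OF pos] this]
  have "((\<lambda>r. sqrt ((max 0 (r - \<epsilon>))\<^sup>2 + \<epsilon>\<^sup>2) - \<epsilon>) has_real_derivative
      inverse (sqrt ((max 0 (r - \<epsilon>))\<^sup>2 + \<epsilon>\<^sup>2)) / 2 * (2 * max 0 (r - \<epsilon>)) - 0) (at r)"
    by (intro DERIV_diff DERIV_const)
  moreover have "inverse (sqrt ((max 0 (r - \<epsilon>))\<^sup>2 + \<epsilon>\<^sup>2)) / 2 * (2 * max 0 (r - \<epsilon>)) - 0 = ramp_deriv \<epsilon> r"
    by (simp add: ramp_deriv_def inverse_eq_divide)
  moreover have "ramp \<epsilon> = (\<lambda>r. sqrt ((max 0 (r - \<epsilon>))\<^sup>2 + \<epsilon>\<^sup>2) - \<epsilon>)"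
    by (simp add: ramp_def fun_eq_iff)
  ultimately show ?thesis by simp
qed

lemma continuous_on_ramp_deriv:
  assumes "0 < \<epsilon>"
  shows "continuous_on UNIV (ramp_deriv \<epsilon>)"
proof -
  have "sqrt ((max 0 (r - \<epsilon>))\<^sup>2 + \<epsilon>\<^sup>2) \<noteq> 0" for r
    using assms by (smt (verit) real_sqrt_gt_zero zero_le_power2 zero_less_power)
  then show ?thesis unfolding ramp_deriv_def[abs_def] by (intro continuous_intros) auto
qed

lemma ramp_bounds:
  assumes "0 < \<epsilon>"
  shows "0 \<le> ramp \<epsilon> r" "ramp \<epsilon> r \<le> max 0 r" "r \<le> \<epsilon> \<Longrightarrow> ramp \<epsilon> r = 0"
    "0 \<le> ramp_deriv \<epsilon> r" "r \<le> \<epsilon> \<Longrightarrow> ramp_deriv \<epsilon> r = 0"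
proof -
  let ?y = "max 0 (r - \<epsilon>)"
  have "\<epsilon> \<le> sqrt (?y\<^sup>2 + \<epsilon>\<^sup>2)" by (rule real_le_rsqrt) simp
  then show "0 \<le> ramp \<epsilon> r" by (simp add: ramp_def)
  have "sqrt (?y\<^sup>2 + \<epsilon>\<^sup>2) \<le> ?y + \<epsilon>"
    using assms by (intro real_le_lsqrt) (auto simp: power2_sum)
  then have "ramp \<epsilon> r \<le> ?y" by (simp add: ramp_def)
  also have "\<dots> \<le> max 0 r" using assms by auto
  finally show "ramp \<epsilon> r \<le> max 0 r" .
  show "r \<le> \<epsilon> \<Longrightarrow> ramp \<epsilon> r = 0" "r \<le> \<epsilon> \<Longrightarrow> ramp_deriv \<epsilon> r = 0"
    using assms by (auto simp: ramp_def ramp_deriv_def max_def)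
  show "0 \<le> ramp_deriv \<epsilon> r" by (simp add: ramp_deriv_def)
qed

lemma ramp_deriv_tendsto:
  assumes e: "e \<longlonglongrightarrow> 0" and "0 < r"
  shows "(\<lambda>m. ramp_deriv (e m) r) \<longlonglongrightarrow> 1"
proof -
  have "(\<lambda>m. ramp_deriv (e m) r) \<longlonglongrightarrow> max 0 (r - 0) / sqrt ((max 0 (r - 0))\<^sup>2 + 0\<^sup>2)"
    unfolding ramp_deriv_def using assms by (intro tendsto_intros) auto
  then show ?thesis using assms by simp
qed

text \<open>Integrability of R is not assumed: in the application R contains |Lw|^2, and the second
  derivatives of w may blow up at the boundary of D. If the integral of R is infinite there is
  nothing to show; otherwise 0 \<le> A \<le> R - d makes A integrable.\<close>

lemma nn_integral_le_of_zero_mean: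
  assumes A: "A \<in> borel_measurable M" "\<And>x. 0 \<le> A x" and R: "R \<in> borel_measurable M" "\<And>x. 0 \<le> R x"
    and d: "integrable M d" "(\<integral>x. d x \<partial>M) = 0" and le: "\<And>x. A x + d x \<le> (R x :: real)"
  shows "(\<integral>\<^sup>+x. ennreal (A x) \<partial>M) \<le> (\<integral>\<^sup>+x. ennreal (R x) \<partial>M)"
proof (cases "(\<integral>\<^sup>+x. ennreal (R x) \<partial>M) = \<infinity>")
  case False
  then have iR: "integrable M R"
    using R by (intro integrableI_nonneg) (auto simp: less_top[symmetric])
  then have iRd: "integrable M (\<lambda>x. R x - d x)" using d by simp
  have Ale: "A x \<le> R x - d x" for x using le[of x] by linarith
  have iA: "integrable M A"
  proof (rule Bochner_Integration.integrable_bound[OF iRd A(1)], rule AE_I2)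
    fix x
    show "norm (A x) \<le> norm (R x - d x)" using Ale[of x] A(2)[of x] by simp
  qed
  have "(\<integral>x. A x \<partial>M) \<le> (\<integral>x. R x - d x \<partial>M)" using Ale by (intro integral_mono iA iRd)
  also have "\<dots> = (\<integral>x. R x \<partial>M)" using d iR by simp
  finally show ?thesis
    using nn_integral_eq_integral[OF iA AE_I2[of M "\<lambda>x. 0 \<le> A x"]] nn_integral_eq_integral[OF iR AE_I2[of M "\<lambda>x. 0 \<le> R x"]] A(2) R(2)
    by (simp add: ennreal_leI)
qed simp

lemma indicator_times_ennreal: "ennreal (indicator D x * y) = ennreal y * indicator D x"
  by (auto simp: indicator_def)

text \<open>The divergence of the cut off current integrates to zero; the weight exp (- k t) makes the
  derivative of the cutoff in time absorb the part of the divergence that is bounded by the energy.\<close>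

lemma energy_cutoff_inequality:
  fixes D :: "(real^'m::finite) set"
  assumes D: "open D" "bounded D" and t: "C1_on D t" "continuous_on (closure D) t"
    and fr: "\<And>x. x \<in> closure D - D \<Longrightarrow> x \<in> T \<or> s \<le> t x"
    and T: "open T" "\<And>x. x \<in> T \<Longrightarrow> \<eta> x = 0" and \<eta>: "C1_on UNIV \<eta>" "\<And>x. 0 \<le> \<eta> x"
    and J: "\<And>i. C1_on D (J i)"
    and G: "continuous_on D G" "\<And>x. x \<in> D \<Longrightarrow> 0 \<le> G x" and R: "continuous_on D R" "\<And>x. x \<in> D \<Longrightarrow> 0 \<le> R x"
    and en: "\<And>x. x \<in> D \<Longrightarrow> c0 * G x \<le> (\<Sum>i\<in>UNIV. J i x * pd i t x)"
    and dv: "\<And>x. x \<in> D \<Longrightarrow> (\<Sum>i\<in>UNIV. pd i (J i) x) \<le> C1 * (G x + R x)"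
    and Jb: "\<And>x i. x \<in> D \<Longrightarrow> \<bar>J i x\<bar> \<le> C2 * G x"
    and const: "0 < c0" "0 \<le> C1" "0 \<le> C2" "0 < \<epsilon>"
  shows "(\<integral>\<^sup>+x\<in>D. ennreal (\<eta> x * exp (- (C1 / c0) * t x) * ramp_deriv \<epsilon> (s - t x) * c0 * G x) \<partial>lborel)
     \<le> (\<integral>\<^sup>+x\<in>D. ennreal (exp (- (C1 / c0) * t x) * ramp \<epsilon> (s - t x) *
          (C1 * \<eta> x * R x + C2 * CARD('m) * (norm (grad \<eta> x) * G x))) \<partial>lborel)"
proof -
  \<comment> \<open>Differentiating the exponential produces - k J . dt, which is at most - k c0 G =
    - C1 G and cancels the bound C1 G in the divergence of J.\<close>
  define k where "k = C1 / c0"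
  have k: "k * c0 = C1" using const by (simp add: k_def)
  define \<phi> where "\<phi> y = exp (- k * y) * ramp \<epsilon> (s - y)" for y
  define \<phi>' where "\<phi>' y = - (k * (exp (- k * y) * ramp \<epsilon> (s - y)) + exp (- k * y) * ramp_deriv \<epsilon> (s - y))" for y
  have d\<phi>: "(\<phi> has_real_derivative \<phi>' y) (at y)" for y
  proof -
    have "((\<lambda>y. ramp \<epsilon> (s - y)) has_real_derivative ramp_deriv \<epsilon> (s - y) * (- 1)) (at y)"
      by (rule DERIV_chain2[OF ramp_has_derivative[OF const(4)]]) (auto intro!: derivative_eq_intros)
    moreover have "((\<lambda>y. exp (- k * y)) has_real_derivative exp (- k * y) * (- k)) (at y)"
      by (auto intro!: derivative_eq_intros)
    ultimately have "((\<lambda>y. exp (- k * y) * ramp \<epsilon> (s - y)) has_real_derivative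
        exp (- k * y) * (- k) * ramp \<epsilon> (s - y) + ramp_deriv \<epsilon> (s - y) * (- 1) * exp (- k * y)) (at y)"
      by (rule DERIV_mult[rotated])
    then show ?thesis unfolding \<phi>_def[abs_def] \<phi>'_def by (simp add: algebra_simps)
  qed
  have cramp: "continuous_on UNIV (ramp \<epsilon>)"
    unfolding ramp_def[abs_def] by (intro continuous_intros)
  have c\<phi>': "continuous_on UNIV \<phi>'"
    unfolding \<phi>'_def[abs_def]
    by (intro continuous_intros continuous_on_compose2[OF cramp] continuous_on_compose2[OF continuous_on_ramp_deriv[OF const(4)]]) auto
  have C\<phi>: "C1_on D (\<lambda>x. \<phi> (t x))" by (rule C1_on_compose[OF t(1) d\<phi> c\<phi>'])
  have C\<eta>: "C1_on D \<eta>" using \<eta>(1) by (rule C1_on_subset) simp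
  define Z where "Z i x = \<eta> x * \<phi> (t x) * J i x" for i x
  have CZ: "C1_on D (Z i)" for i
    unfolding Z_def[abs_def] by (intro C1_on_mult C\<eta> C\<phi> J)
  have pZ: "pd i (Z i) x = \<eta> x * \<phi> (t x) * pd i (J i) x
      + (\<eta> x * (\<phi>' (t x) * pd i t x) + pd i \<eta> x * \<phi> (t x)) * J i x" if x: "x \<in> D" for i x
    unfolding Z_def[abs_def]
    using C1_on_D(1)[OF C\<eta> x] C1_on_D(1)[OF C\<phi> x] C1_on_D(1)[OF J x]
    by (simp add: pd_mult differentiable_mult pd_compose[OF C1_on_D(1)[OF t(1) x] d\<phi>])
  \<comment> \<open>Off K the cutoff or the ramp vanishes. K stays inside D because a point of
    \<open>closure D - D\<close> lies in T or satisfies t \<ge> s, whereas t \<le> s - \<epsilon> on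
    K.\<close>
  define K where "K = {x \<in> closure D. t x \<le> s - \<epsilon>} - T"
  have "closed {x \<in> closure D. t x \<le> s - \<epsilon>}"
    using continuous_closed_preimage[OF t(2) closed_closure closed_atMost[of "s - \<epsilon>"]]
    by (simp add: vimage_def Int_def)
  then have clK: "closed K" unfolding K_def using T(1) by (intro closed_Diff)
  have "K \<subseteq> closure D" by (auto simp: K_def)
  then have cK: "compact K"
    using clK D(2) by (meson bounded_closure bounded_subset compact_eq_bounded_closed)
  have KD: "K \<subseteq> D" using fr const(4) by (force simp: K_def)
  have Z0: "Z i x = 0" if "x \<in> D - K" for i x
  proof -
    have "x \<in> T \<or> s - t x \<le> \<epsilon>" using that closure_subset[of D] by (auto simp: K_def)
    then show ?thesis using T(2) ramp_bounds(3)[OF const(4)] by (auto simp: Z_def \<phi>_def)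
  qed
  note int = integral_pd_compact_support[OF D(1) cK KD CZ Z0]
  define d where "d x = (\<Sum>i\<in>UNIV. indicator D x * pd i (Z i) x)" for x
  have int_d: "integrable lborel d" unfolding d_def[abs_def] by (intro Bochner_Integration.integrable_sum int(1))
  have zd: "(\<integral>x. d x \<partial>lborel) = 0"
  proof -
    have "(\<integral>x. d x \<partial>lborel) = (\<Sum>i\<in>UNIV. \<integral>x. indicator D x * pd i (Z i) x \<partial>lborel)"
      unfolding d_def by (rule Bochner_Integration.integral_sum) (rule int(1))
    also have "\<dots> = 0" by (intro sum.neutral ballI int(2))
    finally show ?thesis .
  qed
  define A where "A x = indicator D x * (\<eta> x * exp (- k * t x) * ramp_deriv \<epsilon> (s - t x) * c0 * G x)" for x
  define Q where "Q x = indicator D x * (exp (- k * t x) * ramp \<epsilon> (s - t x) *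
          (C1 * \<eta> x * R x + C2 * CARD('m) * (norm (grad \<eta> x) * G x)))" for x
  have cg: "continuous_on D (grad \<eta>)"
    unfolding grad_def[abs_def] by (intro continuous_intros C1_on_D(2)[OF C\<eta>])
  have cr: "continuous_on D (\<lambda>x. ramp \<epsilon> (s - t x))" "continuous_on D (\<lambda>x. ramp_deriv \<epsilon> (s - t x))"
    by (intro continuous_on_compose2[OF cramp] continuous_on_compose2[OF continuous_on_ramp_deriv[OF const(4)]]
        continuous_intros C1_on_D(3)[OF t(1)]; simp)+
  have bD: "D \<in> sets borel" using D(1) by simp
  have "continuous_on D (\<lambda>x. \<eta> x * exp (- k * t x) * ramp_deriv \<epsilon> (s - t x) * c0 * G x)"
    by (intro continuous_intros cr G(1) C1_on_D(3)[OF C\<eta>] C1_on_D(3)[OF t(1)])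
  from borel_measurable_continuous_on_indicator[OF bD this]
  have mA: "A \<in> borel_measurable lborel" unfolding A_def[abs_def] by simp
  have "continuous_on D (\<lambda>x. exp (- k * t x) * ramp \<epsilon> (s - t x) *
          (C1 * \<eta> x * R x + C2 * CARD('m) * (norm (grad \<eta> x) * G x)))"
    by (intro continuous_intros cr cg G(1) R(1) C1_on_D(3)[OF C\<eta>] C1_on_D(3)[OF t(1)])
  from borel_measurable_continuous_on_indicator[OF bD this]
  have mQ: "Q \<in> borel_measurable lborel" unfolding Q_def[abs_def] by simp
  have A0: "0 \<le> A x" for x
    using \<eta>(2) G(2) const ramp_bounds(4)[OF const(4)] by (cases "x \<in> D") (auto simp: A_def)
  have Q0: "0 \<le> Q x" for x
    using \<eta>(2) G(2) R(2) const ramp_bounds(1)[OF const(4)] by (cases "x \<in> D") (auto simp: Q_def)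
  have le: "A x + d x \<le> Q x" for x
  proof (cases "x \<in> D")
    case True
    note x = True
    define E where "E = exp (- k * t x)"
    define p where "p = ramp \<epsilon> (s - t x)"
    define p' where "p' = ramp_deriv \<epsilon> (s - t x)"
    have pos: "0 < E" "0 \<le> p" "0 \<le> p'" "0 \<le> \<eta> x" "0 \<le> G x"
      using ramp_bounds[OF const(4)] \<eta>(2) G(2)[OF x] by (auto simp: E_def p_def p'_def)
    have kk: "0 \<le> k" using const by (simp add: k_def)
    have dx: "d x = \<eta> x * (E * p) * (\<Sum>i\<in>UNIV. pd i (J i) x)
      - \<eta> x * (k * (E * p) + E * p') * (\<Sum>i\<in>UNIV. J i x * pd i t x)
      + (E * p) * (\<Sum>i\<in>UNIV. pd i \<eta> x * J i x)"
    proof -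
      have "\<phi> (t x) = E * p" "\<phi>' (t x) = - (k * (E * p) + E * p')"
        by (simp_all only: \<phi>_def \<phi>'_def E_def p_def p'_def)
      note \<phi>E = this
      have "indicator D x * pd i (Z i) x = \<eta> x * (E * p) * pd i (J i) x
        - \<eta> x * (k * (E * p) + E * p') * (J i x * pd i t x) + (E * p) * (pd i \<eta> x * J i x)" for i
        unfolding pZ[OF x] \<phi>E using x by (simp add: algebra_simps)
      then show ?thesis
        unfolding d_def by (simp only: sum.distrib sum_subtractf sum_distrib_left)
    qed
    have 1: "\<eta> x * (E * p) * (\<Sum>i\<in>UNIV. pd i (J i) x) \<le> \<eta> x * (E * p) * (C1 * (G x + R x))"
      using pos by (intro mult_left_mono dv x mult_nonneg_nonneg) auto
    have 2: "\<eta> x * (k * (E * p) + E * p') * (c0 * G x) \<le> \<eta> x * (k * (E * p) + E * p') * (\<Sum>i\<in>UNIV. J i x * pd i t x)"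
      using pos kk by (intro mult_left_mono en x mult_nonneg_nonneg add_nonneg_nonneg) auto
    have "(\<Sum>i\<in>UNIV. pd i \<eta> x * J i x) \<le> (\<Sum>i\<in>(UNIV :: 'm set). norm (grad \<eta> x) * (C2 * G x))"
    proof (rule sum_mono)
      fix i
      have "\<bar>pd i \<eta> x\<bar> \<le> norm (grad \<eta> x)" using component_le_norm_cart[of "grad \<eta> x" i] by simp
      then have "\<bar>pd i \<eta> x\<bar> * \<bar>J i x\<bar> \<le> norm (grad \<eta> x) * (C2 * G x)"
        using Jb[OF x] by (intro mult_mono) auto
      then show "pd i \<eta> x * J i x \<le> norm (grad \<eta> x) * (C2 * G x)"
        by (metis abs_ge_self abs_mult order_trans)
    qed
    then have "(\<Sum>i\<in>UNIV. pd i \<eta> x * J i x) \<le> CARD('m) * (norm (grad \<eta> x) * (C2 * G x))" by simp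
    then have 3: "(E * p) * (\<Sum>i\<in>UNIV. pd i \<eta> x * J i x) \<le> (E * p) * (CARD('m) * (norm (grad \<eta> x) * (C2 * G x)))"
      using pos by (intro mult_left_mono) auto
    have 4: "\<eta> x * (k * (E * p) + E * p') * (c0 * G x) = \<eta> x * (E * p) * (C1 * G x) + \<eta> x * E * p' * c0 * G x"
      unfolding k[symmetric] by (simp add: algebra_simps)
    have Ax: "A x = \<eta> x * E * p' * c0 * G x" using x by (simp add: A_def E_def p'_def)
    have Qx: "Q x = \<eta> x * (E * p) * (C1 * R x) + (E * p) * (CARD('m) * (norm (grad \<eta> x) * (C2 * G x)))"
      using x by (simp add: Q_def E_def p_def algebra_simps)
    have "\<eta> x * (E * p) * (C1 * (G x + R x)) = \<eta> x * (E * p) * (C1 * G x) + \<eta> x * (E * p) * (C1 * R x)"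
      by (simp add: algebra_simps)
    then show ?thesis using 1 2 3 4 unfolding Ax Qx dx by linarith
  qed (simp add: A_def Q_def d_def)
  have "(\<integral>\<^sup>+x. ennreal (A x) \<partial>lborel) \<le> (\<integral>\<^sup>+x. ennreal (Q x) \<partial>lborel)"
    by (rule nn_integral_le_of_zero_mean[OF mA A0 mQ Q0 int_d zd le])
  then show ?thesis unfolding A_def Q_def indicator_times_ennreal k_def .
qed

text \<open>The cutoff shrinks to S while the ramp tends to the positive part. M is the quotient of
  the values of exp (- k t) at s0 and s1, divided by c0: the weight is bounded below on the left and
  above on the right. The ramp is at most s - t, hence at most s - s0.\<close>

lemma energy_estimate:
  fixes D S :: "(real^'m::finite) set"
  assumes card: "CARD('m) = n + 1"
    and D: "open D" "bounded D" and t: "C1_on D t" "continuous_on (closure D) t"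
    and S: "compact S" "S \<subseteq> closure D" "S \<inter> D = {}"
    and fr: "\<And>x. x \<in> closure D - D \<Longrightarrow> x \<in> S \<or> s1 \<le> t x" and t0: "\<And>x. x \<in> closure D \<Longrightarrow> s0 \<le> t x"
    and B: "\<And>\<delta>. 0 < \<delta> \<Longrightarrow> hausdorff_pre n \<delta> S \<le> ennreal B" "0 \<le> B"
    and J: "\<And>i. C1_on D (J i)"
    and G: "continuous_on (closure D) G" "\<And>x. x \<in> closure D \<Longrightarrow> 0 \<le> G x"
    and R: "continuous_on D R" "\<And>x. x \<in> D \<Longrightarrow> 0 \<le> R x"
    and en: "\<And>x. x \<in> D \<Longrightarrow> c0 * G x \<le> (\<Sum>i\<in>UNIV. J i x * pd i t x)"
    and dv: "\<And>x. x \<in> D \<Longrightarrow> (\<Sum>i\<in>UNIV. pd i (J i) x) \<le> C1 * (G x + R x)"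
    and Jb: "\<And>x i. x \<in> D \<Longrightarrow> \<bar>J i x\<bar> \<le> C2 * G x"
    and const: "0 < c0" "0 \<le> C1" "0 \<le> C2" and s: "s \<in> {s0..s1}"
  defines "Cn \<equiv> 16 * 2 ^ (n + 1) * unit_ball_vol (real (n + 1)) * (2 ^ n / unit_ball_vol (real n) + 1)"
  defines "M \<equiv> exp (C1 / c0 * (s1 - s0)) / c0"
  shows "(\<integral>\<^sup>+x\<in>D \<inter> {x. t x < s}. ennreal (G x) \<partial>lborel)
    \<le> ennreal (M * (s - s0)) * (ennreal C1 * (\<integral>\<^sup>+x\<in>D \<inter> {x. t x < s}. ennreal (R x) \<partial>lborel)
        + ennreal (C2 * CARD('m) * Cn) * (\<integral>\<^sup>+x\<in>S. ennreal (G x) \<partial>hausdorff_measure n))"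
proof -
  define k where "k = C1 / c0"
  have k0: "0 \<le> k" using const by (simp add: k_def)
  have Cn: "0 \<le> Cn" by (simp add: Cn_def)
  have M: "0 \<le> M" using const by (simp add: M_def)
  \<comment> \<open>One sequence serves both as the distance from S at which the m-th cutoff equals
    1 and as the smoothing parameter of the ramp.\<close>
  define e where "e m = inverse (real (Suc m))" for m
  have e: "0 < e m" for m by (simp add: e_def)
  have e0: "e \<longlonglongrightarrow> 0" unfolding e_def by (rule LIMSEQ_inverse_real_of_nat)
  have K: "compact (closure D)" using D(2) by (simp add: compact_closure)
  let ?IS = "\<integral>\<^sup>+x\<in>S. ennreal (G x) \<partial>hausdorff_measure n"
  let ?D = "D \<inter> {x. t x < s}"
  let ?IR = "\<integral>\<^sup>+x\<in>?D. ennreal (R x) \<partial>lborel"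
  define cut where "cut m \<eta> \<longleftrightarrow> C1_on UNIV \<eta> \<and> (\<forall>x. 0 \<le> \<eta> x \<and> \<eta> x \<le> 1) \<and> (\<exists>T. open T \<and> S \<subseteq> T \<and> (\<forall>x\<in>T. \<eta> x = 0)) \<and>
    (\<forall>x. (\<forall>y\<in>S. e m \<le> dist x y) \<longrightarrow> \<eta> x = 1) \<and>
    (\<integral>\<^sup>+x\<in>closure D. ennreal (norm (grad \<eta> x) * G x) \<partial>lborel) \<le> ennreal Cn * (?IS + ennreal (e m))" for m \<eta>
  have "\<exists>\<eta>. cut m \<eta>" for m
    unfolding cut_def Cn_def by (rule cutoff_around_null_set[OF card S(1,2) K B G e])
  then obtain \<eta> where \<eta>: "\<And>m. cut m (\<eta> m)" by metis
  have C\<eta>: "C1_on UNIV (\<eta> m)" and r\<eta>: "0 \<le> \<eta> m x" "\<eta> m x \<le> 1"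
    and o\<eta>: "(\<forall>y\<in>S. e m \<le> dist x y) \<Longrightarrow> \<eta> m x = 1"
    and i\<eta>: "(\<integral>\<^sup>+x\<in>closure D. ennreal (norm (grad (\<eta> m) x) * G x) \<partial>lborel) \<le> ennreal Cn * (?IS + ennreal (e m))" for m x
    using \<eta>[of m] unfolding cut_def by blast+
  have cG: "continuous_on D G" using G(1) closure_subset by (rule continuous_on_subset)
  have bD: "D \<in> sets borel" using D(1) by simp
  have oD: "open ?D"
    using continuous_open_preimage[OF C1_on_D(3)[OF t(1)] D(1) open_lessThan[of s]]
    by (simp add: vimage_def)
  have bD': "?D \<in> sets borel" using oD by simp
  define u where "u m x = \<eta> m x * ramp_deriv (e m) (s - t x) * G x" for m x
  have u0: "0 \<le> u m x" if "x \<in> D" for m x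
    unfolding u_def
    by (intro mult_nonneg_nonneg r\<eta> ramp_bounds(4)[OF e] G(2) subsetD[OF closure_subset that])
  have um: "(\<lambda>x. ennreal (u m x) * indicator ?D x) \<in> borel_measurable lborel" for m
  proof -
    have "continuous_on ?D (u m)"
      unfolding u_def[abs_def]
      by (intro continuous_intros continuous_on_compose2[OF continuous_on_ramp_deriv[OF e]]
          continuous_on_subset[OF cG] continuous_on_subset[OF C1_on_D(3)[OF t(1)]] continuous_on_subset[OF C1_on_D(3)[OF C\<eta>]]) auto
    from borel_measurable_continuous_on_indicator[OF bD' this]
    have "(\<lambda>x. ennreal (indicator ?D x * u m x)) \<in> borel_measurable lborel" by simp
    then show ?thesis unfolding indicator_times_ennreal .
  qed
  have bound: "(\<integral>\<^sup>+x\<in>?D. ennreal (u m x) \<partial>lborel)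
    \<le> ennreal (M * (s - s0)) * (ennreal C1 * ?IR + ennreal (C2 * CARD('m) * Cn) * (?IS + ennreal (e m)))" for m
  proof -
    obtain T where T: "open T" "S \<subseteq> T" "\<forall>x\<in>T. \<eta> m x = 0" using \<eta>[of m] unfolding cut_def by blast
    have fr': "x \<in> T \<or> s \<le> t x" if "x \<in> closure D - D" for x
      using fr[OF that] T(2) s by auto
    have G': "0 \<le> G x" if "x \<in> D" for x using G(2) that closure_subset by blast
    note E = energy_cutoff_inequality[OF D t fr' T(1) T(3)[rule_format] C\<eta> r\<eta>(1) J cG G' R en dv Jb const e]
    have low: "ennreal (u m x) * indicator ?D x
      \<le> ennreal (exp (k * s1) / c0) * (ennreal (\<eta> m x * exp (- (C1 / c0) * t x) * ramp_deriv (e m) (s - t x) * c0 * G x) * indicator D x)" for x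
    proof (cases "x \<in> ?D")
      case True
      have "k * t x \<le> k * s1" using True s k0 by (intro mult_left_mono) auto
      then have "1 \<le> exp (k * s1) * exp (- k * t x)" by (simp add: exp_add[symmetric])
      then have "u m x * 1 \<le> u m x * (exp (k * s1) * exp (- k * t x))"
        using True u0 by (intro mult_left_mono) auto
      then have "u m x \<le> exp (k * s1) / c0 * (\<eta> m x * exp (- (C1 / c0) * t x) * ramp_deriv (e m) (s - t x) * c0 * G x)"
        using const(1) by (simp add: u_def k_def mult_ac)
      then have "ennreal (u m x) \<le> ennreal (exp (k * s1) / c0 * (\<eta> m x * exp (- (C1 / c0) * t x) * ramp_deriv (e m) (s - t x) * c0 * G x))"
        by (rule ennreal_leI)
      also have "\<dots> = ennreal (exp (k * s1) / c0) * ennreal (\<eta> m x * exp (- (C1 / c0) * t x) * ramp_deriv (e m) (s - t x) * c0 * G x)"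
        using const(1) by (intro ennreal_mult') auto
      finally show ?thesis using True by simp
    qed simp
    have pE: "0 \<le> exp (- k * s0) * (s - s0)" using s by simp
    have up: "ennreal (exp (- (C1 / c0) * t x) * ramp (e m) (s - t x) *
          (C1 * \<eta> m x * R x + C2 * CARD('m) * (norm (grad (\<eta> m) x) * G x))) * indicator D x
      \<le> ennreal (exp (- k * s0) * (s - s0)) * (ennreal C1 * (ennreal (R x) * indicator ?D x)
          + ennreal (C2 * CARD('m)) * (ennreal (norm (grad (\<eta> m) x) * G x) * indicator (closure D) x))" for x
    proof (cases "x \<in> ?D")
      case True
      then have xD: "x \<in> D" "x \<in> closure D" using closure_subset by auto
      have "- k * t x \<le> - k * s0" using t0[OF xD(2)] k0 by (simp add: mult_left_mono)
      then have "exp (- (C1 / c0) * t x) * ramp (e m) (s - t x) \<le> exp (- k * s0) * (s - s0)"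
        using ramp_bounds[OF e[of m], of "s - t x"] t0[OF xD(2)] True s by (intro mult_mono) (auto simp: k_def)
      moreover have "C1 * \<eta> m x * R x + C2 * CARD('m) * (norm (grad (\<eta> m) x) * G x)
        \<le> C1 * R x + C2 * CARD('m) * (norm (grad (\<eta> m) x) * G x)"
        using r\<eta> R(2)[OF xD(1)] const by (auto intro!: mult_right_mono simp: mult_left_le)
      moreover have "0 \<le> C1 * \<eta> m x * R x + C2 * CARD('m) * (norm (grad (\<eta> m) x) * G x)"
        using r\<eta> R(2)[OF xD(1)] const G(2)[OF xD(2)] by (intro add_nonneg_nonneg mult_nonneg_nonneg) auto
      ultimately have "exp (- (C1 / c0) * t x) * ramp (e m) (s - t x) *
          (C1 * \<eta> m x * R x + C2 * CARD('m) * (norm (grad (\<eta> m) x) * G x))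
        \<le> (exp (- k * s0) * (s - s0)) * (C1 * R x + C2 * CARD('m) * (norm (grad (\<eta> m) x) * G x))"
        by (intro mult_mono[OF _ _ pE])
      then have "ennreal (exp (- (C1 / c0) * t x) * ramp (e m) (s - t x) *
          (C1 * \<eta> m x * R x + C2 * CARD('m) * (norm (grad (\<eta> m) x) * G x)))
        \<le> ennreal ((exp (- k * s0) * (s - s0)) * (C1 * R x + C2 * CARD('m) * (norm (grad (\<eta> m) x) * G x)))"
        by (rule ennreal_leI)
      also have "\<dots> = ennreal (exp (- k * s0) * (s - s0)) * (ennreal (C1 * R x) + ennreal (C2 * CARD('m) * (norm (grad (\<eta> m) x) * G x)))"
        using pE const R(2)[OF xD(1)] G(2)[OF xD(2)]
        by (subst ennreal_mult) (auto simp: ennreal_plus)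
      also have "\<dots> = ennreal (exp (- k * s0) * (s - s0)) * (ennreal C1 * ennreal (R x) + ennreal (C2 * CARD('m)) * ennreal (norm (grad (\<eta> m) x) * G x))"
        using const by (simp only: ennreal_mult' mult_nonneg_nonneg of_nat_0_le_iff)
      finally show ?thesis using True xD by simp
    next
      case False
      then have "ramp (e m) (s - t x) = 0 \<or> x \<notin> D" using ramp_bounds(3)[OF e, of "s - t x" m] e[of m] by auto
      then show ?thesis by auto
    qed
    have mR: "(\<lambda>x. ennreal (R x) * indicator ?D x) \<in> borel_measurable lborel"
    proof -
      have "continuous_on ?D R" using R(1) by (rule continuous_on_subset) auto
      from borel_measurable_continuous_on_indicator[OF bD' this]
      have "(\<lambda>x. ennreal (indicator ?D x * R x)) \<in> borel_measurable lborel" by simp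
      then show ?thesis unfolding indicator_times_ennreal .
    qed
    have mG: "(\<lambda>x. ennreal (norm (grad (\<eta> m) x) * G x) * indicator (closure D) x) \<in> borel_measurable lborel"
    proof -
      have "continuous_on UNIV (grad (\<eta> m))"
        unfolding grad_def[abs_def] by (intro continuous_intros C1_on_D(2)[OF C\<eta>])
      then have "continuous_on (closure D) (\<lambda>x. norm (grad (\<eta> m) x) * G x)"
        by (intro continuous_intros G(1)) (rule continuous_on_subset, auto)
      from borel_measurable_continuous_on_indicator[OF _ this]
      have "(\<lambda>x. ennreal (indicator (closure D) x * (norm (grad (\<eta> m) x) * G x))) \<in> borel_measurable lborel" by simp
      then show ?thesis unfolding indicator_times_ennreal .
    qed
    have "(\<integral>\<^sup>+x\<in>?D. ennreal (u m x) \<partial>lborel)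
      \<le> (\<integral>\<^sup>+x. ennreal (exp (k * s1) / c0) * (ennreal (\<eta> m x * exp (- (C1 / c0) * t x) * ramp_deriv (e m) (s - t x) * c0 * G x) * indicator D x) \<partial>lborel)"
      by (rule nn_integral_mono[OF low])
    also have "\<dots> = ennreal (exp (k * s1) / c0) * (\<integral>\<^sup>+x\<in>D. ennreal (\<eta> m x * exp (- (C1 / c0) * t x) * ramp_deriv (e m) (s - t x) * c0 * G x) \<partial>lborel)"
    proof (rule nn_integral_cmult)
      have "continuous_on D (\<lambda>x. \<eta> m x * exp (- (C1 / c0) * t x) * ramp_deriv (e m) (s - t x) * c0 * G x)"
        by (intro continuous_intros continuous_on_compose2[OF continuous_on_ramp_deriv[OF e]]
            cG C1_on_D(3)[OF t(1)] continuous_on_subset[OF C1_on_D(3)[OF C\<eta>]]) auto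
      from borel_measurable_continuous_on_indicator[OF bD this]
      have "(\<lambda>x. ennreal (indicator D x * (\<eta> m x * exp (- (C1 / c0) * t x) * ramp_deriv (e m) (s - t x) * c0 * G x))) \<in> borel_measurable lborel" by simp
      then show "(\<lambda>x. ennreal (\<eta> m x * exp (- (C1 / c0) * t x) * ramp_deriv (e m) (s - t x) * c0 * G x) * indicator D x) \<in> borel_measurable lborel"
        unfolding indicator_times_ennreal .
    qed
    also have "\<dots> \<le> ennreal (exp (k * s1) / c0) * (\<integral>\<^sup>+x. ennreal (exp (- k * s0) * (s - s0)) * (ennreal C1 * (ennreal (R x) * indicator ?D x)
          + ennreal (C2 * CARD('m)) * (ennreal (norm (grad (\<eta> m) x) * G x) * indicator (closure D) x)) \<partial>lborel)"
      by (intro mult_left_mono order_trans[OF E nn_integral_mono[OF up]]) simp_all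
    also have "\<dots> = ennreal (exp (k * s1) / c0) * (ennreal (exp (- k * s0) * (s - s0)) * (ennreal C1 * ?IR
          + ennreal (C2 * CARD('m)) * (\<integral>\<^sup>+x\<in>closure D. ennreal (norm (grad (\<eta> m) x) * G x) \<partial>lborel)))"
      using mR mG by (simp add: nn_integral_cmult nn_integral_add)
    also have "\<dots> \<le> ennreal (exp (k * s1) / c0) * (ennreal (exp (- k * s0) * (s - s0)) * (ennreal C1 * ?IR
          + ennreal (C2 * CARD('m)) * (ennreal Cn * (?IS + ennreal (e m)))))"
      by (intro mult_left_mono add_left_mono i\<eta>) simp_all
    also have "\<dots> = ennreal (M * (s - s0)) * (ennreal C1 * ?IR + ennreal (C2 * CARD('m) * Cn) * (?IS + ennreal (e m)))"
    proof -
      have "M * (s - s0) = (exp (k * s1) / c0) * (exp (- k * s0) * (s - s0))"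
        by (simp add: M_def k_def[symmetric] right_diff_distrib exp_diff exp_minus field_simps)
      then have 1: "ennreal (M * (s - s0)) = ennreal (exp (k * s1) / c0) * ennreal (exp (- k * s0) * (s - s0))"
        using const(1) by (simp only: ennreal_mult' divide_nonneg_pos exp_ge_zero)
      have 2: "ennreal (C2 * CARD('m) * Cn) = ennreal (C2 * CARD('m)) * ennreal Cn"
        using const Cn by (intro ennreal_mult) auto
      show ?thesis unfolding 1 2 by (simp only: mult.assoc)
    qed
    finally show ?thesis .
  qed
  have lim: "(\<lambda>m. ennreal (u m x)) \<longlonglongrightarrow> ennreal (G x)" if x: "x \<in> ?D" for x
  proof (rule tendsto_ennrealI)
    \<comment> \<open>A point of D has positive distance to the compact set S, so from some m on the
      cutoff is 1 there and only the derivative of the ramp remains.\<close>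
    have "x \<notin> S" using x S(3) by blast
    then obtain r where r: "0 < r" "\<forall>y\<in>S. r \<le> dist x y"
      using separate_point_closed[OF compact_imp_closed[OF S(1)]] by blast
    have "eventually (\<lambda>m. e m < r) sequentially" using order_tendstoD(2)[OF e0 r(1)] .
    then have "eventually (\<lambda>m. ramp_deriv (e m) (s - t x) * G x = u m x) sequentially"
    proof eventually_elim
      case (elim m)
      then have "\<eta> m x = 1" using r(2) by (intro o\<eta>) force
      then show ?case by (simp add: u_def)
    qed
    moreover have "(\<lambda>m. ramp_deriv (e m) (s - t x) * G x) \<longlonglongrightarrow> 1 * G x"
      using x by (intro tendsto_intros ramp_deriv_tendsto[OF e0]) auto
    ultimately show "(\<lambda>m. u m x) \<longlonglongrightarrow> G x" by (auto intro: Lim_transform_eventually)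
  qed
  have "(\<integral>\<^sup>+x\<in>?D. ennreal (G x) \<partial>lborel) = (\<integral>\<^sup>+x. liminf (\<lambda>m. ennreal (u m x) * indicator ?D x) \<partial>lborel)"
  proof (rule nn_integral_cong)
    fix x
    show "ennreal (G x) * indicator ?D x = liminf (\<lambda>m. ennreal (u m x) * indicator ?D x)"
    proof (cases "x \<in> ?D")
      case True
      from lim_imp_Liminf[OF _ lim[OF this]] True show ?thesis by simp
    next
      case False
      then show ?thesis by (simp add: Liminf_const)
    qed
  qed
  \<comment> \<open>Fatou's lemma is enough, since only an upper bound is wanted; no majorant is
    required.\<close>
  also have "\<dots> \<le> liminf (\<lambda>m. \<integral>\<^sup>+x\<in>?D. ennreal (u m x) \<partial>lborel)"
    by (rule nn_integral_liminf[OF um])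
  also have "\<dots> \<le> liminf (\<lambda>m. ennreal (M * (s - s0)) * (ennreal C1 * ?IR + ennreal (C2 * CARD('m) * Cn) * (?IS + ennreal (e m))))"
    by (intro Liminf_mono always_eventually allI bound)
  also have "\<dots> = ennreal (M * (s - s0)) * (ennreal C1 * ?IR + ennreal (C2 * CARD('m) * Cn) * (?IS + 0))"
  proof (rule lim_imp_Liminf)
    have "(\<lambda>m. ennreal (e m)) \<longlonglongrightarrow> 0" using tendsto_ennrealI[OF e0] by simp
    then show "(\<lambda>m. ennreal (M * (s - s0)) * (ennreal C1 * ?IR + ennreal (C2 * CARD('m) * Cn) * (?IS + ennreal (e m))))
      \<longlonglongrightarrow> ennreal (M * (s - s0)) * (ennreal C1 * ?IR + ennreal (C2 * CARD('m) * Cn) * (?IS + 0))"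
      by (intro ennreal_tendsto_cmult tendsto_add tendsto_const) auto
  qed simp
  finally show ?thesis by simp
qed

section \<open>The energy current of a second order operator\<close>

lemma compact_pos_lower_bound:
  fixes f :: "'a::topological_space \<Rightarrow> real"
  assumes "compact S" "continuous_on S f" "\<And>x. x \<in> S \<Longrightarrow> 0 < f x"
  shows "\<exists>c>0. \<forall>x\<in>S. c \<le> f x"
proof (cases "S = {}")
  case False
  obtain x where "x \<in> S" "\<forall>y\<in>S. f x \<le> f y" using continuous_attains_inf[OF assms(1) False assms(2)] by blast
  then show ?thesis using assms(3) by blast
qed (auto intro: exI[of _ 1])

text \<open>The sum of the absolute values is a single continuous function that dominates the whole
  finite family.\<close>

lemma compact_family_bounded:
  fixes f :: "'i \<Rightarrow> 'a::topological_space \<Rightarrow> real"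
  assumes K: "compact K" and I: "finite I" and f: "\<And>i. i \<in> I \<Longrightarrow> continuous_on K (f i)"
  shows "\<exists>M\<ge>0. \<forall>i\<in>I. \<forall>x\<in>K. \<bar>f i x\<bar> \<le> M"
proof -
  have c: "continuous_on K (\<lambda>x. \<Sum>i\<in>I. \<bar>f i x\<bar>)" by (intro continuous_intros f)
  have "\<exists>M>0. \<forall>x\<in>K. norm (\<Sum>i\<in>I. \<bar>f i x\<bar>) \<le> M"
    using compact_imp_bounded[OF compact_continuous_image[OF c K]] unfolding bounded_pos by simp
  then obtain M where M: "M > 0" "\<forall>x\<in>K. norm (\<Sum>i\<in>I. \<bar>f i x\<bar>) \<le> M" by blast
  have "\<bar>f i x\<bar> \<le> M" if "i \<in> I" "x \<in> K" for i x
  proof -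
    have "\<bar>f i x\<bar> \<le> (\<Sum>i\<in>I. \<bar>f i x\<bar>)" using that(1) I by (intro member_le_sum) auto
    also have "\<dots> \<le> M" using bspec[OF M(2) that(2)] by simp
    finally show ?thesis .
  qed
  with M(1) show ?thesis by (intro exI[of _ M]) simp
qed

lemma bform_bound:
  fixes A :: "real^'m^'m::finite" and M :: real
  assumes "\<And>i j. \<bar>A $ i $ j\<bar> \<le> M"
  shows "\<bar>bform A u v\<bar> \<le> (real CARD('m))\<^sup>2 * M * norm u * norm v"
proof -
  have "\<bar>bform A u v\<bar> \<le> (\<Sum>i\<in>UNIV. \<Sum>j\<in>UNIV. \<bar>A $ i $ j * u $ i * v $ j\<bar>)"
    unfolding bform_def by (rule order_trans[OF sum_abs sum_mono[OF sum_abs]])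
  also have "\<dots> \<le> (\<Sum>i\<in>(UNIV::'m set). \<Sum>j\<in>(UNIV::'m set). M * norm u * norm v)"
  proof (intro sum_mono)
    fix i j
    have "0 \<le> M" using assms[of i j] by simp
    then show "\<bar>A $ i $ j * u $ i * v $ j\<bar> \<le> M * norm u * norm v"
      using assms[of i j] component_le_norm_cart[of u i] component_le_norm_cart[of v j]
      by (auto simp: abs_mult intro!: mult_mono)
  qed
  also have "\<dots> = (real CARD('m))\<^sup>2 * M * norm u * norm v" by (simp add: power2_eq_square)
  finally show ?thesis .
qed

text \<open>The gradient N of the time function is merely continuous; the multiplier has to be
  differentiable and is a polynomial approximation of it.\<close>

lemma energy_multiplier:
  fixes K :: "(real^'m::finite) set" and h :: "real^'m \<Rightarrow> real^'m^'m"
  assumes card: "CARD('m) = n + 1" and K: "compact K"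
    and ch: "\<And>i j. continuous_on K (\<lambda>x. h x $ i $ j)" and cN: "continuous_on K N"
    and sym: "\<And>x. x \<in> K \<Longrightarrow> transpose (h x) = h x" and sig: "\<And>x. x \<in> K \<Longrightarrow> has_signature (h x) n 1"
    and tl: "\<And>x. x \<in> K \<Longrightarrow> timelike_conormal (h x) (N x)"
  shows "\<exists>\<tau> c. (\<forall>i. real_polynomial_function (\<lambda>x. \<tau> x $ i)) \<and> 0 < c \<and> (\<forall>x\<in>K. c \<le> \<tau> x \<bullet> N x) \<and>
    (\<forall>x\<in>K. \<forall>\<eta>. c * (norm \<eta>)\<^sup>2 \<le> bform (h x) (N x) \<eta> * bform (h x) \<eta> (\<tau> x) - bform (h x) (N x) (\<tau> x) * bform (h x) \<eta> \<eta> / 2)"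
proof -
  \<comment> \<open>E is linear in v and quadratic in \<eta>. For v = N it is the positive quantity
    of \<open>energy_density_pos\<close>; compactness of K times the unit sphere gives a lower bound
    that survives a small change of v.\<close>
  define E where "E x v \<eta> = bform (h x) (N x) \<eta> * bform (h x) \<eta> v - bform (h x) (N x) v * bform (h x) \<eta> \<eta> / 2" for x v \<eta>
  have cNi: "continuous_on K (\<lambda>x. N x $ i)" for i by (intro continuous_intros cN)
  have cS: "continuous_on (K \<times> sphere 0 1) (\<lambda>p. E (fst p) (N (fst p)) (snd p))"
  proof -
    have 1: "continuous_on (K \<times> sphere (0::real^'m) 1) (\<lambda>p. h (fst p) $ i $ j)" for i j
      by (rule continuous_on_compose2[OF ch continuous_on_fst[OF continuous_on_id]]) auto
    have 2: "continuous_on (K \<times> sphere (0::real^'m) 1) (\<lambda>p. N (fst p) $ i)" for i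
      by (rule continuous_on_compose2[OF cNi continuous_on_fst[OF continuous_on_id]]) auto
    have 3: "continuous_on (K \<times> sphere (0::real^'m) 1) (\<lambda>p. snd p $ i)" for i
      by (intro continuous_intros)
    show ?thesis
      unfolding E_def bform_def divide_inverse
      by (intro 1 2 3 continuous_on_sum continuous_on_mult continuous_on_diff continuous_on_const)
  qed
  have "\<exists>c>0. \<forall>p\<in>K \<times> sphere 0 1. c \<le> E (fst p) (N (fst p)) (snd p)"
  proof (rule compact_pos_lower_bound[OF compact_Times[OF K compact_sphere] cS])
    fix p assume "p \<in> K \<times> sphere (0 :: real^'m) 1"
    then have p: "fst p \<in> K" "snd p \<noteq> 0" by auto
    show "0 < E (fst p) (N (fst p)) (snd p)"
      using energy_density_pos[OF sym[OF p(1)] sig[OF p(1)] card tl[OF p(1)] p(2)]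
        bform_commute[OF sym[OF p(1)], of "snd p" "N (fst p)"]
      by (simp add: E_def power2_eq_square)
  qed
  then obtain c1 where c1: "0 < c1" "\<forall>p\<in>K \<times> sphere 0 1. c1 \<le> E (fst p) (N (fst p)) (snd p)" by blast
  have cNN: "continuous_on K (\<lambda>x. N x \<bullet> N x)" by (intro continuous_intros cN)
  have "\<exists>c>0. \<forall>x\<in>K. c \<le> N x \<bullet> N x"
    by (rule compact_pos_lower_bound[OF K cNN]) (use tl in \<open>auto simp: timelike_conormal_def\<close>)
  then obtain c2 where c2: "0 < c2" "\<forall>x\<in>K. c2 \<le> N x \<bullet> N x" by blast
  have "\<exists>M\<ge>0. \<forall>p\<in>UNIV. \<forall>x\<in>K. \<bar>h x $ fst p $ snd p\<bar> \<le> M"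
    by (rule compact_family_bounded[OF K]) (auto intro: ch)
  then obtain M where M: "0 \<le> M" "\<And>x i j. x \<in> K \<Longrightarrow> \<bar>h x $ i $ j\<bar> \<le> M"
    by (metis UNIV_I fst_conv snd_conv)
  have "\<exists>M\<ge>0. \<forall>p\<in>{()}. \<forall>x\<in>K. \<bar>norm (N x)\<bar> \<le> M"
    by (rule compact_family_bounded[OF K]) (auto intro!: continuous_intros cN)
  then obtain L where L: "0 \<le> L" "\<And>x. x \<in> K \<Longrightarrow> norm (N x) \<le> L" by auto
  define H where "H = (real CARD('m))\<^sup>2 * M"
  have H: "0 \<le> H" using M by (simp add: H_def)
  have bH: "\<bar>bform (h x) u v\<bar> \<le> H * norm u * norm v" if "x \<in> K" for x u v
    unfolding H_def by (rule bform_bound) (rule M(2)[OF that])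
  define Q where "Q = 2 * H\<^sup>2 * L"
  have Q: "0 \<le> Q" using L by (simp add: Q_def)
  have EQ: "\<bar>E x v \<eta>\<bar> \<le> Q * norm v" if x: "x \<in> K" and \<eta>: "norm \<eta> = 1" for x v \<eta>
  proof -
    have 1: "\<bar>bform (h x) (N x) \<eta>\<bar> \<le> H * L" "\<bar>bform (h x) \<eta> v\<bar> \<le> H * norm v"
      "\<bar>bform (h x) (N x) v\<bar> \<le> H * L * norm v" "\<bar>bform (h x) \<eta> \<eta>\<bar> \<le> H"
      using bH[OF x, of "N x" \<eta>] bH[OF x, of \<eta> v] bH[OF x, of "N x" v] bH[OF x, of \<eta> \<eta>] \<eta>
        mult_left_mono[OF L(2)[OF x] H] mult_right_mono[OF mult_left_mono[OF L(2)[OF x] H], of "norm v"]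
      by auto
    have "\<bar>E x v \<eta>\<bar> \<le> \<bar>bform (h x) (N x) \<eta>\<bar> * \<bar>bform (h x) \<eta> v\<bar> + \<bar>bform (h x) (N x) v\<bar> * \<bar>bform (h x) \<eta> \<eta>\<bar> / 2"
      unfolding E_def by (rule order_trans[OF abs_triangle_ineq4]) (simp add: abs_mult)
    also have "\<dots> \<le> (H * L) * (H * norm v) + (H * L * norm v) * H / 2"
      using 1 H L by (intro add_mono divide_right_mono mult_mono) auto
    also have "\<dots> = (3 / 2 * (H\<^sup>2 * L)) * norm v" by (simp add: power2_eq_square algebra_simps)
    also have "\<dots> \<le> Q * norm v" unfolding Q_def using L by (intro mult_right_mono) auto
    finally show ?thesis .
  qed
  \<comment> \<open>Half of the smaller lower bound is kept; the other half covers the errors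
    \<open>Q * e\<close> and \<open>L * e\<close> of the polynomial approximation.\<close>
  define c where "c = min c1 c2 / 2"
  have c: "0 < c" "2 * c \<le> c1" "2 * c \<le> c2" using c1 c2 by (auto simp: c_def)
  define e where "e = c / (Q + L + 1)"
  have e: "0 < e" "Q * e \<le> c" "L * e \<le> c"
    using c Q L by (auto simp: e_def field_simps)
  obtain \<tau> where \<tau>: "polynomial_function \<tau>" "\<forall>x\<in>K. norm (N x - \<tau> x) < e"
    using Stone_Weierstrass_polynomial_function[OF K cN e(1)] by blast
  have poly: "real_polynomial_function (\<lambda>x. \<tau> x $ i)" for i
    using \<tau>(1) bounded_linear_vec_nth[of i] unfolding polynomial_function_def o_def by blast
  have T: "c \<le> \<tau> x \<bullet> N x" if x: "x \<in> K" for x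
  proof -
    have "\<bar>(N x - \<tau> x) \<bullet> N x\<bar> \<le> norm (N x - \<tau> x) * norm (N x)" by (rule Cauchy_Schwarz_ineq2)
    also have "\<dots> \<le> e * L" using \<tau>(2) x L e by (intro mult_mono) (auto simp: less_imp_le)
    finally have "\<bar>N x \<bullet> N x - \<tau> x \<bullet> N x\<bar> \<le> c" using e by (simp add: inner_diff_left mult.commute)
    then show ?thesis using c2(2) c x by fastforce
  qed
  have U: "c \<le> E x (\<tau> x) \<eta>" if x: "x \<in> K" and \<eta>: "norm \<eta> = 1" for x \<eta>
  proof -
    have "E x (\<tau> x) \<eta> = E x (N x) \<eta> - E x (N x - \<tau> x) \<eta>"
      by (simp add: E_def bform_linear algebra_simps diff_divide_distrib)
    moreover have "\<bar>E x (N x - \<tau> x) \<eta>\<bar> \<le> Q * e"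
      using EQ[OF x \<eta>, of "N x - \<tau> x"] mult_left_mono[OF less_imp_le[OF bspec[OF \<tau>(2) x]] Q] by linarith
    moreover have "c1 \<le> E x (N x) \<eta>" using bspec[OF c1(2), of "(x, \<eta>)"] x \<eta> by simp
    ultimately show ?thesis using e c by linarith
  qed
  have V: "c * (norm \<eta>)\<^sup>2 \<le> E x (\<tau> x) \<eta>" if x: "x \<in> K" for x \<eta>
  proof (cases "\<eta> = 0")
    case True
    then show ?thesis by (simp add: E_def bform_inner)
  next
    case False
    define \<zeta> where "\<zeta> = \<eta> /\<^sub>R norm \<eta>"
    have z: "norm \<zeta> = 1" "\<eta> = norm \<eta> *\<^sub>R \<zeta>" using False by (auto simp: \<zeta>_def)
    have "E x (\<tau> x) \<eta> = (norm \<eta>)\<^sup>2 * E x (\<tau> x) \<zeta>"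
      by (subst z(2)) (simp add: E_def bform_linear power2_eq_square algebra_simps)
    then show ?thesis using mult_left_mono[OF U[OF x z(1)], of "(norm \<eta>)\<^sup>2"] by (simp add: mult.commute)
  qed
  show ?thesis
    using poly T V c(1) unfolding E_def by (intro exI[of _ \<tau>] exI[of _ c]) simp
qed

text \<open>With Y = h \<tau> these are the coefficients of a quadratic form in dw: the energy
  tensor of the principal part contracted with the vector field Y.\<close>

definition flux_coeff :: "(real^'m::finite \<Rightarrow> real^'m^'m) \<Rightarrow> (real^'m \<Rightarrow> real^'m) \<Rightarrow> 'm \<Rightarrow> 'm \<Rightarrow> 'm \<Rightarrow> real^'m \<Rightarrow> real" where
  "flux_coeff h \<tau> i j k x = h x $ i $ j * (h x *v \<tau> x) $ k - (h x *v \<tau> x) $ i * h x $ j $ k / 2"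

definition energy_current :: "(real^'m::finite \<Rightarrow> real^'m^'m) \<Rightarrow> (real^'m \<Rightarrow> real^'m) \<Rightarrow> (real^'m \<Rightarrow> real) \<Rightarrow> 'm \<Rightarrow> real^'m \<Rightarrow> real" where
  "energy_current h \<tau> w i x =
     (\<Sum>j\<in>UNIV. \<Sum>k\<in>UNIV. flux_coeff h \<tau> i j k x * (pd j w x * pd k w x)) + \<tau> x $ i * (w x * w x)"

text \<open>For N = dt the right-hand side consists of the quantities bounded below in
  \<open>energy_multiplier\<close>; this is how J . dt comes to dominate the energy, the last
  summand providing the control of w itself.\<close>

lemma energy_current_dot:
  "(\<Sum>i\<in>UNIV. energy_current h \<tau> w i x * N $ i)
    = bform (h x) N (grad w x) * bform (h x) (grad w x) (\<tau> x)
      - bform (h x) N (\<tau> x) * bform (h x) (grad w x) (grad w x) / 2 + (\<tau> x \<bullet> N) * (w x)\<^sup>2"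
proof -
  let ?Y = "h x *v \<tau> x"
  have 1: "bform (h x) (grad w x) (\<tau> x) = (\<Sum>k\<in>UNIV. pd k w x * ?Y $ k)"
    by (simp add: bform_inner inner_vec_def)
  have 2: "bform (h x) N (\<tau> x) = (\<Sum>i\<in>UNIV. N $ i * ?Y $ i)"
    by (simp add: bform_inner inner_vec_def)
  have 3: "bform (h x) N (grad w x) * bform (h x) (grad w x) (\<tau> x)
    = (\<Sum>i\<in>UNIV. \<Sum>j\<in>UNIV. \<Sum>k\<in>UNIV. (h x $ i $ j * N $ i * pd j w x) * (pd k w x * ?Y $ k))"
    unfolding 1 unfolding bform_def grad_nth by (simp only: sum_distrib_right) (simp only: sum_distrib_left)
  have 4: "bform (h x) N (\<tau> x) * bform (h x) (grad w x) (grad w x) / 2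
    = (\<Sum>i\<in>UNIV. \<Sum>j\<in>UNIV. \<Sum>k\<in>UNIV. (N $ i * ?Y $ i) * (h x $ j $ k * pd j w x * pd k w x) / 2)"
    unfolding 2 unfolding bform_def grad_nth
    by (simp only: sum_distrib_right) (simp only: sum_distrib_left sum_divide_distrib)
  have 5: "(\<tau> x \<bullet> N) * (w x)\<^sup>2 = (\<Sum>i\<in>UNIV. \<tau> x $ i * (w x * w x) * N $ i)"
    unfolding inner_vec_def sum_distrib_right by (simp add: power2_eq_square mult_ac)
  have "energy_current h \<tau> w i x * N $ i
    = (\<Sum>j\<in>UNIV. \<Sum>k\<in>UNIV. (h x $ i $ j * N $ i * pd j w x) * (pd k w x * ?Y $ k))
      - (\<Sum>j\<in>UNIV. \<Sum>k\<in>UNIV. (N $ i * ?Y $ i) * (h x $ j $ k * pd j w x * pd k w x) / 2)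
      + \<tau> x $ i * (w x * w x) * N $ i" for i
    unfolding energy_current_def flux_coeff_def distrib_right sum_distrib_right sum_subtractf[symmetric]
    by (intro arg_cong2[where f = "(+)"] sum.cong refl) (simp add: algebra_simps)
  then show ?thesis
    unfolding 3 4 5 by (simp only: sum.distrib sum_subtractf)
qed

text \<open>H stands for the principal matrix, W for the second derivatives, Y for the multiplier
  and v for the gradient. Expansion gives four terms: one is the right-hand side, the other three
  are the same sum \<open>Q\<close> after renaming indices, with the factors 1, -1/2 and
  -1/2.\<close>

lemma flux_algebra:
  fixes H W :: "'m::finite \<Rightarrow> 'm \<Rightarrow> real" and Y v :: "'m \<Rightarrow> real"
  assumes H: "\<And>i j. H i j = H j i" and W: "\<And>i j. W i j = W j i"
  shows "(\<Sum>i\<in>UNIV. \<Sum>j\<in>UNIV. \<Sum>k\<in>UNIV. (H i j * Y k - Y i * H j k / 2) * (v j * W i k + W i j * v k))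
    = (\<Sum>i\<in>UNIV. \<Sum>j\<in>UNIV. H i j * W i j) * (\<Sum>k\<in>UNIV. Y k * v k)"
proof -
  define Q where "Q = (\<Sum>i\<in>UNIV. \<Sum>j\<in>UNIV. \<Sum>k\<in>UNIV. Y i * H j k * (W i j * v k))"
  have P1: "(\<Sum>i\<in>UNIV. \<Sum>j\<in>UNIV. \<Sum>k\<in>UNIV. H i j * Y k * (W i j * v k))
      = (\<Sum>i\<in>UNIV. \<Sum>j\<in>UNIV. H i j * W i j) * (\<Sum>k\<in>UNIV. Y k * v k)"
    by (simp only: sum_distrib_right) (simp only: sum_distrib_left mult_ac)
  have Q1: "(\<Sum>i\<in>UNIV. \<Sum>j\<in>UNIV. \<Sum>k\<in>UNIV. Y i * H j k * (v j * W i k)) = Q"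
    unfolding Q_def
  proof (rule sum.cong[OF refl])
    fix i
    have "(\<Sum>j\<in>UNIV. \<Sum>k\<in>UNIV. Y i * H j k * (v j * W i k)) = (\<Sum>k\<in>UNIV. \<Sum>j\<in>UNIV. Y i * H j k * (v j * W i k))"
      by (rule sum.swap)
    also have "\<dots> = (\<Sum>j\<in>UNIV. \<Sum>k\<in>UNIV. Y i * H j k * (W i j * v k))"
      using H by (simp add: mult_ac)
    finally show "(\<Sum>j\<in>UNIV. \<Sum>k\<in>UNIV. Y i * H j k * (v j * W i k)) = (\<Sum>j\<in>UNIV. \<Sum>k\<in>UNIV. Y i * H j k * (W i j * v k))" .
  qed
  have "(\<Sum>i\<in>UNIV. \<Sum>j\<in>UNIV. \<Sum>k\<in>UNIV. H i j * Y k * (v j * W i k))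
      = (\<Sum>i\<in>UNIV. \<Sum>k\<in>UNIV. \<Sum>j\<in>UNIV. H i j * Y k * (v j * W i k))"
    by (rule sum.cong[OF refl sum.swap])
  also have "\<dots> = (\<Sum>k\<in>UNIV. \<Sum>i\<in>UNIV. \<Sum>j\<in>UNIV. H i j * Y k * (v j * W i k))"
    by (rule sum.swap)
  also have "\<dots> = Q" unfolding Q_def
  proof (intro sum.cong refl)
    fix k i j
    show "H i j * Y k * (v j * W i k) = Y k * H i j * (W k i * v j)" using W[of i k] by (simp add: mult_ac)
  qed
  finally have P2: "(\<Sum>i\<in>UNIV. \<Sum>j\<in>UNIV. \<Sum>k\<in>UNIV. H i j * Y k * (v j * W i k)) = Q" .
  have "(H i j * Y k - Y i * H j k / 2) * (v j * W i k + W i j * v k)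
    = H i j * Y k * (v j * W i k) + H i j * Y k * (W i j * v k)
      - (Y i * H j k * (v j * W i k)) / 2 - (Y i * H j k * (W i j * v k)) / 2" for i j k
    by (simp add: algebra_simps)
  then have "(\<Sum>i\<in>UNIV. \<Sum>j\<in>UNIV. \<Sum>k\<in>UNIV. (H i j * Y k - Y i * H j k / 2) * (v j * W i k + W i j * v k))
    = (\<Sum>i\<in>UNIV. \<Sum>j\<in>UNIV. \<Sum>k\<in>UNIV. H i j * Y k * (v j * W i k)) + (\<Sum>i\<in>UNIV. \<Sum>j\<in>UNIV. \<Sum>k\<in>UNIV. H i j * Y k * (W i j * v k))
      - (\<Sum>i\<in>UNIV. \<Sum>j\<in>UNIV. \<Sum>k\<in>UNIV. Y i * H j k * (v j * W i k)) / 2 - Q / 2"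
    unfolding Q_def by (simp only: sum.distrib sum_subtractf sum_divide_distrib)
  then show ?thesis unfolding P1 P2 Q1 by simp
qed

section \<open>Differentiability and divergence of the current\<close>

lemma C1_on_flux_coeff:
  assumes h: "\<And>i j. C1_on U (\<lambda>x. h x $ i $ j)" and \<tau>: "\<And>i. C1_on U (\<lambda>x. \<tau> x $ i)"
  shows "C1_on U (\<lambda>x. (h x *v \<tau> x) $ k)" "C1_on U (flux_coeff h \<tau> i j k)"
proof -
  show 1: "C1_on U (\<lambda>x. (h x *v \<tau> x) $ k)" for k
    by (simp add: matrix_vector_mult_def) (intro C1_on_sum C1_on_mult h \<tau> finite)
  have "flux_coeff h \<tau> i j k = (\<lambda>x. h x $ i $ j * (h x *v \<tau> x) $ k - (h x *v \<tau> x) $ i * h x $ j $ k * (1 / 2))"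
    by (simp add: flux_coeff_def fun_eq_iff)
  then show "C1_on U (flux_coeff h \<tau> i j k)"
    by (simp only:) (intro C1_on_diff C1_on_mult 1 h C1_on_const)
qed

lemma C1_on_energy_current:
  assumes h: "\<And>i j. C1_on U (\<lambda>x. h x $ i $ j)" and \<tau>: "\<And>i. C1_on U (\<lambda>x. \<tau> x $ i)" and w: "C2_on U w"
  shows "C1_on U (energy_current h \<tau> w i)"
  unfolding energy_current_def[abs_def]
  by (intro C1_on_add C1_on_mult C1_on_sum finite C1_on_flux_coeff(2) h \<tau> C2_on_D[OF w])

text \<open>Second derivatives of w survive only in the combination that forms the principal part of
  L; all other terms are quadratic in w and dw. Symmetry of h and of the second derivatives is what
  makes \<open>flux_algebra\<close> applicable.\<close>

lemma energy_current_divergence: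
  fixes h :: "real^'m::finite \<Rightarrow> real^'m^'m"
  assumes U: "open U" "x \<in> U" and h: "\<And>i j. C1_on U (\<lambda>x. h x $ i $ j)" and \<tau>: "\<And>i. C1_on U (\<lambda>x. \<tau> x $ i)"
    and w: "C2_on U w" and sym: "transpose (h x) = h x"
  shows "(\<Sum>i\<in>UNIV. pd i (energy_current h \<tau> w i) x)
    = (\<Sum>i\<in>UNIV. \<Sum>j\<in>UNIV. h x $ i $ j * pd i (pd j w) x) * (\<Sum>k\<in>UNIV. (h x *v \<tau> x) $ k * pd k w x)
      + (\<Sum>i\<in>UNIV. \<Sum>j\<in>UNIV. \<Sum>k\<in>UNIV. pd i (flux_coeff h \<tau> i j k) x * (pd j w x * pd k w x))
      + (\<Sum>i\<in>UNIV. pd i (\<lambda>x. \<tau> x $ i) x * (w x * w x) + \<tau> x $ i * (2 * (w x * pd i w x)))"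
proof -
  note da = C1_on_D(1)[OF C1_on_flux_coeff(2)[of U h \<tau>, OF h \<tau>] U(2)] and d\<tau> = C1_on_D(1)[OF \<tau> U(2)]
    and dw = C1_on_D(1)[OF C2_on_D(1)[OF w] U(2)] and ddw = C1_on_D(1)[OF C2_on_D(2)[OF w] U(2)]
  have "pd i (energy_current h \<tau> w i) x
    = (\<Sum>j\<in>UNIV. \<Sum>k\<in>UNIV. flux_coeff h \<tau> i j k x * (pd j w x * pd i (pd k w) x + pd i (pd j w) x * pd k w x)
        + pd i (flux_coeff h \<tau> i j k) x * (pd j w x * pd k w x))
      + (pd i (\<lambda>x. \<tau> x $ i) x * (w x * w x) + \<tau> x $ i * (2 * (w x * pd i w x)))" for i
  proof -
    note dp = differentiable_mult[OF ddw ddw]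
    have dap: "(\<lambda>x. flux_coeff h \<tau> i j k x * (pd j w x * pd k w x)) differentiable (at x)" for j k
      by (intro differentiable_mult da dp)
    have ds: "(\<lambda>x. \<Sum>k\<in>UNIV. flux_coeff h \<tau> i j k x * (pd j w x * pd k w x)) differentiable (at x)" for j
      by (intro differentiable_sum dap ballI finite)
    have dss: "(\<lambda>x. \<Sum>j\<in>UNIV. \<Sum>k\<in>UNIV. flux_coeff h \<tau> i j k x * (pd j w x * pd k w x)) differentiable (at x)"
      by (intro differentiable_sum ds ballI finite)
    have dww: "(\<lambda>x. w x * w x) differentiable (at x)" by (intro differentiable_mult dw)
    have "pd i (energy_current h \<tau> w i) x
      = (\<Sum>j\<in>UNIV. \<Sum>k\<in>UNIV. pd i (\<lambda>x. flux_coeff h \<tau> i j k x * (pd j w x * pd k w x)) x) + pd i (\<lambda>x. \<tau> x $ i * (w x * w x)) x"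
      unfolding energy_current_def[abs_def]
      by (simp only: pd_add[OF dss differentiable_mult[OF d\<tau> dww]] pd_sum[OF ds] pd_sum[OF dap])
    then show ?thesis
      by (simp only: pd_mult[OF da dp] pd_mult[OF ddw ddw] pd_mult[OF d\<tau> dww] pd_mult[OF dw dw]) (simp add: algebra_simps)
  qed
  then have "(\<Sum>i\<in>UNIV. pd i (energy_current h \<tau> w i) x)
    = (\<Sum>i\<in>UNIV. \<Sum>j\<in>UNIV. \<Sum>k\<in>UNIV. flux_coeff h \<tau> i j k x * (pd j w x * pd i (pd k w) x + pd i (pd j w) x * pd k w x))
      + (\<Sum>i\<in>UNIV. \<Sum>j\<in>UNIV. \<Sum>k\<in>UNIV. pd i (flux_coeff h \<tau> i j k) x * (pd j w x * pd k w x))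
      + (\<Sum>i\<in>UNIV. pd i (\<lambda>x. \<tau> x $ i) x * (w x * w x) + \<tau> x $ i * (2 * (w x * pd i w x)))"
    by (simp only: sum.distrib)
  moreover have "(\<Sum>i\<in>UNIV. \<Sum>j\<in>UNIV. \<Sum>k\<in>UNIV. flux_coeff h \<tau> i j k x * (pd j w x * pd i (pd k w) x + pd i (pd j w) x * pd k w x))
    = (\<Sum>i\<in>UNIV. \<Sum>j\<in>UNIV. h x $ i $ j * pd i (pd j w) x) * (\<Sum>k\<in>UNIV. (h x *v \<tau> x) $ k * pd k w x)"
    unfolding flux_coeff_def
  proof (rule flux_algebra)
    show "h x $ i $ j = h x $ j $ i" for i j
      using sym by (metis transpose_def vec_lambda_beta)
    show "pd i (pd j w) x = pd j (pd i w) x" for i j by (rule pd_commute[OF U(1) w U(2)])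
  qed
  ultimately show ?thesis by simp
qed

lemma energy_current_bound:
  fixes h :: "real^'m::finite \<Rightarrow> real^'m^'m" and M :: real
  assumes M: "0 \<le> M" "\<And>j k. \<bar>flux_coeff h \<tau> i j k x\<bar> \<le> M" "\<bar>\<tau> x $ i\<bar> \<le> M"
  shows "\<bar>energy_current h \<tau> w i x\<bar> \<le> (CARD('m) * CARD('m) * M + M) * ((w x)\<^sup>2 + (norm (grad w x))\<^sup>2)"
proof -
  let ?q = "norm (grad w x)"
  have w: "\<bar>pd j w x\<bar> \<le> ?q" for j using component_le_norm_cart[of "grad w x" j] by simp
  have "\<bar>\<Sum>j\<in>UNIV. \<Sum>k\<in>UNIV. flux_coeff h \<tau> i j k x * (pd j w x * pd k w x)\<bar>
    \<le> (\<Sum>j\<in>UNIV. \<Sum>k\<in>UNIV. \<bar>flux_coeff h \<tau> i j k x * (pd j w x * pd k w x)\<bar>)"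
    by (rule order_trans[OF sum_abs sum_mono[OF sum_abs]])
  also have "\<dots> \<le> (\<Sum>j\<in>(UNIV::'m set). \<Sum>k\<in>(UNIV::'m set). M * (?q * ?q))"
    using M w unfolding abs_mult by (intro sum_mono mult_mono) auto
  finally have 1: "\<bar>\<Sum>j\<in>UNIV. \<Sum>k\<in>UNIV. flux_coeff h \<tau> i j k x * (pd j w x * pd k w x)\<bar> \<le> CARD('m) * CARD('m) * M * ?q\<^sup>2"
    by (simp add: power2_eq_square)
  have 2: "\<bar>\<tau> x $ i * (w x * w x)\<bar> \<le> M * (w x)\<^sup>2"
    using M(3) unfolding abs_mult power2_eq_square abs_mult_self_eq by (intro mult_right_mono) auto
  have "CARD('m) * CARD('m) * M * ?q\<^sup>2 + M * (w x)\<^sup>2 \<le> (CARD('m) * CARD('m) * M + M) * ((w x)\<^sup>2 + ?q\<^sup>2)"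
    using M(1) by (simp add: algebra_simps)
  then show ?thesis using 1 2 unfolding energy_current_def by linarith
qed

text \<open>The principal part equals Lw minus lower order terms, so it is bounded linearly in |Lw|,
  |dw| and |w|. The three summands of the constant come from its product with the multiplier, from
  the derivatives of \<open>flux_coeff\<close>, and from the part with w^2.\<close>

lemma energy_current_divergence_bound:
  fixes h :: "real^'m::finite \<Rightarrow> real^'m^'m"
  assumes U: "open U" "x \<in> U" and h: "\<And>i j. C1_on U (\<lambda>x. h x $ i $ j)" and \<tau>: "\<And>i. C1_on U (\<lambda>x. \<tau> x $ i)"
    and w: "C2_on U w" and sym: "transpose (h x) = h x"
    and M: "0 \<le> M" "\<And>k. \<bar>(h x *v \<tau> x) $ k\<bar> \<le> M" "\<And>i j k. \<bar>pd i (flux_coeff h \<tau> i j k) x\<bar> \<le> M"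
      "\<And>i. \<bar>pd i (\<lambda>x. \<tau> x $ i) x\<bar> \<le> M" "\<And>i. \<bar>\<tau> x $ i\<bar> \<le> M" "\<And>i. \<bar>b x $ i\<bar> \<le> M" "\<bar>c x\<bar> \<le> M"
  defines "N \<equiv> real CARD('m)"
  shows "(\<Sum>i\<in>UNIV. pd i (energy_current h \<tau> w i) x)
    \<le> (N * M * (1 + N * M + M) + N ^ 3 * M + 3 * N * M) * (((w x)\<^sup>2 + (norm (grad w x))\<^sup>2) + (L_op h b c w x)\<^sup>2)"
proof -
  define p q r where "p = \<bar>w x\<bar>" and "q = norm (grad w x)" and "r = \<bar>L_op h b c w x\<bar>"
  have pos: "0 \<le> p" "0 \<le> q" "0 \<le> r" "0 \<le> N" by (auto simp: p_def q_def r_def N_def)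
  have w': "\<bar>pd j w x\<bar> \<le> q" for j using component_le_norm_cart[of "grad w x" j] by (simp add: q_def)
  define A where "A = (\<Sum>i\<in>UNIV. \<Sum>j\<in>UNIV. h x $ i $ j * pd i (pd j w) x)"
  define Y where "Y = (\<Sum>k\<in>UNIV. (h x *v \<tau> x) $ k * pd k w x)"
  define T2 where "T2 = (\<Sum>i\<in>UNIV. \<Sum>j\<in>UNIV. \<Sum>k\<in>UNIV. pd i (flux_coeff h \<tau> i j k) x * (pd j w x * pd k w x))"
  define T3 where "T3 = (\<Sum>i\<in>UNIV. pd i (\<lambda>x. \<tau> x $ i) x * (w x * w x) + \<tau> x $ i * (2 * (w x * pd i w x)))"
  have lin: "\<bar>\<Sum>k\<in>UNIV. v k * pd k w x\<bar> \<le> N * M * q" if "\<And>k. \<bar>v k\<bar> \<le> M" for v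
  proof -
    have "\<bar>\<Sum>k\<in>UNIV. v k * pd k w x\<bar> \<le> (\<Sum>k\<in>UNIV. \<bar>v k * pd k w x\<bar>)" by (rule sum_abs)
    also have "\<dots> \<le> (\<Sum>k\<in>(UNIV::'m set). M * q)"
      using that w' M(1) unfolding abs_mult by (intro sum_mono mult_mono) auto
    finally show ?thesis by (simp add: N_def mult.assoc)
  qed
  have "A = L_op h b c w x - (\<Sum>i\<in>UNIV. b x $ i * pd i w x) - c x * w x" by (simp add: A_def L_op_def)
  moreover have "\<bar>c x * w x\<bar> \<le> M * p" using M(7) by (auto simp: p_def abs_mult intro!: mult_right_mono)
  moreover have "\<bar>\<Sum>i\<in>UNIV. b x $ i * pd i w x\<bar> \<le> N * M * q" by (rule lin[OF M(6)])
  ultimately have A: "\<bar>A\<bar> \<le> r + N * M * q + M * p" unfolding r_def by linarith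
  have Y: "\<bar>Y\<bar> \<le> N * M * q" unfolding Y_def by (rule lin[OF M(2)])
  have "\<bar>A * Y\<bar> \<le> (r + N * M * q + M * p) * (N * M * q)"
    unfolding abs_mult using A Y by (intro mult_mono) auto
  also have "\<dots> = N * M * (r * q + N * M * (q * q) + M * (p * q))" by (simp add: algebra_simps)
  also have "\<dots> \<le> N * M * (1 * (p\<^sup>2 + q\<^sup>2 + r\<^sup>2) + N * M * (p\<^sup>2 + q\<^sup>2 + r\<^sup>2) + M * (p\<^sup>2 + q\<^sup>2 + r\<^sup>2))"
  proof -
    have prod_le: "2 * (r * q) \<le> r\<^sup>2 + q\<^sup>2" "2 * (p * q) \<le> p\<^sup>2 + q\<^sup>2"
      using zero_le_power2[of "r - q"] zero_le_power2[of "p - q"] by (auto simp: power2_diff)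
    have sq: "0 \<le> p\<^sup>2" "0 \<le> q\<^sup>2" "0 \<le> r\<^sup>2" by auto
    have half: "a \<le> y1 + y2 + y3" if "2 * a \<le> y1 + y2" "0 \<le> y1" "0 \<le> y2" "0 \<le> y3" for a y1 y2 y3 :: real
      using that by linarith
    have "r * q \<le> 1 * (p\<^sup>2 + q\<^sup>2 + r\<^sup>2)"
      using half[OF prod_le(1) sq(3,2,1)] by (simp add: add_ac)
    moreover have "q * q \<le> p\<^sup>2 + q\<^sup>2 + r\<^sup>2" using sq by (simp add: power2_eq_square)
    moreover have "p * q \<le> p\<^sup>2 + q\<^sup>2 + r\<^sup>2" by (rule half[OF prod_le(2) sq])
    ultimately show ?thesis using M(1) pos by (intro mult_left_mono add_mono mult_nonneg_nonneg) auto
  qed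
  finally have AY: "\<bar>A * Y\<bar> \<le> N * M * (1 + N * M + M) * (p\<^sup>2 + q\<^sup>2 + r\<^sup>2)" by (simp add: algebra_simps)
  have "\<bar>T2\<bar> \<le> (\<Sum>i\<in>UNIV. \<Sum>j\<in>UNIV. \<Sum>k\<in>UNIV. \<bar>pd i (flux_coeff h \<tau> i j k) x * (pd j w x * pd k w x)\<bar>)"
    unfolding T2_def by (rule order_trans[OF sum_abs sum_mono[OF order_trans[OF sum_abs sum_mono[OF sum_abs]]]])
  also have "\<dots> \<le> (\<Sum>i\<in>(UNIV::'m set). \<Sum>j\<in>(UNIV::'m set). \<Sum>k\<in>(UNIV::'m set). M * (q * q))"
    using M w' pos unfolding abs_mult by (intro sum_mono mult_mono) auto
  also have "\<dots> = N ^ 3 * M * q\<^sup>2" by (simp add: N_def power2_eq_square power3_eq_cube)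
  also have "\<dots> \<le> N ^ 3 * M * (p\<^sup>2 + q\<^sup>2 + r\<^sup>2)" using M(1) pos by (intro mult_left_mono) auto
  finally have T2: "\<bar>T2\<bar> \<le> N ^ 3 * M * (p\<^sup>2 + q\<^sup>2 + r\<^sup>2)" .
  have "\<bar>T3\<bar> \<le> (\<Sum>i\<in>UNIV. \<bar>pd i (\<lambda>x. \<tau> x $ i) x * (w x * w x) + \<tau> x $ i * (2 * (w x * pd i w x))\<bar>)"
    unfolding T3_def by (rule sum_abs)
  also have "\<dots> \<le> (\<Sum>i\<in>(UNIV::'m set). M * (p * p) + M * (2 * (p * q)))"
  proof (rule sum_mono)
    fix i
    have "\<bar>pd i (\<lambda>x. \<tau> x $ i) x * (w x * w x)\<bar> \<le> M * (p * p)"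
      unfolding abs_mult p_def by (intro mult_right_mono M(4)) auto
    moreover have "\<bar>\<tau> x $ i * (2 * (w x * pd i w x))\<bar> \<le> M * (2 * (p * q))"
      unfolding abs_mult p_def using M(1,5) w' by (intro mult_mono) auto
    ultimately show "\<bar>pd i (\<lambda>x. \<tau> x $ i) x * (w x * w x) + \<tau> x $ i * (2 * (w x * pd i w x))\<bar> \<le> M * (p * p) + M * (2 * (p * q))"
      by linarith
  qed
  also have "\<dots> = N * M * (p\<^sup>2 + 2 * (p * q))" by (simp add: N_def power2_eq_square algebra_simps)
  also have "\<dots> \<le> N * M * (3 * (p\<^sup>2 + q\<^sup>2 + r\<^sup>2))"
  proof -
    have aux: "y1 + a \<le> 3 * (y1 + y2 + y3)" if "a \<le> y1 + y2" "0 \<le> y1" "0 \<le> y2" "0 \<le> y3" for a y1 y2 y3 :: real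
      using that unfolding distrib_left by linarith
    have "2 * (p * q) \<le> p\<^sup>2 + q\<^sup>2" using zero_le_power2[of "p - q"] by (auto simp: power2_diff)
    then have "p\<^sup>2 + 2 * (p * q) \<le> 3 * (p\<^sup>2 + q\<^sup>2 + r\<^sup>2)" by (intro aux zero_le_power2)
    then show ?thesis using M(1) pos by (intro mult_left_mono) auto
  qed
  finally have T3: "\<bar>T3\<bar> \<le> 3 * N * M * (p\<^sup>2 + q\<^sup>2 + r\<^sup>2)" by (simp add: algebra_simps)
  have "(\<Sum>i\<in>UNIV. pd i (energy_current h \<tau> w i) x) = A * Y + T2 + T3"
    unfolding energy_current_divergence[OF U h \<tau> w sym] A_def Y_def T2_def T3_def ..
  also have "\<dots> \<le> N * M * (1 + N * M + M) * (p\<^sup>2 + q\<^sup>2 + r\<^sup>2) + N ^ 3 * M * (p\<^sup>2 + q\<^sup>2 + r\<^sup>2)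
      + 3 * N * M * (p\<^sup>2 + q\<^sup>2 + r\<^sup>2)"
    by (intro add_mono abs_le_D1[OF AY] abs_le_D1[OF T2] abs_le_D1[OF T3])
  also have "\<dots> = (N * M * (1 + N * M + M) + N ^ 3 * M + 3 * N * M) * (p\<^sup>2 + q\<^sup>2 + r\<^sup>2)"
    by (simp only: distrib_right)
  finally show ?thesis by (simp add: p_def q_def r_def)
qed

section \<open>The initial value problem\<close>

lemma spacelike_surface_locally_in_level_set:
  assumes "spacelike_surface h \<Omega> S"
  shows "compact S" "locally_in_level_set S"
proof -
  show "compact S" using assms by (simp add: spacelike_surface_def)
  obtain M where M: "spacelike_hypersurface h M" "S \<subseteq> M"
    using assms unfolding spacelike_surface_def by blast
  show "locally_in_level_set S"
    unfolding locally_in_level_set_def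
  proof
    fix x assume x: "x \<in> S"
    have "\<exists>U \<sigma>. open U \<and> x \<in> U \<and> C1_on U \<sigma> \<and> M \<inter> U = {y\<in>U. \<sigma> y = 0} \<and>
        (\<forall>y\<in>M \<inter> U. timelike_conormal (h y) (grad \<sigma> y))"
      using M(1) subsetD[OF M(2) x] unfolding spacelike_hypersurface_def by (rule bspec)
    then obtain U \<sigma> where U: "open U" "x \<in> U" "C1_on U \<sigma>" "M \<inter> U = {y\<in>U. \<sigma> y = 0}"
        "\<forall>y\<in>M \<inter> U. timelike_conormal (h y) (grad \<sigma> y)"
      by (elim exE conjE)
    have "grad \<sigma> x \<noteq> 0" using U(2,5) M(2) x by (auto simp: timelike_conormal_def)
    moreover have "\<forall>y\<in>S \<inter> U. \<sigma> y = 0" using U(4) M(2) by blast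
    ultimately show "\<exists>U \<sigma>. open U \<and> x \<in> U \<and> C1_on U \<sigma> \<and> (\<forall>y\<in>S \<inter> U. \<sigma> y = 0) \<and> grad \<sigma> x \<noteq> 0"
      using U(1-3) by blast
  qed
qed

text \<open>The function t - s serves as defining function. The lemma is used to discard the level t
  = s and the upper surface as null sets.\<close>

lemma sweep_locally_in_level_set:
  assumes sw: "spacelike_sweeping h D t s0 s1" and s: "s \<in> {s0..s1}" and "bounded D"
  shows "compact (sweep D t s)" "locally_in_level_set (sweep D t s)"
proof -
  obtain W where W: "open W" "closure D \<subseteq> W" "C1_on W t"
    using sw unfolding spacelike_sweeping_def by blast
  have "continuous_on (closure D) t" by (rule continuous_on_subset[OF C1_on_D(3)[OF W(3)] W(2)])
  from continuous_closed_preimage_constant[OF this closed_closure, of s]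
  have "closed (sweep D t s)" by (simp add: sweep_def)
  moreover have "bounded (sweep D t s)"
    by (rule bounded_subset[OF bounded_closure[OF \<open>bounded D\<close>]]) (auto simp: sweep_def)
  ultimately show "compact (sweep D t s)" by (simp add: compact_eq_bounded_closed)
  show "locally_in_level_set (sweep D t s)"
    unfolding locally_in_level_set_def
  proof
    fix x assume x: "x \<in> sweep D t s"
    then have xW: "x \<in> W" using W(2) by (auto simp: sweep_def)
    have C: "C1_on W (\<lambda>y. t y - s)" by (intro C1_on_diff W C1_on_const)
    have "timelike_conormal (h x) (grad t x)" using sw s x unfolding spacelike_sweeping_def by blast
    moreover have "grad (\<lambda>y. t y - s) x = grad t x"
      using C1_on_D(1)[OF W(3) xW] by (simp add: vec_eq_iff pd_diff)
    ultimately have "grad (\<lambda>y. t y - s) x \<noteq> 0" by (simp add: timelike_conormal_def)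
    then show "\<exists>U \<sigma>. open U \<and> x \<in> U \<and> C1_on U \<sigma> \<and> (\<forall>y\<in>sweep D t s \<inter> U. \<sigma> y = 0) \<and> grad \<sigma> x \<noteq> 0"
      using W(1) xW C by (intro exI[of _ W] exI[of _ "\<lambda>y. t y - s"]) (auto simp: sweep_def)
  qed
qed

lemma continuous_on_L_op:
  assumes "C2_on D w" "\<And>i j. continuous_on D (\<lambda>x. h x $ i $ j)" "continuous_on D b" "continuous_on D c"
  shows "continuous_on D (L_op h b c w)"
proof -
  have b: "continuous_on D (\<lambda>x. b x $ i)" for i by (intro continuous_intros assms)
  show ?thesis
    unfolding L_op_def[abs_def]
    by (intro continuous_on_add continuous_on_sum continuous_on_mult assms b
        C1_on_D(2,3)[OF C2_on_D(1)[OF assms(1)]] C1_on_D(2)[OF C2_on_D(2)[OF assms(1)]])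
qed

text \<open>The constant is fixed before the data and the solution: every bound is taken over the
  compact closure of D and involves only the coefficients, the multiplier and the time
  function.\<close>

lemma initial_value_estimate:
  fixes \<Omega> D Si Se :: "(real^'m::finite) set"
    and h :: "real^'m \<Rightarrow> real^'m^'m"
    and b :: "real^'m \<Rightarrow> real^'m"
    and c t :: "real^'m \<Rightarrow> real"
    and n :: nat and s0 s1 :: real
  assumes card: "CARD('m) = n + 1"
    and h1: "\<And>i j. C1_on \<Omega> (\<lambda>x. h x $ i $ j)"
    and sym: "\<And>x. x \<in> \<Omega> \<Longrightarrow> transpose (h x) = h x"
    and sig: "\<And>x. x \<in> \<Omega> \<Longrightarrow> has_signature (h x) n 1"
    and cb: "continuous_on \<Omega> b" and cc: "continuous_on \<Omega> c"
    and D: "open D" "bounded D" "closure D \<subseteq> \<Omega>"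
    and fr: "frontier D = Si \<union> Se"
    and Si: "spacelike_surface h \<Omega> Si"
    and sw: "spacelike_sweeping h D t s0 s1"
    and Se: "Se = sweep D t s1"
  shows "\<exists>C>0. \<forall>f g \<omega> w. solves_ivp h b c D Si f g \<omega> w \<longrightarrow>
       (\<forall>s\<in>{s0..s1}.
          (\<integral>\<^sup>+x\<in>swept D t s. ennreal ((w x)\<^sup>2) \<partial>lborel)
          \<le> ennreal (C * (s - s0)) * (\<integral>\<^sup>+x\<in>Si. ennreal ((g x)\<^sup>2 + (norm (\<omega> x))\<^sup>2) \<partial>hausdorff_measure n)
            + ennreal C * (\<integral>\<^sup>+x\<in>swept D t s. ennreal ((f x)\<^sup>2) \<partial>lborel))"
proof -
  let ?K = "closure D"
  have K: "compact ?K" using D(2) by (simp add: compact_closure)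
  have DK: "D \<subseteq> ?K" by (rule closure_subset)
  obtain W where W: "open W" "?K \<subseteq> W" "C1_on W t"
    using sw unfolding spacelike_sweeping_def by blast
  have D\<Omega>: "D \<subseteq> \<Omega>" and DW: "D \<subseteq> W" using DK D(3) W(2) by auto
  have tK: "continuous_on ?K t" by (rule continuous_on_subset[OF C1_on_D(3)[OF W(3)] W(2)])
  have tD: "C1_on D t" by (rule C1_on_subset[OF W(3) DW])
  have cl: "?K = (\<Union>s\<in>{s0..s1}. sweep D t s)" using sw unfolding spacelike_sweeping_def by blast
  have lev: "\<exists>s\<in>{s0..s1}. x \<in> sweep D t s" if "x \<in> ?K" for x
    using eqset_imp_iff[OF cl, THEN iffD1, OF that] by (simp only: UN_iff)
  have t0: "s0 \<le> t x" if "x \<in> ?K" for x using lev[OF that] by (auto simp: sweep_def)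
  have gt: "continuous_on ?K (grad t)"
    unfolding grad_def[abs_def]
    by (intro continuous_on_vec_lambda continuous_on_subset[OF C1_on_D(2)[OF W(3)] W(2)])
  have tl: "timelike_conormal (h x) (grad t x)" if "x \<in> ?K" for x
    using lev[OF that] sw unfolding spacelike_sweeping_def by blast
  have hK: "continuous_on ?K (\<lambda>x. h x $ i $ j)" for i j
    by (rule continuous_on_subset[OF C1_on_D(3)[OF h1] D(3)])
  have sK: "transpose (h x) = h x" "has_signature (h x) n 1" if "x \<in> ?K" for x
    using that D(3) sym sig by auto
  have "\<exists>\<tau> c. (\<forall>i. real_polynomial_function (\<lambda>x. \<tau> x $ i)) \<and> 0 < c \<and> (\<forall>x\<in>?K. c \<le> \<tau> x \<bullet> grad t x) \<and>
    (\<forall>x\<in>?K. \<forall>\<eta>. c * (norm \<eta>)\<^sup>2 \<le> bform (h x) (grad t x) \<eta> * bform (h x) \<eta> (\<tau> x)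
        - bform (h x) (grad t x) (\<tau> x) * bform (h x) \<eta> \<eta> / 2)"
    by (rule energy_multiplier[OF card K hK gt sK tl])
  then obtain \<tau> c0 where \<tau>: "\<forall>i. real_polynomial_function (\<lambda>x. \<tau> x $ i)" and c0: "0 < c0"
    and \<tau>N: "\<forall>x\<in>?K. c0 \<le> \<tau> x \<bullet> grad t x"
    and \<tau>E: "\<forall>x\<in>?K. \<forall>\<eta>. c0 * (norm \<eta>)\<^sup>2 \<le> bform (h x) (grad t x) \<eta> * bform (h x) \<eta> (\<tau> x)
        - bform (h x) (grad t x) (\<tau> x) * bform (h x) \<eta> \<eta> / 2"
    by (elim exE conjE)
  have C\<tau>: "C1_on U (\<lambda>x. \<tau> x $ i)" for U i using \<tau> real_polynomial_function_C1_on by blast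
  note Cf = C1_on_flux_coeff[of \<Omega> h \<tau>, OF h1 C\<tau>]
  have onK: "continuous_on ?K F" if "continuous_on \<Omega> F" for F :: "real^'m \<Rightarrow> real"
    using that D(3) by (rule continuous_on_subset)
  have "\<exists>M\<ge>0. \<forall>k\<in>UNIV. \<forall>x\<in>?K. \<bar>(h x *v \<tau> x) $ k\<bar> \<le> M"
    by (rule compact_family_bounded[OF K finite onK[OF C1_on_D(3)[OF Cf(1)]]])
  then obtain M1 where M1: "0 \<le> M1" "\<forall>k\<in>UNIV. \<forall>x\<in>?K. \<bar>(h x *v \<tau> x) $ k\<bar> \<le> M1" by blast
  have "\<exists>M\<ge>0. \<forall>p\<in>UNIV. \<forall>x\<in>?K. \<bar>pd (fst p) (flux_coeff h \<tau> (fst p) (fst (snd p)) (snd (snd p))) x\<bar> \<le> M"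
    by (rule compact_family_bounded[OF K finite onK[OF C1_on_D(2)[OF Cf(2)]]])
  then obtain M2 where M2: "0 \<le> M2" "\<forall>p\<in>UNIV. \<forall>x\<in>?K. \<bar>pd (fst p) (flux_coeff h \<tau> (fst p) (fst (snd p)) (snd (snd p))) x\<bar> \<le> M2" by blast
  have "\<exists>M\<ge>0. \<forall>p\<in>UNIV. \<forall>x\<in>?K. \<bar>flux_coeff h \<tau> (fst p) (fst (snd p)) (snd (snd p)) x\<bar> \<le> M"
    by (rule compact_family_bounded[OF K finite onK[OF C1_on_D(3)[OF Cf(2)]]])
  then obtain M3 where M3: "0 \<le> M3" "\<forall>p\<in>UNIV. \<forall>x\<in>?K. \<bar>flux_coeff h \<tau> (fst p) (fst (snd p)) (snd (snd p)) x\<bar> \<le> M3" by blast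
  have "\<exists>M\<ge>0. \<forall>i\<in>UNIV. \<forall>x\<in>?K. \<bar>pd i (\<lambda>x. \<tau> x $ i) x\<bar> \<le> M"
    by (rule compact_family_bounded[OF K finite onK[OF C1_on_D(2)[OF C\<tau>]]])
  then obtain M4 where M4: "0 \<le> M4" "\<forall>i\<in>UNIV. \<forall>x\<in>?K. \<bar>pd i (\<lambda>x. \<tau> x $ i) x\<bar> \<le> M4" by blast
  have "\<exists>M\<ge>0. \<forall>i\<in>UNIV. \<forall>x\<in>?K. \<bar>\<tau> x $ i\<bar> \<le> M"
    by (rule compact_family_bounded[OF K finite onK[OF C1_on_D(3)[OF C\<tau>]]])
  then obtain M5 where M5: "0 \<le> M5" "\<forall>i\<in>UNIV. \<forall>x\<in>?K. \<bar>\<tau> x $ i\<bar> \<le> M5" by blast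
  have bi: "continuous_on \<Omega> (\<lambda>x. b x $ i)" for i by (intro continuous_intros cb)
  have "\<exists>M\<ge>0. \<forall>i\<in>UNIV. \<forall>x\<in>?K. \<bar>b x $ i\<bar> \<le> M"
    by (rule compact_family_bounded[OF K finite onK[OF bi]])
  then obtain M6 where M6: "0 \<le> M6" "\<forall>i\<in>UNIV. \<forall>x\<in>?K. \<bar>b x $ i\<bar> \<le> M6" by blast
  have "\<exists>M\<ge>0. \<forall>i\<in>(UNIV :: unit set). \<forall>x\<in>?K. \<bar>c x\<bar> \<le> M"
    by (rule compact_family_bounded[OF K finite onK[OF cc]])
  then obtain M7 where M7: "0 \<le> M7" "\<forall>i\<in>(UNIV :: unit set). \<forall>x\<in>?K. \<bar>c x\<bar> \<le> M7" by blast
  define M where "M = M1 + M2 + M3 + M4 + M5 + M6 + M7"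
  have M0: "0 \<le> M" unfolding M_def using M1(1) M2(1) M3(1) M4(1) M5(1) M6(1) M7(1) by linarith
  have le: "M1 \<le> M" "M2 \<le> M" "M3 \<le> M" "M4 \<le> M" "M5 \<le> M" "M6 \<le> M" "M7 \<le> M"
    unfolding M_def using M1(1) M2(1) M3(1) M4(1) M5(1) M6(1) M7(1) by linarith+
  have bM: "\<bar>(h x *v \<tau> x) $ k\<bar> \<le> M" "\<bar>pd i (flux_coeff h \<tau> i j k) x\<bar> \<le> M" "\<bar>flux_coeff h \<tau> i j k x\<bar> \<le> M"
    "\<bar>pd i (\<lambda>x. \<tau> x $ i) x\<bar> \<le> M" "\<bar>\<tau> x $ i\<bar> \<le> M" "\<bar>b x $ i\<bar> \<le> M" "\<bar>c x\<bar> \<le> M" if x: "x \<in> ?K" for x i j k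
  proof -
    show "\<bar>(h x *v \<tau> x) $ k\<bar> \<le> M" using bspec[OF bspec[OF M1(2) UNIV_I] x] le(1) by (rule order_trans)
    show "\<bar>pd i (flux_coeff h \<tau> i j k) x\<bar> \<le> M"
      using bspec[OF bspec[OF M2(2) UNIV_I[of "(i,j,k)"]] x] le(2) by (simp only: fst_conv snd_conv)
    show "\<bar>flux_coeff h \<tau> i j k x\<bar> \<le> M"
      using bspec[OF bspec[OF M3(2) UNIV_I[of "(i,j,k)"]] x] le(3) by (simp only: fst_conv snd_conv)
    show "\<bar>pd i (\<lambda>x. \<tau> x $ i) x\<bar> \<le> M" using bspec[OF bspec[OF M4(2) UNIV_I] x] le(4) by (rule order_trans)
    show "\<bar>\<tau> x $ i\<bar> \<le> M" using bspec[OF bspec[OF M5(2) UNIV_I] x] le(5) by (rule order_trans)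
    show "\<bar>b x $ i\<bar> \<le> M" using bspec[OF bspec[OF M6(2) UNIV_I] x] le(6) by (rule order_trans)
    show "\<bar>c x\<bar> \<le> M" using bspec[OF bspec[OF M7(2) UNIV_I] x] le(7) by (rule order_trans)
  qed
  define N where "N = real CARD('m)"
  define C1 where "C1 = N * M * (1 + N * M + M) + N ^ 3 * M + 3 * N * M"
  define C2 where "C2 = N * N * M + M"
  have C12: "0 \<le> C1" "0 \<le> C2" using M0 by (auto simp: C1_def C2_def N_def)
  define Cn where "Cn = 16 * 2 ^ (n + 1) * unit_ball_vol (real (n + 1)) * (2 ^ n / unit_ball_vol (real n) + 1)"
  have Cn: "0 \<le> Cn" by (simp add: Cn_def)
  define E where "E = exp (C1 / c0 * (s1 - s0)) / c0"
  have E: "0 \<le> E" using c0 by (simp add: E_def)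
  \<comment> \<open>The factor \<open>\<bar>s1 - s0\<bar>\<close> absorbs s - s0 in the term with f;
    it carries an absolute value because s0 \<le> s1 is not assumed. The summand 1 makes C
    positive.\<close>
  define C where "C = E * (C2 * N * Cn) + E * \<bar>s1 - s0\<bar> * C1 + 1"
  have N0: "0 \<le> N" by (simp add: N_def)
  have C: "0 < C" "E * (C2 * N * Cn) \<le> C" "E * \<bar>s1 - s0\<bar> * C1 \<le> C"
  proof -
    have "0 \<le> E * (C2 * N * Cn)" "0 \<le> E * \<bar>s1 - s0\<bar> * C1" using E C12 Cn N0 by auto
    then show "0 < C" "E * (C2 * N * Cn) \<le> C" "E * \<bar>s1 - s0\<bar> * C1 \<le> C" unfolding C_def by linarith+
  qed
  note Sil = spacelike_surface_locally_in_level_set[OF Si]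
  obtain B where B: "0 \<le> B" "\<And>\<delta>. 0 < \<delta> \<Longrightarrow> hausdorff_pre n \<delta> Si \<le> ennreal B"
    using level_set_hausdorff_bound[OF card Sil] by blast
  have frD: "frontier D = ?K - D" using D(1) by (simp add: frontier_def interior_open)
  have SiK: "Si \<subseteq> ?K" "Si \<inter> D = {}" using fr frD by auto
  \<comment> \<open>Frontier points outside \<open>Si\<close> are on the top level s1, where the
    weight vanishes for every s in the interval.\<close>
  have frS: "x \<in> Si \<or> s1 \<le> t x" if "x \<in> ?K - D" for x
    using that fr frD Se by (auto simp: sweep_def)
  have main: "(\<integral>\<^sup>+x\<in>swept D t s. ennreal ((w x)\<^sup>2) \<partial>lborel)
          \<le> ennreal (C * (s - s0)) * (\<integral>\<^sup>+x\<in>Si. ennreal ((g x)\<^sup>2 + (norm (\<omega> x))\<^sup>2) \<partial>hausdorff_measure n)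
            + ennreal C * (\<integral>\<^sup>+x\<in>swept D t s. ennreal ((f x)\<^sup>2) \<partial>lborel)"
    if w: "solves_ivp h b c D Si f g \<omega> w" and s: "s \<in> {s0..s1}" for f g \<omega> w s
  proof -
    have w2: "C2_on D w" and wc: "continuous_on ?K w" and wL: "\<forall>x\<in>D. L_op h b c w x = f x"
      and wg: "\<forall>x\<in>Si. w x = g x"
      and wV: "\<exists>V. continuous_on ?K V \<and> (\<forall>x\<in>D. V x = grad w x) \<and> (\<forall>x\<in>Si. V x = \<omega> x)"
      using w unfolding solves_ivp_def by - (elim conjE, assumption)+
    obtain V where V: "continuous_on ?K V" "\<forall>x\<in>D. V x = grad w x" "\<forall>x\<in>Si. V x = \<omega> x"
      using wV by (elim exE conjE)
    \<comment> \<open>The extension V stands in for \<open>grad w\<close>, which need not exist on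
      the boundary. G is therefore continuous on the closure and is the density of the data on
      \<open>Si\<close>.\<close>
    define G where "G x = (w x)\<^sup>2 + (norm (V x))\<^sup>2" for x
    have cG: "continuous_on ?K G" unfolding G_def[abs_def] by (intro continuous_intros wc V(1))
    have G0: "0 \<le> G x" for x by (simp add: G_def)
    have GD: "G x = (w x)\<^sup>2 + (norm (grad w x))\<^sup>2" if "x \<in> D" for x using V(2) that by (simp add: G_def)
    define R where "R x = (L_op h b c w x)\<^sup>2" for x
    have cL: "continuous_on D (L_op h b c w)"
      by (rule continuous_on_L_op[OF w2 continuous_on_subset[OF hK DK] continuous_on_subset[OF cb D\<Omega>] continuous_on_subset[OF cc D\<Omega>]])
    have cR: "continuous_on D R" unfolding R_def[abs_def] by (intro continuous_intros cL)
    have hD: "C1_on D (\<lambda>x. h x $ i $ j)" for i j by (rule C1_on_subset[OF h1 D\<Omega>])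
    have J: "C1_on D (energy_current h \<tau> w i)" for i by (rule C1_on_energy_current[OF hD C\<tau> w2])
    have en: "c0 * G x \<le> (\<Sum>i\<in>UNIV. energy_current h \<tau> w i x * pd i t x)" if x: "x \<in> D" for x
    proof -
      have xK: "x \<in> ?K" using x DK by blast
      have "c0 * (w x)\<^sup>2 \<le> (\<tau> x \<bullet> grad t x) * (w x)\<^sup>2" using bspec[OF \<tau>N xK] by (rule mult_right_mono) simp
      moreover note spec[OF bspec[OF \<tau>E xK], of "grad w x"]
      ultimately have "c0 * G x \<le> (\<Sum>i\<in>UNIV. energy_current h \<tau> w i x * grad t x $ i)"
        unfolding energy_current_dot GD[OF x] distrib_left by linarith
      then show ?thesis by simp
    qed
    have dv: "(\<Sum>i\<in>UNIV. pd i (energy_current h \<tau> w i) x) \<le> C1 * (G x + R x)" if x: "x \<in> D" for x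
    proof -
      have xK: "x \<in> ?K" using x DK by blast
      show ?thesis
        unfolding C1_def N_def GD[OF x] R_def
        by (rule energy_current_divergence_bound[OF D(1) x hD C\<tau> w2 sK(1)[OF xK] M0]; rule bM[OF xK])
    qed
    have Jb: "\<bar>energy_current h \<tau> w i x\<bar> \<le> C2 * G x" if x: "x \<in> D" for i x
    proof -
      have xK: "x \<in> ?K" using x DK by blast
      show ?thesis
        unfolding C2_def N_def GD[OF x] of_nat_mult[symmetric] by (rule energy_current_bound[OF M0]; rule bM[OF xK])
    qed
    let ?D = "D \<inter> {x. t x < s}"
    let ?IS = "\<integral>\<^sup>+x\<in>Si. ennreal ((g x)\<^sup>2 + (norm (\<omega> x))\<^sup>2) \<partial>hausdorff_measure n"
    let ?IF = "\<integral>\<^sup>+x\<in>swept D t s. ennreal ((f x)\<^sup>2) \<partial>lborel"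
    have R0: "0 \<le> R x" for x by (simp add: R_def)
    have est: "(\<integral>\<^sup>+x\<in>?D. ennreal (G x) \<partial>lborel)
      \<le> ennreal (E * (s - s0)) * (ennreal C1 * (\<integral>\<^sup>+x\<in>?D. ennreal (R x) \<partial>lborel)
        + ennreal (C2 * N * Cn) * (\<integral>\<^sup>+x\<in>Si. ennreal (G x) \<partial>hausdorff_measure n))"
      unfolding E_def N_def Cn_def
      by (rule energy_estimate[OF card D(1,2) tD tK Sil(1) SiK frS t0 B(2,1) J cG G0 cR R0 en dv Jb c0 C12 s])
    have IS: "(\<integral>\<^sup>+x\<in>Si. ennreal (G x) \<partial>hausdorff_measure n) = ?IS"
    proof (rule nn_integral_cong)
      fix x show "ennreal (G x) * indicator Si x = ennreal ((g x)\<^sup>2 + (norm (\<omega> x))\<^sup>2) * indicator Si x"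
        using wg V(3) by (cases "x \<in> Si") (auto simp: G_def)
    qed
    have IF: "(\<integral>\<^sup>+x\<in>?D. ennreal (R x) \<partial>lborel) \<le> ?IF"
    proof (rule nn_integral_mono)
      fix x show "ennreal (R x) * indicator ?D x \<le> ennreal ((f x)\<^sup>2) * indicator (swept D t s) x"
        using wL DK by (cases "x \<in> ?D") (auto simp: R_def swept_def)
    qed
    have null: "AE x in lborel. x \<notin> Z" if "compact Z" "locally_in_level_set Z" for Z :: "(real^'m) set"
      using level_set_null[OF card that] compact_imp_closed[OF that(1)] by (intro AE_not_in null_setsI) auto
    have s1: "s1 \<in> {s0..s1}" using s by simp
    \<comment> \<open>The closed set \<open>swept D t s\<close> exceeds the open one by parts of
      \<open>Si\<close>, of \<open>Se\<close> and of the level t = s, all of Lebesgue measure 0; on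
      the open set |w|^2 is at most G.\<close>
    have "(\<integral>\<^sup>+x\<in>swept D t s. ennreal ((w x)\<^sup>2) \<partial>lborel) \<le> (\<integral>\<^sup>+x\<in>?D. ennreal (G x) \<partial>lborel)"
    proof (rule nn_integral_mono_AE)
      show "AE x in lborel. ennreal ((w x)\<^sup>2) * indicator (swept D t s) x \<le> ennreal (G x) * indicator ?D x"
        using null[OF Sil] null[OF sweep_locally_in_level_set[OF sw s D(2)]] null[OF sweep_locally_in_level_set[OF sw s1 D(2)]]
      proof eventually_elim
        case (elim x)
        show ?case
        proof (cases "x \<in> swept D t s")
          case True
          then have x: "x \<in> ?K" "t x \<le> s" by (auto simp: swept_def)
          have "x \<in> D" using x(1) elim(1,3) fr frD Se by blast
          moreover have "t x \<noteq> s" using x elim(2) by (auto simp: sweep_def)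
          ultimately have "x \<in> ?D" using x by auto
          then show ?thesis using True by (simp add: G_def ennreal_leI)
        qed simp
      qed
    qed
    also note est
    also have "ennreal (E * (s - s0)) * (ennreal C1 * (\<integral>\<^sup>+x\<in>?D. ennreal (R x) \<partial>lborel)
        + ennreal (C2 * N * Cn) * (\<integral>\<^sup>+x\<in>Si. ennreal (G x) \<partial>hausdorff_measure n))
      \<le> ennreal (E * (s - s0)) * (ennreal C1 * ?IF + ennreal (C2 * N * Cn) * ?IS)"
      unfolding IS by (intro mult_left_mono add_right_mono IF) simp_all
    also have "\<dots> = ennreal (E * (s - s0) * (C2 * N * Cn)) * ?IS + ennreal (E * (s - s0) * C1) * ?IF"
      using E s C12 Cn N0 by (simp add: distrib_left ennreal_mult mult.assoc add.commute)
    also have "\<dots> \<le> ennreal (C * (s - s0)) * ?IS + ennreal C * ?IF"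
    proof (intro add_mono mult_right_mono ennreal_leI)
      show "E * (s - s0) * (C2 * N * Cn) \<le> C * (s - s0)"
        using mult_right_mono[OF C(2), of "s - s0"] s by (simp add: mult_ac)
      have "E * (s - s0) * C1 \<le> E * \<bar>s1 - s0\<bar> * C1"
        using s E C12 by (intro mult_right_mono mult_left_mono) auto
      then show "E * (s - s0) * C1 \<le> C" using C(3) by linarith
    qed simp_all
    finally show ?thesis .
  qed
  show ?thesis using C(1) main by (intro exI[of _ C]) blast
qed

text \<open>A polynomial is smooth on the whole space, so V - dp is the continuous extension
  required of the gradient of the difference.\<close>

lemma solves_ivp_diff_polynomial:
  assumes D: "open D" "Si \<subseteq> closure D" and u: "solves_ivp h b c D Si f g \<omega> u" and p: "real_polynomial_function p"
  shows "solves_ivp h b c D Si (\<lambda>x. f x - L_op h b c p x) (\<lambda>x. g x - p x) (\<lambda>x. \<omega> x - grad p x) (\<lambda>x. u x - p x)"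
proof -
  note p1 = real_polynomial_function_C1_on[OF p] and p2 = real_polynomial_function_C2_on[OF p]
  have u2: "C2_on D u" and uc: "continuous_on (closure D) u" and uL: "\<forall>x\<in>D. L_op h b c u x = f x"
      and ug: "\<forall>x\<in>Si. u x = g x"
      and uV: "\<exists>V. continuous_on (closure D) V \<and> (\<forall>x\<in>D. V x = grad u x) \<and> (\<forall>x\<in>Si. V x = \<omega> x)"
    using u unfolding solves_ivp_def by - (elim conjE, assumption)+
  obtain V where V: "continuous_on (closure D) V" "\<forall>x\<in>D. V x = grad u x" "\<forall>x\<in>Si. V x = \<omega> x"
    using uV by (elim exE conjE)
  have "continuous_on (closure D) (\<lambda>x. V x - grad p x)"
    unfolding grad_def[of p]
    by (intro continuous_on_diff V(1) continuous_on_vec_lambda C1_on_D(2)[OF p1])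
  moreover have "grad (\<lambda>x. u x - p x) x = grad u x - grad p x" if "x \<in> D" for x
    using C1_on_D(1)[OF C2_on_D(1)[OF u2] that] C1_on_D(1)[OF p1[of UNIV] UNIV_I]
    by (simp add: vec_eq_iff pd_diff)
  ultimately have "\<exists>V. continuous_on (closure D) V \<and> (\<forall>x\<in>D. V x = grad (\<lambda>x. u x - p x) x) \<and> (\<forall>x\<in>Si. V x = \<omega> x - grad p x)"
    using V(2,3) by (intro exI[of _ "\<lambda>x. V x - grad p x"]) simp
  then show ?thesis
    unfolding solves_ivp_def
    using C2_on_diff[OF D(1) u2 p2] continuous_on_diff[OF uc C1_on_D(3)[OF p1]] L_op_diff[OF D(1) u2 p2] uL ug
    by simp
qed

theorem theorem6p4:
  fixes \<Omega> D Si Se :: "(real^'m::finite) set"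
    and h :: "real^'m \<Rightarrow> real^'m^'m"
    and b :: "real^'m \<Rightarrow> real^'m"
    and c t :: "real^'m \<Rightarrow> real"
    and n :: nat and s0 s1 :: real
  assumes "CARD('m) = n + 1"
    and "open \<Omega>" and "connected \<Omega>"
    and "\<And>i j. C1_on \<Omega> (\<lambda>x. h x $ i $ j)"
    and "\<And>x. x \<in> \<Omega> \<Longrightarrow> transpose (h x) = h x"
    and "\<And>x. x \<in> \<Omega> \<Longrightarrow> has_signature (h x) n 1"
    and "continuous_on \<Omega> b" and "continuous_on \<Omega> c"
    and "open D" and "bounded D" and "closure D \<subseteq> \<Omega>"
    and "frontier D = Si \<union> Se"
    and "spacelike_surface h \<Omega> Si" and "spacelike_surface h \<Omega> Se"
    and "spacelike_sweeping h D t s0 s1"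
    and "Se = sweep D t s1"
  shows "\<exists>C>0. \<forall>f g \<omega> u P Q p.
     solves_ivp h b c D Si f g \<omega> u \<and>
     finite P \<and> P \<subseteq> D \<and> finite Q \<and> Q \<subseteq> Si \<and>
     interpolation_polynomial h b c P Q f g \<omega> p \<longrightarrow>
       solves_ivp h b c D Si (\<lambda>x. f x - L_op h b c p x) (\<lambda>x. g x - p x) (\<lambda>x. \<omega> x - grad p x)
         (\<lambda>x. u x - p x) \<and>
       (\<forall>s\<in>{s0..s1}.
          (\<integral>\<^sup>+x\<in>swept D t s. ennreal (\<bar>u x - p x\<bar>\<^sup>2) \<partial>lborel)
          \<le> (\<integral>\<^sup>+x\<in>Si \<inter> swept D t s. ennreal (\<bar>g x - p x\<bar>\<^sup>2) \<partial>hausdorff_measure n)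
            + ennreal (C * (s - s0)) *
                (\<integral>\<^sup>+x\<in>Si. ennreal (\<bar>g x - p x\<bar>\<^sup>2 + (norm (\<omega> x - grad p x))\<^sup>2) \<partial>hausdorff_measure n)
            + ennreal C *
                (\<integral>\<^sup>+x\<in>swept D t s. ennreal (\<bar>f x - L_op h b c p x\<bar>\<^sup>2) \<partial>lborel))"
proof -
  have "\<exists>C>0. \<forall>f g \<omega> w. solves_ivp h b c D Si f g \<omega> w \<longrightarrow>
       (\<forall>s\<in>{s0..s1}.
          (\<integral>\<^sup>+x\<in>swept D t s. ennreal ((w x)\<^sup>2) \<partial>lborel)
          \<le> ennreal (C * (s - s0)) * (\<integral>\<^sup>+x\<in>Si. ennreal ((g x)\<^sup>2 + (norm (\<omega> x))\<^sup>2) \<partial>hausdorff_measure n)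
            + ennreal C * (\<integral>\<^sup>+x\<in>swept D t s. ennreal ((f x)\<^sup>2) \<partial>lborel))"
    by (rule initial_value_estimate[OF assms(1,4-13,15,16)])
  then obtain C where C: "C > 0" "\<forall>f g \<omega> w. solves_ivp h b c D Si f g \<omega> w \<longrightarrow>
       (\<forall>s\<in>{s0..s1}.
          (\<integral>\<^sup>+x\<in>swept D t s. ennreal ((w x)\<^sup>2) \<partial>lborel)
          \<le> ennreal (C * (s - s0)) * (\<integral>\<^sup>+x\<in>Si. ennreal ((g x)\<^sup>2 + (norm (\<omega> x))\<^sup>2) \<partial>hausdorff_measure n)
            + ennreal C * (\<integral>\<^sup>+x\<in>swept D t s. ennreal ((f x)\<^sup>2) \<partial>lborel))"
    by (elim exE conjE)
  have SiK: "Si \<subseteq> closure D" using assms(12) by (auto simp: frontier_def)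
  show ?thesis
  proof (intro exI[of _ C] conjI allI impI ballI C(1))
    fix f g \<omega> u P Q p
    assume A: "solves_ivp h b c D Si f g \<omega> u \<and> finite P \<and> P \<subseteq> D \<and> finite Q \<and> Q \<subseteq> Si \<and>
      interpolation_polynomial h b c P Q f g \<omega> p"
    then have u: "solves_ivp h b c D Si f g \<omega> u" and p: "real_polynomial_function p"
      by (simp_all add: interpolation_polynomial_def)
    show w: "solves_ivp h b c D Si (\<lambda>x. f x - L_op h b c p x) (\<lambda>x. g x - p x) (\<lambda>x. \<omega> x - grad p x) (\<lambda>x. u x - p x)"
      by (rule solves_ivp_diff_polynomial[OF assms(9) SiK u p])
    fix s assume s: "s \<in> {s0..s1}"
    from C(2)[rule_format, OF w s]
    show "(\<integral>\<^sup>+x\<in>swept D t s. ennreal (\<bar>u x - p x\<bar>\<^sup>2) \<partial>lborel)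
          \<le> (\<integral>\<^sup>+x\<in>Si \<inter> swept D t s. ennreal (\<bar>g x - p x\<bar>\<^sup>2) \<partial>hausdorff_measure n)
            + ennreal (C * (s - s0)) *
                (\<integral>\<^sup>+x\<in>Si. ennreal (\<bar>g x - p x\<bar>\<^sup>2 + (norm (\<omega> x - grad p x))\<^sup>2) \<partial>hausdorff_measure n)
            + ennreal C *
                (\<integral>\<^sup>+x\<in>swept D t s. ennreal (\<bar>f x - L_op h b c p x\<bar>\<^sup>2) \<partial>lborel)"
      \<comment> \<open>The estimate for w yields the last two terms; the integral over the swept
        part of \<open>Si\<close> is nonnegative and is added on the right.\<close>
      unfolding power2_abs add.assoc by (rule order_trans) (simp add: add_increasing)
  qed
qed

end
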